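(* Let $n\ge 2$, let $M^n$ be a closed connected smooth $n$-dimensional manifold, let $\lambda\in\mathbb{R}$ be a constant, and let $x:M^n\to\mathbb{R}^{n+1}$ be a smooth immersion which is a $\lambda$-self-expander, i.e. $H-\frac12\langle x,\xi\rangle=\lambda$ on $M^n$. If the scalar curvature $R$ of $M^n$ satisfies $$R\ \ge\ \frac{n-2}{n-1}H^2\ >\ 0$$ everywhere on $M^n$, then $R=\frac{n-1}{n}H^2$ on $M^n$ and $M^n$ is a round sphere centered at the origin.
   Context: Let $x:M^n\to\mathbb{R}^{n+1}$ be an immersed hypersurface with the induced metric $I=\langle dx,dx\rangle$, and let $\xi$ be its smooth global unit normal field, called the inward unit normal (for a round sphere centered at the origin it points towards the center). For a local orthonormal frame $e_1,\dots,e_n$ with dual coframe $\omega_1,\dots,\omega_n$, the second fundamental form $h=\sum_{i,j}h_{ij}\,\omega_i\otimes\omega_j$ is given by $d\xi=-\sum_{i,j}h_{ij}\omega_j e_i$. The mean curvature is the trace $H=\sum_i h_{ii}$ (not divided by $n$; so the round sphere of radius $r$ has $H=n/r$), and $S=|h|^2=\sum_{i,j}h_{ij}^2$. $R$ is the scalar curvature of the induced metric (the full trace of the Ricci tensor); by the Gauss equation $R=H^2-S$. "Closed" means compact without boundary. The immersion $x$ is a $\lambda$-self-expander if $H-\frac12\langle x,\xi\rangle=\lambda$ on $M^n$ for the constant $\lambda$. "$M^n$ is a round sphere centered at the origin" means that $x(M^n)=\{y\in\mathbb{R}^{n+1}:|y|=r\}$ for some $r>0$. *)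

theory Defs
  imports "HOL-Analysis.Analysis"
begin

section \<open>Smooth maps between Euclidean spaces\<close>

(* Meant for open S; in finite dimension, continuity of all iterated directional derivatives
   is the usual C^k condition. *)
primrec Ck_on :: "nat \<Rightarrow> 'a::euclidean_space set \<Rightarrow> ('a \<Rightarrow> 'b::euclidean_space) \<Rightarrow> bool" where
  "Ck_on 0 S f \<longleftrightarrow> continuous_on S f"
| "Ck_on (Suc k) S f \<longleftrightarrow>
     (\<forall>u\<in>S. f differentiable (at u)) \<and>
     (\<forall>v. Ck_on k S (\<lambda>u. frechet_derivative f (at u) v))"

definition smooth_on :: "'a::euclidean_space set \<Rightarrow> ('a \<Rightarrow> 'b::euclidean_space) \<Rightarrow> bool" where
  "smooth_on S f \<longleftrightarrow> (\<forall>k. Ck_on k S f)"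


section \<open>Smooth manifolds\<close>

(* A chart (U, \<phi>) consists of a coordinate domain U and a coordinate map \<phi>.
   Only the values of \<phi> on U matter. *)
type_synonym ('p, 'n) chart = "'p set \<times> ('p \<Rightarrow> real^'n)"

definition is_chart :: "'p topology \<Rightarrow> ('p, 'n::finite) chart \<Rightarrow> bool" where
  "is_chart M = (\<lambda>(U, \<phi>). openin M U \<and> open (\<phi> ` U) \<and>
     homeomorphic_map (subtopology M U) (top_of_set (\<phi> ` U)) \<phi>)"

definition coords :: "('p, 'n) chart \<Rightarrow> (real^'n) set" where
  "coords = (\<lambda>(U, \<phi>). \<phi> ` U)"

(* The expression f \<circ> \<phi>\<inverse> of a map f in a chart; meaningful on coords c. *)
definition local_expr :: "('p, 'n) chart \<Rightarrow> ('p \<Rightarrow> 'b) \<Rightarrow> real^'n \<Rightarrow> 'b" where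
  "local_expr = (\<lambda>(U, \<phi>) f. f \<circ> inv_into U \<phi>)"

definition smoothly_compatible :: "('p, 'n::finite) chart \<Rightarrow> ('p, 'n) chart \<Rightarrow> bool" where
  "smoothly_compatible c d \<longleftrightarrow> smooth_on (snd c ` (fst c \<inter> fst d)) (local_expr c (snd d))"

(* The atlas need not be maximal. Charts map onto open subsets of real^'n,
   so there is no boundary. *)
definition smooth_manifold :: "'p topology \<Rightarrow> ('p, 'n::finite) chart set \<Rightarrow> bool" where
  "smooth_manifold M A \<longleftrightarrow>
     Hausdorff_space M \<and> second_countable M \<and>
     (\<forall>c\<in>A. is_chart M c) \<and> (\<Union>c\<in>A. fst c) = topspace M \<and>
     (\<forall>c\<in>A. \<forall>d\<in>A. smoothly_compatible c d)"

definition smooth_map :: "('p, 'n::finite) chart set \<Rightarrow> ('p \<Rightarrow> 'b::euclidean_space) \<Rightarrow> bool" where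
  "smooth_map A f \<longleftrightarrow> (\<forall>c\<in>A. smooth_on (coords c) (local_expr c f))"

definition smooth_immersion :: "('p, 'n::finite) chart set \<Rightarrow> ('p \<Rightarrow> 'b::euclidean_space) \<Rightarrow> bool" where
  "smooth_immersion A f \<longleftrightarrow> smooth_map A f \<and>
     (\<forall>c\<in>A. \<forall>u\<in>coords c. inj (frechet_derivative (local_expr c f) (at u)))"

definition chart_at :: "('p, 'n) chart set \<Rightarrow> 'p \<Rightarrow> ('p, 'n) chart" where
  "chart_at A p = (SOME c. c \<in> A \<and> p \<in> fst c)"


section \<open>Curvature in coordinates\<close>

definition partial :: "'n::finite \<Rightarrow> (real^'n \<Rightarrow> 'b::real_normed_vector) \<Rightarrow> real^'n \<Rightarrow> 'b" where
  "partial i f u = frechet_derivative f (at u) (axis i 1)"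

(* The trace g^{ij} b_{ij} of a bilinear form b with respect to an inner product g. *)
definition metric_trace :: "real^'n::finite^'n \<Rightarrow> real^'n^'n \<Rightarrow> real" where
  "metric_trace g b = (\<Sum>i\<in>UNIV. \<Sum>j\<in>UNIV. matrix_inv g $ i $ j * b $ i $ j)"

(* metric_trace is the sum of the diagonal entries of b in any g-orthonormal frame E. *)
lemma metric_trace_orthonormal_frame:
  fixes E :: "'n::finite \<Rightarrow> real^'n" and g b :: "real^'n^'n"
  assumes "\<And>k l. E k \<bullet> (g *v E l) = (if k = l then 1 else 0)"
  shows "metric_trace g b = (\<Sum>k\<in>UNIV. E k \<bullet> (b *v E k))"
proof -
  define P :: "real^'n^'n" where "P = (\<chi> i j. E j $ i)"
  have "(transpose P ** (g ** P)) $ k $ l = mat 1 $ k $ l" for k l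
    using assms[of k l]
    by (simp add: P_def matrix_matrix_mult_def matrix_vector_mult_def transpose_def mat_def
        inner_vec_def)
  then have "transpose P ** (g ** P) = mat 1"
    by (simp add: vec_eq_iff)
  then have 1: "P ** (transpose P ** g) = mat 1"
    by (metis matrix_left_right_inverse matrix_mul_assoc)
  then have 2: "(P ** transpose P) ** g = mat 1" "g ** (P ** transpose P) = mat 1"
    by (metis matrix_left_right_inverse matrix_mul_assoc)+
  then have "\<exists>A'. g ** A' = mat 1 \<and> A' ** g = mat 1" by blast
  then have "g ** matrix_inv g = mat 1 \<and> matrix_inv g ** g = mat 1"
    unfolding matrix_inv_def by (rule someI_ex)
  then have inv: "matrix_inv g = P ** transpose P"
    using 2 by (metis matrix_mul_assoc matrix_mul_lid matrix_mul_rid)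
  have "metric_trace g b = (\<Sum>i\<in>UNIV. \<Sum>j\<in>UNIV. \<Sum>k\<in>UNIV. E k $ i * (b $ i $ j * E k $ j))"
    by (simp add: metric_trace_def inv P_def matrix_matrix_mult_def transpose_def
        sum_distrib_left sum_distrib_right mult_ac)
  also have "\<dots> = (\<Sum>i\<in>UNIV. \<Sum>k\<in>UNIV. \<Sum>j\<in>UNIV. E k $ i * (b $ i $ j * E k $ j))"
    by (rule sum.cong[OF refl], rule sum.swap)
  also have "\<dots> = (\<Sum>k\<in>UNIV. \<Sum>i\<in>UNIV. \<Sum>j\<in>UNIV. E k $ i * (b $ i $ j * E k $ j))"
    by (rule sum.swap)
  also have "\<dots> = (\<Sum>k\<in>UNIV. E k \<bullet> (b *v E k))"
    by (simp add: inner_vec_def matrix_vector_mult_def sum_distrib_left)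
  finally show ?thesis .
qed

definition first_fundamental_form :: "(real^'n::finite \<Rightarrow> 'b::real_inner) \<Rightarrow> real^'n \<Rightarrow> real^'n^'n" where
  "first_fundamental_form X u = (\<chi> i j. partial i X u \<bullet> partial j X u)"

(* From d\<xi> = - \<Sum> h_ij \<omega>_j e_i: the value h(v, w) is - \<langle>d\<xi>(w), dx(v)\<rangle>. *)
definition second_fundamental_form ::
    "(real^'n::finite \<Rightarrow> 'b::real_inner) \<Rightarrow> (real^'n \<Rightarrow> 'b) \<Rightarrow> real^'n \<Rightarrow> real^'n^'n" where
  "second_fundamental_form X N u = (\<chi> i j. - (partial j N u \<bullet> partial i X u))"

(* Christoffel symbol \<Gamma>^k_{ij} of the metric g. *)
definition christoffel :: "(real^'n::finite \<Rightarrow> real^'n^'n) \<Rightarrow> 'n \<Rightarrow> 'n \<Rightarrow> 'n \<Rightarrow> real^'n \<Rightarrow> real" where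
  "christoffel g k i j u =
     (\<Sum>l\<in>UNIV. matrix_inv (g u) $ k $ l *
        (partial i (\<lambda>w. g w $ j $ l) u + partial j (\<lambda>w. g w $ i $ l) u
          - partial l (\<lambda>w. g w $ i $ j) u)) / 2"

(* Coefficients R^l_{ijk} with R(\<partial>_i, \<partial>_j) \<partial>_k = \<Sum>_l R^l_{ijk} \<partial>_l, where
   R(X, Y) = [\<nabla>_X, \<nabla>_Y] - \<nabla>_[X,Y]. *)
definition riemann ::
    "(real^'n::finite \<Rightarrow> real^'n^'n) \<Rightarrow> 'n \<Rightarrow> 'n \<Rightarrow> 'n \<Rightarrow> 'n \<Rightarrow> real^'n \<Rightarrow> real" where
  "riemann g l i j k u =
     partial i (christoffel g l j k) u - partial j (christoffel g l i k) u
     + (\<Sum>m\<in>UNIV. christoffel g l i m u * christoffel g m j k u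
                  - christoffel g l j m u * christoffel g m i k u)"

(* Ric(Y, Z) is the trace of X \<mapsto> R(X, Y) Z; it is positive on round spheres. *)
definition ricci :: "(real^'n::finite \<Rightarrow> real^'n^'n) \<Rightarrow> real^'n \<Rightarrow> real^'n^'n" where
  "ricci g u = (\<chi> j k. \<Sum>i\<in>UNIV. riemann g i i j k u)"


section \<open>Immersed hypersurfaces\<close>

(* The next two quantities are computed in an arbitrarily chosen chart around the point;
   their values do not depend on the chart. *)
definition mean_curvature ::
    "('p, 'n::finite) chart set \<Rightarrow> ('p \<Rightarrow> 'b::euclidean_space) \<Rightarrow> ('p \<Rightarrow> 'b) \<Rightarrow> 'p \<Rightarrow> real" where
  "mean_curvature A x \<xi> p =
     (let c = chart_at A p; u = snd c p; X = local_expr c x; N = local_expr c \<xi>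
      in metric_trace (first_fundamental_form X u) (second_fundamental_form X N u))"

definition scalar_curvature ::
    "('p, 'n::finite) chart set \<Rightarrow> ('p \<Rightarrow> 'b::euclidean_space) \<Rightarrow> 'p \<Rightarrow> real" where
  "scalar_curvature A x p =
     (let c = chart_at A p; u = snd c p; g = first_fundamental_form (local_expr c x)
      in metric_trace (g u) (ricci g u))"

definition unit_normal_field ::
    "'p topology \<Rightarrow> ('p, 'n::finite) chart set \<Rightarrow> ('p \<Rightarrow> 'b::euclidean_space) \<Rightarrow> ('p \<Rightarrow> 'b) \<Rightarrow> bool" where
  "unit_normal_field M A x \<xi> \<longleftrightarrow>
     smooth_map A \<xi> \<and> (\<forall>p\<in>topspace M. norm (\<xi> p) = 1) \<and>
     (\<forall>c\<in>A. \<forall>u\<in>coords c. \<forall>v.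
        local_expr c \<xi> u \<bullet> frechet_derivative (local_expr c x) (at u) v = 0)"

(* A general immersed hypersurface has no canonical inward side. The orientation is
   normalised only for round spheres centred at the origin, where \<xi> points to the centre;
   otherwise \<xi> may be either choice. Replacing \<xi> by -\<xi> changes the sign of H and of
   H - \<langle>x, \<xi>\<rangle>/2. *)
definition inward_unit_normal_field ::
    "'p topology \<Rightarrow> ('p, 'n::finite) chart set \<Rightarrow> ('p \<Rightarrow> 'b::euclidean_space) \<Rightarrow> ('p \<Rightarrow> 'b) \<Rightarrow> bool" where
  "inward_unit_normal_field M A x \<xi> \<longleftrightarrow>
     unit_normal_field M A x \<xi> \<and>
     (\<forall>r>0. x ` topspace M = sphere 0 r \<longrightarrow> (\<forall>p\<in>topspace M. \<xi> p = - (x p /\<^sub>R r)))"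

definition self_expander ::
    "'p topology \<Rightarrow> ('p, 'n::finite) chart set \<Rightarrow> ('p \<Rightarrow> 'b::euclidean_space) \<Rightarrow> ('p \<Rightarrow> 'b) \<Rightarrow> real \<Rightarrow> bool"
  where
  "self_expander M A x \<xi> lam \<longleftrightarrow>
     (\<forall>p\<in>topspace M. mean_curvature A x \<xi> p - 1/2 * (x p \<bullet> \<xi> p) = lam)"

definition round_sphere_centered_at_origin :: "'p topology \<Rightarrow> ('p \<Rightarrow> 'b::euclidean_space) \<Rightarrow> bool" where
  "round_sphere_centered_at_origin M x \<longleftrightarrow> (\<exists>r>0. x ` topspace M = sphere 0 r)"

end

(* A maximum principle for the ratio of the smallest principal curvature to H.  After replacing \<xi> by
   -\<xi> and lam by -lam if necessary, H > 0.  With S = |h|^2 and the Gauss equation R = H^2 - S, the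
   hypothesis says (n-1) S <= H^2, which forces all principal curvatures to be nonnegative.

   Let P = <x,\<xi>>, so H = lam + P/2, and let m be the smallest principal curvature divided by H.  Put
   w = |x|^2/2 + 2(n-1) ln H.  Simons' identity and the expander equation give, at a point where m - eps w
   is minimal (eps >= 0),
     eps (1 + H P (1 - (n-1) S / H^2)) <= lam m (m H - S/H).
   Moreover lam > 0, as one sees at a point farthest from the origin, the right-hand side is nonpositive,
   and pinching gives 0 <= 1 - (n-1) S/H^2 <= 2 m.  For eps > 0 this bounds m away from 0; letting eps
   tend to 0 this holds everywhere, so no strong maximum principle is needed.  For eps = 0 the
   inequality then forces all principal curvatures to coincide at the minimum of m; hence m = 1/n
   there, and therefore everywhere.

   An umbilic expander has dH = 0 by Codazzi, hence <x,dx> = 0 and |x| is constant.  The image is the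
   whole sphere: for y on the sphere, a maximum point of <x,y> is mapped to y or -y, and the latter
   would make x constant. *)
theory Submission
  imports Defs
begin

section \<open>Calculus of smooth maps\<close>

text \<open>The obstacle is that the smallest principal curvature need not be smooth, so it is never
  differentiated. The minimum is taken over all pairs of a point and a unit tangent vector, a
  compact set. Near the minimizing pair the vector is extended by a coordinate field
  \<open>partial e Y\<close>; the quotient \<open>h_ee / (g_ee * H)\<close> is then smooth and,
  minus \<open>eps\<close> times the barrier, has a local minimum. Coordinates with orthonormal
  frame and vanishing Christoffel symbols at the point replace covariant derivatives, so Simons'
  identity becomes a comparison of third and fourth partial derivatives of the immersion. The weight
  2(n-1) of ln H comes from a cancellation. The Laplacian of |x|^2/2 is n + H P, while the expander
  equation makes (Laplacian H)/H equal to -(1 + S P/H)/2 up to a gradient term. Weighted by 2(n-1)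
  and added, this leaves 1 + H P (1 - (n-1) S/H^2), and the remaining gradient terms have a
  favourable sign for n >= 2. A small m would make the last factor small and leave the constant 1
  facing a nonpositive right-hand side.\<close>

lemma Ck_on_cong:
  assumes "open S" and "\<And>u. u \<in> S \<Longrightarrow> f u = g u"
  shows "Ck_on k S f \<longleftrightarrow> Ck_on k S g"
proof -
  have "Ck_on k S g" if "Ck_on k S f" and "\<And>u. u \<in> S \<Longrightarrow> f u = g u" for f g :: "'a \<Rightarrow> 'b"
    using that
  proof (induction k arbitrary: f g)
    case 0
    then show ?case by (simp cong: continuous_on_cong)
  next
    case (Suc k)
    have "g differentiable (at u)" if "u \<in> S" for u
    proof -
      have "(f has_derivative frechet_derivative f (at u)) (at u)"
        using Suc.prems that by (simp add: frechet_derivative_works)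
      then have "(g has_derivative frechet_derivative f (at u)) (at u)"
        by (rule has_derivative_transform_within_open[OF _ assms(1) that]) (simp add: Suc.prems)
      then show ?thesis by (rule Derivative.differentiableI)
    qed
    moreover have "Ck_on k S (\<lambda>u. frechet_derivative g (at u) v)" for v
    proof (rule Suc.IH)
      show "Ck_on k S (\<lambda>u. frechet_derivative f (at u) v)" using Suc.prems by simp
      show "frechet_derivative f (at u) v = frechet_derivative g (at u) v" if "u \<in> S" for u
        using Suc.prems that
        by (metis assms(1) Ck_on.simps(2) frechet_derivative_transform_within_open)
    qed
    ultimately show ?case by simp
  qed
  with assms(2) show ?thesis by metis
qed

lemma Ck_on_SucD: "Ck_on (Suc k) S f \<Longrightarrow> Ck_on k S f"
proof (induction k arbitrary: f)
  case 0
  then show ?case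
    by (auto intro!: differentiable_imp_continuous_on simp: differentiable_on_def
        differentiable_at_withinI)
next
  case (Suc k)
  from Suc.prems have "\<forall>u\<in>S. f differentiable (at u)"
    and "\<forall>v. Ck_on (Suc k) S (\<lambda>u. frechet_derivative f (at u) v)"
    by simp_all
  with Suc.IH show ?case by simp
qed

lemma Ck_on_subset: "Ck_on k S f \<Longrightarrow> T \<subseteq> S \<Longrightarrow> Ck_on k T f"
  by (induction k arbitrary: f) (auto intro: continuous_on_subset)

lemma Ck_on_const: "Ck_on k S (\<lambda>u. c)"
  by (induction k arbitrary: c) auto

lemma Ck_on_linear:
  assumes "bounded_linear f"
  shows "Ck_on k S f"
proof (cases k)
  case 0
  then show ?thesis by (simp add: linear_continuous_on assms)
next
  case (Suc k)
  have "(f has_derivative f) (at u)" for u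
    by (rule bounded_linear_imp_has_derivative[OF assms])
  then have "f differentiable (at u)" "frechet_derivative f (at u) = f" for u
    by (blast intro: Derivative.differentiableI, metis frechet_derivative_at)
  with Suc show ?thesis by (simp add: Ck_on_const)
qed

lemma frechet_derivative_add:
  "f differentiable (at u) \<Longrightarrow> g differentiable (at u) \<Longrightarrow>
    frechet_derivative (\<lambda>x. f x + g x) (at u) = (\<lambda>v. frechet_derivative f (at u) v + frechet_derivative g (at u) v)"
  by (rule frechet_derivative_at[symmetric])
     (auto intro!: has_derivative_add simp: frechet_derivative_works)

lemma Ck_on_add: "Ck_on k S f \<Longrightarrow> Ck_on k S g \<Longrightarrow> Ck_on k S (\<lambda>u. f u + g u)" if "open S"
proof (induction k arbitrary: f g)
  case 0
  then show ?case by (simp add: continuous_on_add)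
next
  case (Suc k)
  have "Ck_on k S (\<lambda>u. frechet_derivative (\<lambda>u. f u + g u) (at u) v) \<longleftrightarrow>
     Ck_on k S (\<lambda>u. frechet_derivative f (at u) v + frechet_derivative g (at u) v)" for v
    using Suc.prems by (intro Ck_on_cong that) (simp add: frechet_derivative_add)
  with Suc show ?case by simp
qed

lemma (in bounded_bilinear) frechet_derivative_prod:
  "f differentiable (at u) \<Longrightarrow> g differentiable (at u) \<Longrightarrow>
    frechet_derivative (\<lambda>x. prod (f x) (g x)) (at u) =
     (\<lambda>v. prod (f u) (frechet_derivative g (at u) v) + prod (frechet_derivative f (at u) v) (g u))"
  by (rule frechet_derivative_at[symmetric])
     (auto intro!: FDERIV simp: frechet_derivative_works)

lemma Ck_on_bilinear:
  assumes "open S" and "bounded_bilinear prd"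
  shows "Ck_on k S f \<Longrightarrow> Ck_on k S g \<Longrightarrow> Ck_on k S (\<lambda>u. prd (f u) (g u))"
proof (induction k arbitrary: f g)
  case 0
  then show ?case by (simp add: bounded_bilinear.continuous_on[OF assms(2)])
next
  case (Suc k)
  have "Ck_on k S (\<lambda>u. frechet_derivative (\<lambda>u. prd (f u) (g u)) (at u) v) \<longleftrightarrow>
     Ck_on k S (\<lambda>u. prd (f u) (frechet_derivative g (at u) v) + prd (frechet_derivative f (at u) v) (g u))" for v
    using Suc.prems
    by (intro Ck_on_cong assms) (simp add: bounded_bilinear.frechet_derivative_prod[OF assms(2)])
  moreover have "Ck_on k S f" "Ck_on k S g" using Suc.prems Ck_on_SucD by blast+
  moreover have "(\<lambda>u. prd (f u) (g u)) differentiable (at u)" if "u \<in> S" for u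
    using Suc.prems that bounded_bilinear.FDERIV[OF assms(2)]
    unfolding differentiable_def Ck_on.simps by blast
  ultimately show ?case using Suc by (simp add: Ck_on_add[OF assms(1)])
qed

lemma Ck_on_sum:
  assumes "open S" "\<And>i. i \<in> I \<Longrightarrow> Ck_on k S (f i)"
  shows "Ck_on k S (\<lambda>u. \<Sum>i\<in>I. f i u)"
  using assms(2)
proof (induction I rule: infinite_finite_induct)
  case (insert i I)
  then show ?case by (simp add: Ck_on_add[OF assms(1)])
qed (auto simp: Ck_on_const)

text \<open>By the chain rule a derivative of the composite is a finite sum of components of the
  derivative of \<open>t\<close> times directional derivatives of \<open>f\<close> composed with the
  same \<open>t\<close>. Hence the induction generalises over \<open>f\<close> only.\<close>

lemma Ck_on_compose:
  fixes f :: "'b::euclidean_space \<Rightarrow> 'c::euclidean_space" and t :: "'a::euclidean_space \<Rightarrow> 'b"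
  assumes "open S" "open T" "t ` T \<subseteq> S"
  shows "Ck_on k S f \<Longrightarrow> Ck_on k T t \<Longrightarrow> Ck_on k T (\<lambda>u. f (t u))"
proof (induction k arbitrary: f)
  case 0
  then show ?case using assms(3) by (auto intro: continuous_on_compose2)
next
  case (Suc k)
  have fd: "f differentiable (at (t u))" and td: "t differentiable (at u)" if "u \<in> T" for u
    using Suc.prems assms(3) that by auto
  have der: "((\<lambda>u. f (t u)) has_derivative
      (\<lambda>v. frechet_derivative f (at (t u)) (frechet_derivative t (at u) v))) (at u)"
    if "u \<in> T" for u
    using diff_chain_at[of t "frechet_derivative t (at u)" u f "frechet_derivative f (at (t u))"]
      fd[OF that] td[OF that] by (simp add: frechet_derivative_works o_def)
  have "frechet_derivative (\<lambda>u. f (t u)) (at u) v =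
    (\<Sum>b\<in>Basis. (frechet_derivative t (at u) v \<bullet> b) *\<^sub>R frechet_derivative f (at (t u)) b)"
    if "u \<in> T" for u v
  proof -
    have lin: "linear (frechet_derivative f (at (t u)))"
      using fd[OF that] by (rule linear_frechet_derivative)
    have "frechet_derivative (\<lambda>u. f (t u)) (at u) v
       = frechet_derivative f (at (t u)) (frechet_derivative t (at u) v)"
      using frechet_derivative_at[OF der[OF that]] by metis
    also have "\<dots> = frechet_derivative f (at (t u)) (\<Sum>b\<in>Basis. (frechet_derivative t (at u) v \<bullet> b) *\<^sub>R b)"
      by (simp add: euclidean_representation)
    finally show ?thesis by (simp add: linear_sum[OF lin] linear_scale[OF lin])
  qed
  moreover have "Ck_on k T (\<lambda>u. (\<Sum>b\<in>Basis. (frechet_derivative t (at u) v \<bullet> b) *\<^sub>R frechet_derivative f (at (t u)) b))" for v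
  proof (intro Ck_on_sum assms Ck_on_bilinear[OF assms(2) bounded_bilinear_scaleR]
      Ck_on_bilinear[OF assms(2) bounded_bilinear_inner])
    show "Ck_on k T (\<lambda>u. frechet_derivative f (at (t u)) b)" for b
      using Suc.prems Ck_on_SucD by (intro Suc.IH) auto
  qed (use Suc.prems in \<open>simp_all add: Ck_on_const\<close>)
  ultimately have "Ck_on k T (\<lambda>u. frechet_derivative (\<lambda>u. f (t u)) (at u) v)" for v
    using Ck_on_cong[OF assms(2)] by (metis (no_types, lifting))
  moreover have "(\<lambda>u. f (t u)) differentiable (at u)" if "u \<in> T" for u
    using der[OF that] by (rule Derivative.differentiableI)
  ultimately show ?case by simp
qed

text \<open>The derivative of 1/f is a product of f' with two copies of 1/f, to which the induction
  hypothesis applies at one order less.\<close>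

lemma Ck_on_inverse:
  fixes f :: "'a::euclidean_space \<Rightarrow> real"
  assumes "open S" and nz: "\<And>u. u \<in> S \<Longrightarrow> f u \<noteq> 0"
  shows "Ck_on k S f \<Longrightarrow> Ck_on k S (\<lambda>u. inverse (f u))"
proof (induction k)
  case 0
  then show ?case using nz by (auto intro: continuous_on_inverse)
next
  case (Suc k)
  have der: "((\<lambda>u. inverse (f u)) has_derivative
      (\<lambda>v. - (inverse (f u) * frechet_derivative f (at u) v * inverse (f u)))) (at u)"
    if "u \<in> S" for u
    using Suc.prems that nz[OF that]
    by (intro Deriv.has_derivative_inverse) (auto simp: frechet_derivative_works)
  have C: "Ck_on k S (\<lambda>u. -1 * (inverse (f u) * frechet_derivative f (at u) v * inverse (f u)))" for v
    using Suc Ck_on_SucD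
    by (intro Ck_on_bilinear[OF assms(1) bounded_bilinear_mult]) (auto simp: Ck_on_const)
  have "Ck_on k S (\<lambda>u. frechet_derivative (\<lambda>u. inverse (f u)) (at u) v)" for v
    by (rule iffD1[OF Ck_on_cong[OF assms(1)], rotated, OF C[of v]])
      (simp add: frechet_derivative_at[OF der, symmetric])
  moreover have "(\<lambda>u. inverse (f u)) differentiable (at u)" if "u \<in> S" for u
    using der[OF that] by (rule Derivative.differentiableI)
  ultimately show ?case by simp
qed

text \<open>A case distinction suffices in place of an induction, because the derivative f'/f is
  covered by \<open>Ck_on_inverse\<close>.\<close>

lemma Ck_on_ln:
  fixes f :: "'a::euclidean_space \<Rightarrow> real"
  assumes "open S" and pos: "\<And>u. u \<in> S \<Longrightarrow> f u > 0" and "Ck_on k S f"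
  shows "Ck_on k S (\<lambda>u. ln (f u))"
proof (cases k)
  case 0
  then show ?thesis using assms by (auto intro!: continuous_on_ln simp: less_imp_neq[symmetric])
next
  case (Suc k')
  have der: "((\<lambda>u. ln (f u)) has_derivative (\<lambda>v. frechet_derivative f (at u) v * inverse (f u))) (at u)"
    if "u \<in> S" for u
    using assms Suc that pos[OF that]
    by (auto intro!: derivative_eq_intros simp: frechet_derivative_works field_simps)
  have C: "Ck_on k' S (\<lambda>u. frechet_derivative f (at u) v * inverse (f u))" for v
    using assms Suc Ck_on_SucD
    by (intro Ck_on_bilinear[OF assms(1) bounded_bilinear_mult] Ck_on_inverse)
      (auto simp: less_imp_neq[symmetric] dest: pos)
  have "Ck_on k' S (\<lambda>u. frechet_derivative (\<lambda>u. ln (f u)) (at u) v)" for v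
    by (rule iffD1[OF Ck_on_cong[OF assms(1)], rotated, OF C[of v]])
      (simp add: frechet_derivative_at[OF der, symmetric])
  moreover have "(\<lambda>u. ln (f u)) differentiable (at u)" if "u \<in> S" for u
    using der[OF that] by (rule Derivative.differentiableI)
  ultimately show ?thesis using Suc by simp
qed

section \<open>Closure properties of smooth functions, up to inverse matrices\<close>

lemma smooth_on_differentiable: "smooth_on S f \<Longrightarrow> u \<in> S \<Longrightarrow> f differentiable (at u)"
  unfolding smooth_on_def by (metis Ck_on.simps(2))

lemma smooth_on_frechet_derivative:
  "smooth_on S f \<Longrightarrow> smooth_on S (\<lambda>u. frechet_derivative f (at u) v)"
  unfolding smooth_on_def by (metis Ck_on.simps(2))

lemma smooth_on_continuous_on: "smooth_on S f \<Longrightarrow> continuous_on S f"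
  unfolding smooth_on_def by (metis Ck_on.simps(1))

lemma smooth_on_partial: "smooth_on S f \<Longrightarrow> smooth_on S (partial i f)"
  using smooth_on_frechet_derivative[of S f "axis i 1"] by (simp add: partial_def[abs_def])

lemma smooth_on_cong:
  "open S \<Longrightarrow> (\<And>u. u \<in> S \<Longrightarrow> f u = g u) \<Longrightarrow> smooth_on S f \<longleftrightarrow> smooth_on S g"
  unfolding smooth_on_def by (metis Ck_on_cong)

lemma smooth_on_subset: "smooth_on S f \<Longrightarrow> T \<subseteq> S \<Longrightarrow> smooth_on T f"
  unfolding smooth_on_def by (metis Ck_on_subset)

lemma smooth_on_const [simp]: "smooth_on S (\<lambda>u. c)"
  unfolding smooth_on_def by (simp add: Ck_on_const)

lemma smooth_on_linear: "bounded_linear f \<Longrightarrow> smooth_on S f"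
  unfolding smooth_on_def by (simp add: Ck_on_linear)

lemma smooth_on_add: "open S \<Longrightarrow> smooth_on S f \<Longrightarrow> smooth_on S g \<Longrightarrow> smooth_on S (\<lambda>u. f u + g u)"
  unfolding smooth_on_def by (simp add: Ck_on_add)

lemma smooth_on_bilinear:
  "open S \<Longrightarrow> bounded_bilinear prd \<Longrightarrow> smooth_on S f \<Longrightarrow> smooth_on S g \<Longrightarrow>
    smooth_on S (\<lambda>u. prd (f u) (g u))"
  unfolding smooth_on_def by (simp add: Ck_on_bilinear)

lemmas smooth_on_mult = smooth_on_bilinear[OF _ bounded_bilinear_mult]
lemmas smooth_on_inner = smooth_on_bilinear[OF _ bounded_bilinear_inner]
lemmas smooth_on_scaleR = smooth_on_bilinear[OF _ bounded_bilinear_scaleR]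

lemma smooth_on_sum:
  "open S \<Longrightarrow> (\<And>i. i \<in> I \<Longrightarrow> smooth_on S (f i)) \<Longrightarrow> smooth_on S (\<lambda>u. \<Sum>i\<in>I. f i u)"
  unfolding smooth_on_def by (simp add: Ck_on_sum)

lemma smooth_on_compose:
  "open S \<Longrightarrow> open T \<Longrightarrow> t ` T \<subseteq> S \<Longrightarrow> smooth_on S f \<Longrightarrow> smooth_on T t \<Longrightarrow>
    smooth_on T (\<lambda>u. f (t u))"
  unfolding smooth_on_def by (metis Ck_on_compose)

lemma smooth_on_inverse:
  fixes f :: "'a::euclidean_space \<Rightarrow> real"
  shows "open S \<Longrightarrow> (\<And>u. u \<in> S \<Longrightarrow> f u \<noteq> 0) \<Longrightarrow> smooth_on S f \<Longrightarrow> smooth_on S (\<lambda>u. inverse (f u))"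
  unfolding smooth_on_def by (simp add: Ck_on_inverse)

lemma smooth_on_ln:
  fixes f :: "'a::euclidean_space \<Rightarrow> real"
  shows "open S \<Longrightarrow> (\<And>u. u \<in> S \<Longrightarrow> f u > 0) \<Longrightarrow> smooth_on S f \<Longrightarrow> smooth_on S (\<lambda>u. ln (f u))"
  unfolding smooth_on_def by (simp add: Ck_on_ln)

lemma smooth_on_prod:
  fixes f :: "'i \<Rightarrow> 'a::euclidean_space \<Rightarrow> real"
  assumes "open S" "\<And>i. i \<in> I \<Longrightarrow> smooth_on S (f i)"
  shows "smooth_on S (\<lambda>u. \<Prod>i\<in>I. f i u)"
  using assms(2)
proof (induction I rule: infinite_finite_induct)
  case (insert i I)
  then show ?case by (simp add: smooth_on_mult[OF assms(1)])
qed auto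

lemma smooth_on_det:
  fixes g :: "'a::euclidean_space \<Rightarrow> real^'n^'n"
  assumes "open S" "\<And>i j. smooth_on S (\<lambda>u. g u $ i $ j)"
  shows "smooth_on S (\<lambda>u. det (g u))"
  unfolding det_def
  by (intro smooth_on_sum smooth_on_mult smooth_on_prod assms smooth_on_const)

lemma invertible_matrix_inv:
  assumes "invertible (g :: real^'n^'n)"
  shows "g ** matrix_inv g = mat 1" "matrix_inv g ** g = mat 1"
proof -
  have "g ** matrix_inv g = mat 1 \<and> matrix_inv g ** g = mat 1"
    unfolding matrix_inv_def using assms unfolding invertible_def by (rule someI_ex)
  then show "g ** matrix_inv g = mat 1" "matrix_inv g ** g = mat 1" by auto
qed

text \<open>Cramer's rule writes an entry of the inverse as a quotient of determinants, and
  determinants are polynomials in the entries. In \<open>?c\<close> the column \<open>k\<close> is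
  replaced by the basis vector \<open>l\<close>.\<close>

lemma smooth_on_matrix_inv:
  fixes g :: "'a::euclidean_space \<Rightarrow> real^'n^'n"
  assumes "open S" "\<And>i j. smooth_on S (\<lambda>u. g u $ i $ j)" "\<And>u. u \<in> S \<Longrightarrow> invertible (g u)"
  shows "smooth_on S (\<lambda>u. matrix_inv (g u) $ k $ l)"
proof -
  let ?c = "\<lambda>u. (\<chi> i j. if j = k then axis l 1 $ i else g u $ i $ j) :: real^'n^'n"
  have "matrix_inv (g u) $ k $ l = det (?c u) * inverse (det (g u))" if "u \<in> S" for u
  proof -
    have "g u *v (matrix_inv (g u) *v axis l 1) = axis l 1"
      by (simp add: matrix_vector_mul_assoc invertible_matrix_inv assms(3)[OF that])
    then have "matrix_inv (g u) *v axis l 1 = (\<chi> k. det(\<chi> i j. if j=k then axis l 1 $ i else g u $ i $ j) / det (g u))"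
      using cramer[of "g u" "matrix_inv (g u) *v axis l 1" "axis l 1"] assms(3)[OF that]
      by (simp add: invertible_det_nz)
    then have "(matrix_inv (g u) *v axis l 1) $ k = det (?c u) * inverse (det (g u))"
      by (simp add: divide_inverse)
    then show ?thesis by (simp add: matrix_vector_mult_basis column_def)
  qed
  moreover have "smooth_on S (\<lambda>u. det (?c u) * inverse (det (g u)))"
  proof (intro smooth_on_mult smooth_on_inverse smooth_on_det assms)
    show "smooth_on S (\<lambda>u. ?c u $ i $ j)" for i j
      using assms(2)[of i j] by (cases "j = k") auto
    show "det (g u) \<noteq> 0" if "u \<in> S" for u
      using assms(3)[OF that] invertible_det_nz by blast
  qed
  ultimately show ?thesis using smooth_on_cong[OF assms(1)] by (metis (no_types, lifting))
qed


section \<open>Symmetry of second derivatives by mean values\<close>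

lemma has_real_derivative_along_line:
  fixes f :: "'a::euclidean_space \<Rightarrow> real"
  assumes "f differentiable (at (a + s *\<^sub>R v))"
  shows "((\<lambda>s. f (a + s *\<^sub>R v)) has_real_derivative frechet_derivative f (at (a + s *\<^sub>R v)) v) (at s)"
proof -
  have "((\<lambda>s. a + s *\<^sub>R v) has_derivative (\<lambda>t. t *\<^sub>R v)) (at s)"
    by (auto intro!: derivative_eq_intros)
  then have "(f \<circ> (\<lambda>s. a + s *\<^sub>R v) has_derivative frechet_derivative f (at (a + s *\<^sub>R v)) \<circ> (\<lambda>t. t *\<^sub>R v)) (at s)"
    using assms by (intro diff_chain_at) (auto simp: frechet_derivative_works)
  then show ?thesis
    unfolding has_field_derivative_def o_def
    using linear_scale[OF linear_frechet_derivative[OF assms]]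
    by (simp add: mult_commute_abs)
qed

text \<open>Two applications of the mean value theorem, along \<open>v\<close> and then along
  \<open>w\<close>. The left-hand side of the equation is symmetric in \<open>v\<close> and
  \<open>w\<close>, while the order of differentiation on the right is not; this is the source of
  the symmetry of mixed derivatives.\<close>

lemma second_difference_mean_value:
  fixes f :: "'a::euclidean_space \<Rightarrow> real"
  assumes "smooth_on S f" "t > 0"
    and S: "\<And>s r. 0 \<le> s \<Longrightarrow> s \<le> t \<Longrightarrow> 0 \<le> r \<Longrightarrow> r \<le> t \<Longrightarrow> u + s *\<^sub>R v + r *\<^sub>R w \<in> S"
  obtains s r where "0 < s" "s < t" "0 < r" "r < t"
    "f (u + t *\<^sub>R v + t *\<^sub>R w) - f (u + t *\<^sub>R v) - f (u + t *\<^sub>R w) + f u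
      = t * t * frechet_derivative (\<lambda>x. frechet_derivative f (at x) v) (at (u + s *\<^sub>R v + r *\<^sub>R w)) w"
proof -
  define F where "F s = f (u + t *\<^sub>R w + s *\<^sub>R v) - f (u + s *\<^sub>R v)" for s
  define G where "G x = frechet_derivative f (at x) v" for x
  have "smooth_on S G"
    unfolding G_def[abs_def] by (rule smooth_on_frechet_derivative[OF assms(1)])
  have "(F has_real_derivative G (u + t *\<^sub>R w + s *\<^sub>R v) - G (u + s *\<^sub>R v)) (at s)"
    if "0 \<le> s" "s \<le> t" for s
    unfolding F_def G_def
    using S[of s t] S[of s 0] that assms
    by (intro DERIV_diff has_real_derivative_along_line smooth_on_differentiable[OF assms(1)])
      (auto simp: add_ac)
  from MVT2[OF assms(2) this] obtain s where s: "0 < s" "s < t"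
    "F t - F 0 = t * (G (u + t *\<^sub>R w + s *\<^sub>R v) - G (u + s *\<^sub>R v))" by auto
  have "((\<lambda>r. G (u + s *\<^sub>R v + r *\<^sub>R w)) has_real_derivative
      frechet_derivative G (at (u + s *\<^sub>R v + r *\<^sub>R w)) w) (at r)"
    if "0 \<le> r" "r \<le> t" for r
    using S[of s r] that s
    by (intro has_real_derivative_along_line smooth_on_differentiable[OF \<open>smooth_on S G\<close>]) auto
  from MVT2[OF assms(2) this] obtain r where r: "0 < r" "r < t"
    "G (u + s *\<^sub>R v + t *\<^sub>R w) - G (u + s *\<^sub>R v)
      = t * frechet_derivative G (at (u + s *\<^sub>R v + r *\<^sub>R w)) w" by auto
  show ?thesis
  proof (rule that[OF s(1,2) r(1,2)])
    show "f (u + t *\<^sub>R v + t *\<^sub>R w) - f (u + t *\<^sub>R v) - f (u + t *\<^sub>R w) + f u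
      = t * t * frechet_derivative (\<lambda>x. frechet_derivative f (at x) v) (at (u + s *\<^sub>R v + r *\<^sub>R w)) w"
      using s(3) r(3) unfolding G_def[abs_def] F_def by (simp add: add_ac)
  qed
qed

text \<open>Each mixed derivative, evaluated at some point near \<open>u\<close>, equals the same
  second difference divided by t^2. Continuity at \<open>u\<close> makes the two values at
  \<open>u\<close> differ by at most any positive \<open>e\<close>.\<close>

lemma frechet_derivative_commute_real:
  fixes f :: "'a::euclidean_space \<Rightarrow> real"
  assumes "open S" "smooth_on S f" "u \<in> S"
  shows "frechet_derivative (\<lambda>x. frechet_derivative f (at x) v) (at u) w
    = frechet_derivative (\<lambda>x. frechet_derivative f (at x) w) (at u) v"
proof -
  define G where "G v w x = frechet_derivative (\<lambda>x. frechet_derivative f (at x) v) (at x) w" for v w x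
  have cont: "continuous_on S (G v w)" for v w
    unfolding G_def[abs_def] using assms(2)
    by (intro smooth_on_continuous_on smooth_on_frechet_derivative)
  have "dist (G v w u) (G w v u) \<le> e" if "e > 0" for e
  proof -
    have "\<exists>d>0. \<forall>x. dist x u < d \<longrightarrow> x \<in> S \<and> dist (G v w x) (G v w u) < e / 2" for v w
    proof -
      from assms obtain d1 where "d1 > 0" "ball u d1 \<subseteq> S" by (meson openE)
      moreover from cont[of v w] assms(3) \<open>e > 0\<close> obtain d2 where "d2 > 0"
        "\<forall>x\<in>S. dist x u < d2 \<longrightarrow> dist (G v w x) (G v w u) < e / 2"
        unfolding continuous_on_iff by (meson half_gt_zero)
      ultimately show ?thesis
        by (intro exI[of _ "min d1 d2"]) (auto simp: dist_commute subset_iff)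
    qed
    from this[of v w] this[of w v] obtain d1 d2 where
      d1: "d1 > 0" "\<And>x. dist x u < d1 \<Longrightarrow> x \<in> S \<and> dist (G v w x) (G v w u) < e / 2" and
      d2: "d2 > 0" "\<And>x. dist x u < d2 \<Longrightarrow> x \<in> S \<and> dist (G w v x) (G w v u) < e / 2"
      by blast
    define d where "d = min d1 d2"
    have "d > 0" using d1 d2 by (simp add: d_def)
    \<comment> \<open>Small enough for the whole parallelogram spanned by
      \<open>t *\<^sub>R v\<close> and \<open>t *\<^sub>R w\<close> to stay within distance
      \<open>d\<close> of \<open>u\<close>; the summand 1 covers the case that both vectors
      vanish.\<close>
    define t where "t = d / (2 * (norm v + norm w + 1))"
    have t: "t > 0" "t * (norm v + norm w) < d"
    proof -
      have *: "norm v + norm w + 1 > 0" by (simp add: add_nonneg_pos)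
      show "t > 0" unfolding t_def using \<open>d > 0\<close> * by simp
      have "t * (norm v + norm w + 1) = d / 2" unfolding t_def using * by (simp add: field_simps)
      moreover have "t * (norm v + norm w) \<le> t * (norm v + norm w + 1)"
        using \<open>t > 0\<close> by (simp add: mult_left_mono)
      ultimately show "t * (norm v + norm w) < d" using \<open>d > 0\<close> by linarith
    qed
    have near: "dist (u + s *\<^sub>R v + r *\<^sub>R w) u < d" "dist (u + s *\<^sub>R w + r *\<^sub>R v) u < d"
      if "0 \<le> s" "s \<le> t" "0 \<le> r" "r \<le> t" for s r
    proof -
      have "norm (s *\<^sub>R v + r *\<^sub>R w) \<le> t * norm v + t * norm w" "norm (s *\<^sub>R w + r *\<^sub>R v) \<le> t * norm w + t * norm v"
        using that by (auto intro!: order_trans[OF norm_triangle_ineq] add_mono mult_right_mono)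
      then show "dist (u + s *\<^sub>R v + r *\<^sub>R w) u < d" "dist (u + s *\<^sub>R w + r *\<^sub>R v) u < d"
        using t(2) by (auto simp: dist_norm algebra_simps)
    qed
    obtain s r where sr: "0 < s" "s < t" "0 < r" "r < t"
      "f (u + t *\<^sub>R v + t *\<^sub>R w) - f (u + t *\<^sub>R v) - f (u + t *\<^sub>R w) + f u
        = t * t * G v w (u + s *\<^sub>R v + r *\<^sub>R w)"
      using second_difference_mean_value[OF assms(2) t(1), of u v w] near(1) d1(2)
      unfolding G_def d_def by (metis min_less_iff_conj)
    obtain s' r' where sr': "0 < s'" "s' < t" "0 < r'" "r' < t"
      "f (u + t *\<^sub>R w + t *\<^sub>R v) - f (u + t *\<^sub>R w) - f (u + t *\<^sub>R v) + f u
        = t * t * G w v (u + s' *\<^sub>R w + r' *\<^sub>R v)"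
      using second_difference_mean_value[OF assms(2) t(1), of u w v] near(2) d1(2)
      unfolding G_def d_def by (metis min_less_iff_conj)
    have "t * t * G v w (u + s *\<^sub>R v + r *\<^sub>R w) = t * t * G w v (u + s' *\<^sub>R w + r' *\<^sub>R v)"
      using sr(5) sr'(5)
      unfolding add.commute[of "t *\<^sub>R v" "t *\<^sub>R w", THEN arg_cong[of _ _ "(+) u"], folded add.assoc]
      by linarith
    then have eq: "G v w (u + s *\<^sub>R v + r *\<^sub>R w) = G w v (u + s' *\<^sub>R w + r' *\<^sub>R v)"
      using t(1) by simp
    have "dist (G v w (u + s *\<^sub>R v + r *\<^sub>R w)) (G v w u) < e / 2"
      using near(1)[of s r] sr d1(2)[of "u + s *\<^sub>R v + r *\<^sub>R w"] unfolding d_def by auto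
    moreover have "dist (G w v (u + s' *\<^sub>R w + r' *\<^sub>R v)) (G w v u) < e / 2"
      using near(2)[of s' r'] sr' d2(2)[of "u + s' *\<^sub>R w + r' *\<^sub>R v"] unfolding d_def by auto
    ultimately show ?thesis using eq unfolding dist_real_def by linarith
  qed
  then have "dist (G v w u) (G w v u) \<le> 0" by (rule dense_ge)
  then show ?thesis by (simp add: G_def)
qed

section \<open>Rules for coordinate partial derivatives\<close>

lemma partial_bilinear:
  assumes "bounded_bilinear prd" "f differentiable (at u)" "g differentiable (at u)"
  shows "partial i (\<lambda>x. prd (f x) (g x)) u = prd (f u) (partial i g u) + prd (partial i f u) (g u)"
  unfolding partial_def by (simp add: bounded_bilinear.frechet_derivative_prod[OF assms])

lemmas partial_inner = partial_bilinear[OF bounded_bilinear_inner]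
lemmas partial_mult = partial_bilinear[OF bounded_bilinear_mult]
lemmas partial_scaleR = partial_bilinear[OF bounded_bilinear_scaleR]

lemma partial_const [simp]: "partial i (\<lambda>x. c) u = 0"
  by (simp add: partial_def)

lemma partial_add:
  "f differentiable (at u) \<Longrightarrow> g differentiable (at u) \<Longrightarrow>
    partial i (\<lambda>x. f x + g x) u = partial i f u + partial i g u"
  unfolding partial_def by (simp add: frechet_derivative_add)

lemma partial_sum:
  assumes "\<And>j. j \<in> I \<Longrightarrow> f j differentiable (at u)"
  shows "partial i (\<lambda>x. \<Sum>j\<in>I. f j x) u = (\<Sum>j\<in>I. partial i (f j) u)"
proof -
  have "((\<lambda>x. \<Sum>j\<in>I. f j x) has_derivative (\<lambda>v. \<Sum>j\<in>I. frechet_derivative (f j) (at u) v)) (at u)"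
    using assms by (intro has_derivative_sum) (auto simp: frechet_derivative_works)
  from frechet_derivative_at[OF this, symmetric] show ?thesis
    unfolding partial_def by simp
qed

lemma partial_cong:
  assumes "open S" "u \<in> S" "\<And>x. x \<in> S \<Longrightarrow> f x = g x" "f differentiable (at u)"
  shows "partial i f u = partial i g u"
  unfolding partial_def
  using frechet_derivative_transform_within_open[OF assms(4,1,2,3)] by simp

text \<open>Pairing with each basis vector reduces this to real-valued functions.\<close>

lemma partial_commute:
  fixes f :: "real^'n \<Rightarrow> 'b::euclidean_space"
  assumes "open S" "smooth_on S f" "u \<in> S"
  shows "partial i (partial j f) u = partial j (partial i f) u"
proof (rule euclidean_eqI)
  fix b :: 'b
  have sm: "smooth_on S (\<lambda>x. f x \<bullet> b)" by (intro smooth_on_inner assms smooth_on_const)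
  have "partial i (partial j (\<lambda>x. f x \<bullet> b)) u = partial i (partial j f) u \<bullet> b" for i j
  proof -
    have "partial j (\<lambda>x. f x \<bullet> b) x = partial j f x \<bullet> b" if "x \<in> S" for x
      using smooth_on_differentiable[OF assms(2) that] by (simp add: partial_inner)
    then have "partial i (partial j (\<lambda>x. f x \<bullet> b)) u = partial i (\<lambda>x. partial j f x \<bullet> b) u"
      using assms(1,3) sm
      by (intro partial_cong[OF assms(1,3)] smooth_on_differentiable[OF smooth_on_partial])
    also have "\<dots> = partial i (partial j f) u \<bullet> b"
      using smooth_on_differentiable[OF smooth_on_partial[OF assms(2)] assms(3)]
      by (simp add: partial_inner)
    finally show ?thesis .
  qed
  moreover have "partial i (partial j (\<lambda>x. f x \<bullet> b)) u = partial j (partial i (\<lambda>x. f x \<bullet> b)) u"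
    using frechet_derivative_commute_real[OF assms(1) sm assms(3)]
    unfolding partial_def[abs_def] .
  ultimately show "partial i (partial j f) u \<bullet> b = partial j (partial i f) u \<bullet> b" by simp
qed

lemma partial_partial_bilinear:
  fixes prd :: "'b::euclidean_space \<Rightarrow> 'c::euclidean_space \<Rightarrow> 'd::euclidean_space"
  assumes "open S" "u \<in> S" "bounded_bilinear prd" "smooth_on S f" "smooth_on S g"
  shows "partial j (partial i (\<lambda>x. prd (f x) (g x))) u =
    prd (f u) (partial j (partial i g) u) + prd (partial j f u) (partial i g u) +
    prd (partial i f u) (partial j g u) + prd (partial j (partial i f) u) (g u)"
proof -
  note d = smooth_on_differentiable
  have "partial j (partial i (\<lambda>x. prd (f x) (g x))) u =
     partial j (\<lambda>x. prd (f x) (partial i g x) + prd (partial i f x) (g x)) u"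
    using assms
    by (intro partial_cong[OF assms(1,2)]
        d[OF smooth_on_partial[OF smooth_on_bilinear[OF assms(1,3,4,5)]] assms(2)])
      (simp add: partial_bilinear d)
  also have "\<dots> = partial j (\<lambda>x. prd (f x) (partial i g x)) u + partial j (\<lambda>x. prd (partial i f x) (g x)) u"
    using assms by (intro partial_add d[OF smooth_on_bilinear] smooth_on_partial)
  finally show ?thesis
    using assms(3) d[OF assms(4,2)] d[OF assms(5,2)]
      d[OF smooth_on_partial[OF assms(4)] assms(2)] d[OF smooth_on_partial[OF assms(5)] assms(2)]
    by (simp add: partial_bilinear)
qed

lemmas partial_partial_inner = partial_partial_bilinear[OF _ _ bounded_bilinear_inner]
lemmas partial_partial_mult = partial_partial_bilinear[OF _ _ bounded_bilinear_mult]

text \<open>For the second claim, restrict to the coordinate line. A negative second derivative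
  would make the first derivative negative immediately to the right of 0, so by the mean value
  theorem the function would drop below its minimum.\<close>

lemma partial_local_min:
  fixes f :: "real^'n \<Rightarrow> real"
  assumes S: "open S" "u \<in> S" "smooth_on S f" and min: "\<And>y. y \<in> S \<Longrightarrow> f u \<le> f y"
  shows "partial i f u = 0" "partial i (partial i f) u \<ge> 0"
proof -
  have "\<forall>\<^sub>F y in at u. f u \<le> f y"
    using S min by (auto simp: eventually_at_topological)
  then have "frechet_derivative f (at u) = (\<lambda>h. 0)"
    using has_derivative_local_min smooth_on_differentiable[OF S(3,2)]
    unfolding frechet_derivative_works by blast
  then show 0: "partial i f u = 0" by (simp add: partial_def)
  let ?e = "axis i 1 :: real^'n"
  define F where "F t = f (u + t *\<^sub>R ?e)" for t
  define F' where "F' t = partial i f (u + t *\<^sub>R ?e)" for t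
  obtain d where d: "d > 0" "ball u d \<subseteq> S" using S by (meson openE)
  have near: "u + t *\<^sub>R ?e \<in> S" if "\<bar>t\<bar> < d" for t
    using d(2) that by (auto simp: dist_norm)
  have F: "(F has_real_derivative F' t) (at t)" if "\<bar>t\<bar> < d" for t
    unfolding F_def F'_def partial_def using near[OF that] S(3)
    by (intro has_real_derivative_along_line smooth_on_differentiable)
  have F': "(F' has_real_derivative partial i (partial i f) u) (at 0)"
    using has_real_derivative_along_line[of "partial i f" u 0 ?e] S
      smooth_on_differentiable[OF smooth_on_partial]
    unfolding F'_def[abs_def] by (auto simp: partial_def)
  show "partial i (partial i f) u \<ge> 0"
  proof (rule ccontr)
    assume "\<not> ?thesis"
    then obtain d' where d': "d' > 0" "\<And>h. 0 < h \<Longrightarrow> h < d' \<Longrightarrow> F' h < 0"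
      using has_real_derivative_neg_dec_right[OF F'] 0 unfolding F'_def by auto
    define h where "h = min d d' / 2"
    have h: "0 < h" "h < d" "h < d'" using d d' by (auto simp: h_def)
    obtain z where z: "0 < z" "z < h" "F h - F 0 = h * F' z"
      using MVT2[OF h(1), of F F'] F h by auto
    then have "F h < F 0" using d'(2)[of z] h mult_pos_neg[of h "F' z"] by auto
    then show False using min[OF near[of h]] h by (simp add: F_def)
  qed
qed

section \<open>Hypersurface patches and the Gauss equation\<close>

lemma frechet_derivative_eq_sum_partial:
  assumes "f differentiable (at u)"
  shows "frechet_derivative f (at u) v = (\<Sum>i\<in>UNIV. v $ i *\<^sub>R partial i f u)"
proof -
  have lin: "linear (frechet_derivative f (at u))"
    using assms by (rule linear_frechet_derivative)
  have "frechet_derivative f (at u) (\<Sum>i\<in>UNIV. v $ i *\<^sub>R axis i 1) = (\<Sum>i\<in>UNIV. v $ i *\<^sub>R partial i f u)"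
    by (simp add: linear_sum[OF lin] linear_scale[OF lin] partial_def)
  then show ?thesis
    using basis_expansion[of v] by (simp add: scalar_mult_eq_scaleR)
qed

text \<open>A dimension count: if \<open>r\<close> were nonzero, the image of \<open>f\<close>
  together with \<open>a\<close> and \<open>r\<close> would be an injective linear image of a space
  of dimension n + 2 inside one of dimension n + 1.\<close>

lemma orthogonal_to_hyperplane_and_normal:
  fixes f :: "real^'n \<Rightarrow> real^'m"
  assumes "CARD('m) = CARD('n) + 1" "linear f" "inj f" "a \<noteq> 0"
    and a: "\<And>v. a \<bullet> f v = 0" and r: "\<And>v. r \<bullet> f v = 0" "r \<bullet> a = 0"
  shows "r = 0"
proof (rule ccontr)
  assume "r \<noteq> 0"
  define F where "F = (\<lambda>(v, s, t). f v + s *\<^sub>R a + t *\<^sub>R r :: real^'m)"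
  have "linear F"
    unfolding F_def
    by (intro linearI) (auto simp: linear_add[OF assms(2)] linear_scale[OF assms(2)] algebra_simps)
  moreover have "inj F"
  proof (rule linear_inj_iff_eq_0[THEN iffD2, OF \<open>linear F\<close>], clarify)
    fix v and s t :: real
    assume "F (v, s, t) = 0"
    then have *: "f v + s *\<^sub>R a + t *\<^sub>R r = 0" by (simp add: F_def)
    from arg_cong[OF *, of "\<lambda>z. r \<bullet> z"] have "t = 0"
      using r \<open>r \<noteq> 0\<close> by (simp add: inner_add_right)
    moreover from arg_cong[OF *, of "\<lambda>z. a \<bullet> z"] have "s = 0"
      using r a \<open>a \<noteq> 0\<close> by (simp add: inner_add_right inner_commute)
    ultimately have "f v = 0" using * by simp
    then have "v = 0" using assms(2,3) linear_inj_iff_eq_0 by blast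
    with \<open>s = 0\<close> \<open>t = 0\<close> show "(v, s, t) = 0" by (simp add: zero_prod_def)
  qed
  ultimately have "dim (range F) = DIM((real^'n) \<times> real \<times> real)"
    by (metis dim_UNIV dim_image_eq inj_on_subset subset_UNIV)
  moreover have "dim (range F) \<le> DIM(real^'m)" by (rule dim_subset_UNIV)
  ultimately show False using assms(1) by simp
qed

text \<open>The dual coframe, represented by tangent vectors of the ambient space, so that the inner
  product with \<open>dual_frame Y i u\<close> reads off the \<open>i\<close>-th coefficient of a
  tangent vector.\<close>

definition dual_frame :: "(real^'n::finite \<Rightarrow> 'b::real_inner) \<Rightarrow> 'n \<Rightarrow> real^'n \<Rightarrow> 'b" where
  "dual_frame Y i u =
    (\<Sum>j\<in>UNIV. matrix_inv (first_fundamental_form Y u) $ i $ j *\<^sub>R partial j Y u)"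

text \<open>The shape operator as an endomorphism of the ambient space, vanishing in the normal
  direction. Unlike the second fundamental form it does not depend on the parametrisation.\<close>
definition shape_matrix ::
    "(real^'n::finite \<Rightarrow> real^'m::finite) \<Rightarrow> (real^'n \<Rightarrow> real^'m) \<Rightarrow> real^'n \<Rightarrow> real^'m^'m" where
  "shape_matrix Y N u = (\<chi> a b. - (\<Sum>i\<in>UNIV. partial i N u $ a * dual_frame Y i u $ b))"

text \<open>Local geometry is developed without manifold or atlas, because it is needed for two
  kinds of parametrisation: the charts of \<open>M\<close> and special coordinates built around a
  given point.\<close>

locale patch =
  fixes U :: "(real^'n::finite) set" and Y N :: "real^'n \<Rightarrow> real^'m::finite"
  assumes dim: "CARD('m) = CARD('n) + 1"
    and open_U: "open U"
    and smooth_Y: "smooth_on U Y"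
    and smooth_N: "smooth_on U N"
    and norm_N: "u \<in> U \<Longrightarrow> norm (N u) = 1"
    and N_normal: "u \<in> U \<Longrightarrow> N u \<bullet> frechet_derivative Y (at u) v = 0"
    and inj_dY: "u \<in> U \<Longrightarrow> inj (frechet_derivative Y (at u))"
begin

abbreviation "g \<equiv> first_fundamental_form Y"
abbreviation "h \<equiv> second_fundamental_form Y N"
abbreviation "dual \<equiv> dual_frame Y"

lemma diff_Y: "u \<in> U \<Longrightarrow> Y differentiable (at u)"
  by (rule smooth_on_differentiable[OF smooth_Y])

lemma diff_N: "u \<in> U \<Longrightarrow> N differentiable (at u)"
  by (rule smooth_on_differentiable[OF smooth_N])

lemma smooth_dY: "smooth_on U (partial i Y)"
  by (rule smooth_on_partial[OF smooth_Y])

lemma smooth_ddY: "smooth_on U (partial i (partial j Y))"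
  by (rule smooth_on_partial[OF smooth_dY])

lemma smooth_dN: "smooth_on U (partial i N)"
  by (rule smooth_on_partial[OF smooth_N])

lemma diff_dY: "u \<in> U \<Longrightarrow> partial i Y differentiable (at u)"
  by (rule smooth_on_differentiable[OF smooth_dY])

lemma diff_dN: "u \<in> U \<Longrightarrow> partial i N differentiable (at u)"
  by (rule smooth_on_differentiable[OF smooth_dN])

lemma N_N: "u \<in> U \<Longrightarrow> N u \<bullet> N u = 1"
  using norm_N by (simp add: norm_eq_1)

lemma N_dY: "u \<in> U \<Longrightarrow> N u \<bullet> partial i Y u = 0"
  unfolding partial_def by (rule N_normal)

lemma linear_dY: "u \<in> U \<Longrightarrow> linear (frechet_derivative Y (at u))"
  by (intro linear_frechet_derivative diff_Y)

lemma dY_eq_0: "u \<in> U \<Longrightarrow> frechet_derivative Y (at u) v = 0 \<Longrightarrow> v = 0"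
  using inj_dY linear_dY linear_inj_iff_eq_0 by blast

lemma N_dN: "u \<in> U \<Longrightarrow> N u \<bullet> partial i N u = 0"
proof -
  assume u: "u \<in> U"
  have "partial i (\<lambda>x. N x \<bullet> N x) u = partial i (\<lambda>x. 1 :: real) u"
    by (rule partial_cong[OF open_U u]) (auto simp: N_N u diff_N intro!: smooth_on_differentiable[OF smooth_on_inner[OF open_U smooth_N smooth_N]])
  then show ?thesis
    using u by (simp add: partial_inner diff_N inner_commute)
qed

lemma g_apply: "u \<in> U \<Longrightarrow> v \<bullet> (g u *v w) = frechet_derivative Y (at u) v \<bullet> frechet_derivative Y (at u) w"
  by (simp add: frechet_derivative_eq_sum_partial[OF diff_Y] first_fundamental_form_def
      inner_vec_def[of v] matrix_vector_mult_def inner_sum_left inner_sum_right sum_distrib_left mult_ac)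
    (subst sum.swap, rule refl)?

lemma invertible_g: "u \<in> U \<Longrightarrow> invertible (g u)"
proof -
  assume u: "u \<in> U"
  have "v = 0" if "g u *v v = 0" for v
    using g_apply[OF u, of v v] that dY_eq_0[OF u] by simp
  then have "inj ((*v) (g u))"
    by (simp add: linear_inj_iff_eq_0)
  then show ?thesis
    by (simp add: invertible_left_inverse matrix_left_invertible_injective)
qed

lemma smooth_g: "smooth_on U (\<lambda>u. g u $ i $ j)"
  unfolding first_fundamental_form_def
  by (simp add: smooth_on_inner[OF open_U smooth_dY smooth_dY])

lemma smooth_ginv: "smooth_on U (\<lambda>u. matrix_inv (g u) $ i $ j)"
  by (rule smooth_on_matrix_inv[OF open_U smooth_g invertible_g])

lemma smooth_dual: "smooth_on U (dual i)"
  unfolding dual_frame_def[abs_def]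
  by (intro smooth_on_sum smooth_on_scaleR open_U smooth_ginv smooth_dY)

lemma dual_dY: "u \<in> U \<Longrightarrow> dual i u \<bullet> partial k Y u = (if i = k then 1 else 0)"
proof -
  assume u: "u \<in> U"
  have "dual i u \<bullet> partial k Y u = (matrix_inv (g u) ** g u) $ i $ k"
    by (simp add: dual_frame_def matrix_matrix_mult_def first_fundamental_form_def inner_sum_left)
  then show ?thesis
    by (simp add: invertible_matrix_inv[OF invertible_g[OF u]] mat_def)
qed

lemma dual_N: "u \<in> U \<Longrightarrow> dual i u \<bullet> N u = 0"
  by (simp add: dual_frame_def inner_sum_left inner_commute[of "partial _ Y u"] N_dY)

text \<open>The difference of the two sides is orthogonal to every \<open>partial k Y u\<close> and
  to \<open>N u\<close>; in codimension one this forces it to vanish.\<close>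

lemma frame_expansion:
  assumes u: "u \<in> U"
  shows "z = (z \<bullet> N u) *\<^sub>R N u + (\<Sum>i\<in>UNIV. (z \<bullet> dual i u) *\<^sub>R partial i Y u)" (is "z = ?z")
proof -
  have k: "(z - ?z) \<bullet> partial k Y u = 0" for k
  proof -
    have "(\<Sum>i\<in>UNIV. (z \<bullet> dual i u) * (partial i Y u \<bullet> partial k Y u))
       = (\<Sum>i\<in>UNIV. \<Sum>j\<in>UNIV. matrix_inv (g u) $ i $ j * (z \<bullet> partial j Y u) * g u $ k $ i)"
      by (simp add: dual_frame_def inner_sum_right sum_distrib_left sum_distrib_right
          first_fundamental_form_def inner_commute mult_ac)
    also have "\<dots> = (\<Sum>j\<in>UNIV. (z \<bullet> partial j Y u) * (g u ** matrix_inv (g u)) $ k $ j)"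
      by (subst sum.swap) (simp add: matrix_matrix_mult_def sum_distrib_left mult_ac)
    also have "\<dots> = z \<bullet> partial k Y u"
      by (simp add: invertible_matrix_inv[OF invertible_g[OF u]] mat_def if_distrib[of "(*) _"] cong: if_cong)
    finally show ?thesis
      by (simp add: inner_diff_left inner_add_left inner_sum_left N_dY[OF u])
  qed
  have "z - ?z = 0"
  proof (rule orthogonal_to_hyperplane_and_normal[OF dim linear_dY[OF u] inj_dY[OF u]])
    show "N u \<noteq> 0" using N_N[OF u] by auto
    show "(z - ?z) \<bullet> frechet_derivative Y (at u) v = 0" for v
      by (simp only: frechet_derivative_eq_sum_partial[OF diff_Y[OF u]] inner_sum_right
          inner_scaleR_right k mult_zero_right sum.neutral_const)
    show "(z - ?z) \<bullet> N u = 0"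
      by (simp add: inner_diff_left inner_add_left inner_sum_left N_N[OF u]
          inner_commute[of "partial _ Y u" "N u"] N_dY[OF u])
  qed (rule N_normal[OF u])
  then show ?thesis by simp
qed

lemma shape_apply: "shape_matrix Y N u *v z = - (\<Sum>i\<in>UNIV. (dual i u \<bullet> z) *\<^sub>R partial i N u)"
proof -
  have "(shape_matrix Y N u *v z) $ a = - (\<Sum>b\<in>UNIV. \<Sum>i\<in>UNIV. (partial i N u $ a * dual i u $ b) * z $ b)" for a
    by (simp add: shape_matrix_def matrix_vector_mult_def sum_distrib_right sum_negf)
  also have "\<dots> a = - (\<Sum>i\<in>UNIV. \<Sum>b\<in>UNIV. (partial i N u $ a * dual i u $ b) * z $ b)" for a
    by (subst sum.swap) simp
  finally show ?thesis
    by (simp add: vec_eq_iff inner_vec_def sum_distrib_right sum_distrib_left mult_ac)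
qed

lemma shape_dY: "u \<in> U \<Longrightarrow> shape_matrix Y N u *v partial k Y u = - partial k N u"
  by (simp add: shape_apply dual_dY if_distrib[of "\<lambda>c. c *\<^sub>R _"] cong: if_cong)

lemma shape_N: "u \<in> U \<Longrightarrow> shape_matrix Y N u *v N u = 0"
  by (simp add: shape_apply dual_N)

text \<open>The tangent frame and the normal span the ambient space, so values on them determine the
  matrix. Independence of the parametrisation rests on this characterisation.\<close>

lemma shape_unique:
  assumes u: "u \<in> U" and "\<And>k. B *v partial k Y u = - partial k N u" "B *v N u = 0"
  shows "B = shape_matrix Y N u"
proof (rule matrix_eq[THEN iffD2], rule allI)
  fix z
  have "B *v z = shape_matrix Y N u *v z"
    by (subst (1 2) frame_expansion[OF u, of z])
      (simp add: matrix_vector_right_distrib matrix_vector_mult_scaleR linear_sum[OF matrix_vector_mul_linear]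
        assms shape_dY shape_N)
  then show "B *v z = shape_matrix Y N u *v z" .
qed

text \<open>Differentiate the identity that \<open>N\<close> is orthogonal to
  \<open>partial i Y\<close>. In this form the symmetry of \<open>h\<close> is the symmetry of mixed
  derivatives.\<close>

lemma h_eq: "u \<in> U \<Longrightarrow> h u $ i $ j = partial i (partial j Y) u \<bullet> N u"
proof -
  assume u: "u \<in> U"
  have "partial j (\<lambda>x. N x \<bullet> partial i Y x) u = partial j (\<lambda>x. 0 :: real) u"
    by (rule partial_cong[OF open_U u])
      (auto simp: N_dY u intro!: smooth_on_differentiable[OF smooth_on_inner[OF open_U smooth_N smooth_dY]])
  then have "partial j (partial i Y) u \<bullet> N u = - (partial j N u \<bullet> partial i Y u)"
    using u by (simp add: partial_inner diff_N diff_dY inner_commute)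
  then show ?thesis
    using partial_commute[OF open_U smooth_Y u, of i j] by (simp add: second_fundamental_form_def)
qed

lemma h_eq_dN: "u \<in> U \<Longrightarrow> h u $ i $ j = - (partial i N u \<bullet> partial j Y u)"
  using h_eq[of u i j] h_eq[of u j i] partial_commute[OF open_U smooth_Y, of u i j]
  by (simp add: second_fundamental_form_def)

lemma smooth_h: "smooth_on U (\<lambda>u. h u $ i $ j)"
proof -
  have "smooth_on U (\<lambda>u. partial i (partial j Y) u \<bullet> N u)"
    by (rule smooth_on_inner[OF open_U smooth_ddY smooth_N])
  then show ?thesis using smooth_on_cong[OF open_U h_eq] by fast
qed

lemma metric_trace_h: "u \<in> U \<Longrightarrow> metric_trace (g u) (h u) = - (\<Sum>i\<in>UNIV. partial i N u \<bullet> dual i u)"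
  by (simp add: metric_trace_def h_eq_dN dual_frame_def inner_sum_right sum_negf)

lemma trace_shape: "u \<in> U \<Longrightarrow> trace (shape_matrix Y N u) = metric_trace (g u) (h u)"
  unfolding metric_trace_h
  by (simp add: trace_def shape_matrix_def inner_vec_def sum_negf) (rule sum.swap)

lemma trace_shape_square:
  "trace (shape_matrix Y N u ** shape_matrix Y N u)
    = (\<Sum>i\<in>UNIV. \<Sum>k\<in>UNIV. (partial i N u \<bullet> dual k u) * (partial k N u \<bullet> dual i u))"
proof -
  let ?B = "shape_matrix Y N u"
  have "trace (?B ** ?B) = (\<Sum>a\<in>UNIV. \<Sum>b\<in>UNIV. \<Sum>i\<in>UNIV. \<Sum>k\<in>UNIV.
      (partial i N u $ a * dual k u $ a) * (partial k N u $ b * dual i u $ b))"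
    by (simp add: trace_def matrix_matrix_mult_def shape_matrix_def sum_product mult_ac)
  also have "\<dots> = (\<Sum>a\<in>UNIV. \<Sum>i\<in>UNIV. \<Sum>k\<in>UNIV. \<Sum>b\<in>UNIV.
      (partial i N u $ a * dual k u $ a) * (partial k N u $ b * dual i u $ b))"
    by (intro sum.cong refl) (subst sum.swap, intro sum.cong refl, subst sum.swap, rule refl)
  also have "\<dots> = (\<Sum>i\<in>UNIV. \<Sum>k\<in>UNIV. \<Sum>a\<in>UNIV. \<Sum>b\<in>UNIV.
      (partial i N u $ a * dual k u $ a) * (partial k N u $ b * dual i u $ b))"
    by (subst sum.swap, intro sum.cong refl, subst sum.swap, rule refl)
  finally show ?thesis by (simp add: inner_vec_def sum_product)
qed

text \<open>The product rule expands each derivative of the metric into two terms; after the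
  symmetry of \<open>partial i (partial j Y)\<close> is used, all cancel except twice the pairing
  with \<open>partial l Y\<close>.\<close>

lemma christoffel_eq:
  "u \<in> U \<Longrightarrow> christoffel g k i j u = partial i (partial j Y) u \<bullet> dual k u"
proof -
  assume u: "u \<in> U"
  have dg: "partial i (\<lambda>w. g w $ j $ l) u
     = partial j Y u \<bullet> partial i (partial l Y) u + partial i (partial j Y) u \<bullet> partial l Y u" for i j l
    by (simp add: first_fundamental_form_def partial_inner diff_dY[OF u])
  have "partial i (\<lambda>w. g w $ j $ l) u + partial j (\<lambda>w. g w $ i $ l) u
          - partial l (\<lambda>w. g w $ i $ j) u = 2 * (partial i (partial j Y) u \<bullet> partial l Y u)" for l
    unfolding dg
    using partial_commute[OF open_U smooth_Y u, of i j] partial_commute[OF open_U smooth_Y u, of i l]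
      partial_commute[OF open_U smooth_Y u, of j l]
    by (simp add: inner_commute)
  then show ?thesis
    by (simp add: christoffel_def dual_frame_def inner_sum_right sum_divide_distrib)
qed

lemma gauss_formula:
  "u \<in> U \<Longrightarrow> partial i (partial j Y) u
    = h u $ i $ j *\<^sub>R N u + (\<Sum>k\<in>UNIV. christoffel g k i j u *\<^sub>R partial k Y u)"
  using frame_expansion[of u "partial i (partial j Y) u"] by (simp add: h_eq christoffel_eq)

lemma smooth_christoffel: "smooth_on U (christoffel g k i j)"
proof -
  have "smooth_on U (\<lambda>u. partial i (partial j Y) u \<bullet> dual k u)"
    by (rule smooth_on_inner[OF open_U smooth_ddY smooth_dual])
  then show ?thesis using smooth_on_cong[OF open_U christoffel_eq] by fast
qed

text \<open>Differentiate the Gauss formula and pair it with the dual frame: \<open>N\<close> drops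
  out, but its derivative remains. Antisymmetrising in \<open>i\<close> and \<open>j\<close> removes
  the third derivatives of \<open>Y\<close>; what is left is the curvature tensor on one side and
  products of \<open>h\<close> with the shape operator on the other.\<close>

lemma gauss_equation:
  assumes u: "u \<in> U"
  shows "riemann g l i j k u
    = h u $ i $ k * (partial j N u \<bullet> dual l u) - h u $ j $ k * (partial i N u \<bullet> dual l u)"
proof -
  note d = smooth_on_differentiable[OF _ u]
  have third: "partial i (partial j (partial k Y)) u \<bullet> dual l u
      = partial i (christoffel g l j k) u
        + (\<Sum>m\<in>UNIV. christoffel g l i m u * christoffel g m j k u)
        + h u $ j $ k * (partial i N u \<bullet> dual l u)" for i j
  proof -
    have "partial i (partial j (partial k Y)) u
        = partial i (\<lambda>x. h x $ j $ k *\<^sub>R N x + (\<Sum>m\<in>UNIV. christoffel g m j k x *\<^sub>R partial m Y x)) u"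
      by (rule partial_cong[OF open_U u gauss_formula d[OF smooth_ddY]])
    also have "\<dots> = partial i (\<lambda>x. h x $ j $ k *\<^sub>R N x) u
        + (\<Sum>m\<in>UNIV. partial i (\<lambda>x. christoffel g m j k x *\<^sub>R partial m Y x) u)"
      by (subst partial_add)
        (intro d[OF smooth_on_scaleR] d[OF smooth_on_sum] smooth_on_scaleR open_U smooth_h smooth_N
          smooth_christoffel smooth_dY, intro d[OF smooth_on_sum] smooth_on_scaleR open_U smooth_christoffel smooth_dY,
         subst partial_sum, intro d[OF smooth_on_scaleR] open_U smooth_christoffel smooth_dY, rule refl)
    also have "\<dots> = h u $ j $ k *\<^sub>R partial i N u + partial i (\<lambda>x. h x $ j $ k) u *\<^sub>R N u
        + (\<Sum>m\<in>UNIV. christoffel g m j k u *\<^sub>R partial i (partial m Y) u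
            + partial i (christoffel g m j k) u *\<^sub>R partial m Y u)"
      by (simp add: partial_scaleR d[OF smooth_h] d[OF smooth_N] d[OF smooth_christoffel] d[OF smooth_dY])
    finally have "partial i (partial j (partial k Y)) u \<bullet> dual l u
        = h u $ j $ k * (partial i N u \<bullet> dual l u)
        + (\<Sum>m\<in>UNIV. christoffel g m j k u * christoffel g l i m u)
        + (\<Sum>m\<in>UNIV. partial i (christoffel g m j k) u * (partial m Y u \<bullet> dual l u))"
      by (simp add: inner_add_left inner_sum_left christoffel_eq[OF u] inner_commute[of "N u"]
          dual_N[OF u] sum.distrib)
    also have "(\<Sum>m\<in>UNIV. partial i (christoffel g m j k) u * (partial m Y u \<bullet> dual l u))
        = partial i (christoffel g l j k) u"
      by (simp add: inner_commute[of _ "dual l u"] dual_dY[OF u] if_distrib[of "(*) _"] cong: if_cong)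
    finally show ?thesis by (simp add: mult.commute)
  qed
  show ?thesis
    using third[of i j] third[of j i] partial_commute[OF open_U smooth_dY u, of i j]
    by (simp add: riemann_def sum_subtractf)
qed

lemma scalar_curvature_eq:
  assumes u: "u \<in> U"
  shows "metric_trace (g u) (ricci g u)
    = (trace (shape_matrix Y N u))\<^sup>2 - trace (shape_matrix Y N u ** shape_matrix Y N u)"
proof -
  let ?W = "\<lambda>i k. partial i N u \<bullet> dual k u"
  \<comment> \<open>Raising an index turns \<open>h\<close> into the coefficients of the shape
    operator, up to sign.\<close>
  have hsum: "(\<Sum>k\<in>UNIV. matrix_inv (g u) $ j $ k * h u $ i $ k) = - ?W i j" for i j
    by (simp add: h_eq_dN[OF u] dual_frame_def inner_sum_right sum_negf)
  have "metric_trace (g u) (ricci g u)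
    = (\<Sum>j\<in>UNIV. \<Sum>k\<in>UNIV. \<Sum>i\<in>UNIV. matrix_inv (g u) $ j $ k * (h u $ i $ k * ?W j i - h u $ j $ k * ?W i i))"
    by (simp add: metric_trace_def ricci_def gauss_equation[OF u] sum_distrib_left)
  also have "\<dots> = (\<Sum>j\<in>UNIV. \<Sum>i\<in>UNIV. \<Sum>k\<in>UNIV. matrix_inv (g u) $ j $ k * (h u $ i $ k * ?W j i - h u $ j $ k * ?W i i))"
    by (rule sum.cong[OF refl], rule sum.swap)
  also have "\<dots> = (\<Sum>j\<in>UNIV. \<Sum>i\<in>UNIV. (\<Sum>k\<in>UNIV. matrix_inv (g u) $ j $ k * h u $ i $ k) * ?W j i
       - (\<Sum>k\<in>UNIV. matrix_inv (g u) $ j $ k * h u $ j $ k) * ?W i i)"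
    by (simp add: sum_distrib_right sum_distrib_left right_diff_distrib sum_subtractf mult_ac)
  also have "\<dots> = (\<Sum>j\<in>UNIV. \<Sum>i\<in>UNIV. ?W j j * ?W i i) - (\<Sum>j\<in>UNIV. \<Sum>i\<in>UNIV. ?W i j * ?W j i)"
    by (simp add: hsum sum_subtractf sum_negf)
  also have "(\<Sum>j\<in>UNIV. \<Sum>i\<in>UNIV. ?W j j * ?W i i) = (trace (shape_matrix Y N u))\<^sup>2"
    by (simp add: trace_shape[OF u] metric_trace_h[OF u] power2_eq_square sum_product)
  also have "(\<Sum>j\<in>UNIV. \<Sum>i\<in>UNIV. ?W i j * ?W j i) = trace (shape_matrix Y N u ** shape_matrix Y N u)"
    by (simp add: trace_shape_square mult.commute)
  finally show ?thesis .
qed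

lemma continuous_shape: "continuous_on U (\<lambda>u. shape_matrix Y N u $ a $ b)"
  unfolding shape_matrix_def
  by (simp, intro continuous_on_minus continuous_on_sum continuous_on_mult continuous_on_component
      smooth_on_continuous_on[OF smooth_dN] smooth_on_continuous_on[OF smooth_dual])

end

section \<open>Simons identity and the test inequality\<close>

lemma partial_ln:
  fixes f :: "real^'n \<Rightarrow> real"
  assumes "f differentiable (at u)" "f u > 0"
  shows "partial i f u = partial i (\<lambda>x. ln (f x)) u * f u"
proof -
  have "((\<lambda>u. ln (f u)) has_derivative (\<lambda>v. frechet_derivative f (at u) v * inverse (f u))) (at u)"
    using assms by (auto intro!: derivative_eq_intros simp: frechet_derivative_works field_simps)
  from frechet_derivative_at[OF this, symmetric] show ?thesis
    using assms(2) by (simp add: partial_def)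
qed

text \<open>Needed for the fourth derivatives of the immersion, which occur with both index orders
  in the two sides of Simons' identity.\<close>

lemma partial_partial_commute_twice:
  fixes f :: "real^'n \<Rightarrow> 'b::euclidean_space"
  assumes "open S" "smooth_on S f" "u \<in> S"
  shows "partial k (partial k (partial e (partial e f))) u = partial e (partial e (partial k (partial k f))) u"
proof -
  have inner: "partial a (partial b (partial c F)) x = partial a (partial c (partial b F)) x"
    if "smooth_on S F" "x \<in> S" for a b c x and F :: "real^'n \<Rightarrow> 'b"
    using assms(1) that
    by (intro partial_cong[OF assms(1)] partial_commute smooth_on_differentiable[OF smooth_on_partial[OF smooth_on_partial]])
  have "partial k (partial k (partial e (partial e f))) u = partial k (partial e (partial k (partial e f))) u"
    by (rule inner[OF smooth_on_partial[OF assms(2)] assms(3)])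
  also have "\<dots> = partial e (partial k (partial k (partial e f))) u"
    by (intro partial_commute[OF assms(1) _ assms(3)] smooth_on_partial assms(2))
  also have "\<dots> = partial e (partial k (partial e (partial k f))) u"
    by (rule partial_cong[OF assms(1,3)])
      (auto intro!: inner assms smooth_on_differentiable[OF _ assms(3)] smooth_on_partial)
  also have "\<dots> = partial e (partial e (partial k (partial k f))) u"
    by (rule partial_cong[OF assms(1,3)])
      (auto intro!: partial_commute[OF assms(1)] assms(2) smooth_on_differentiable[OF _ assms(3)] smooth_on_partial)
  finally show ?thesis .
qed

text \<open>The arithmetic of the maximum principle in an orthonormal frame. Here \<open>v\<close>
  is the tangential part of the position vector, \<open>dq\<close> and \<open>ddq\<close> belong to
  the curvature quotient q, and \<open>da\<close> and \<open>dda\<close> to q H. The assumptions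
  \<open>He\<close> and \<open>lap\<close> are the expander equation differentiated twice, along
  \<open>e\<close> and traced; \<open>sim\<close> is Simons' identity. Elimination of all second
  derivatives leaves only gradient terms, of favourable sign.\<close>

lemma expander_test_algebra:
  fixes v dH ddH dq ddq da dda hk :: "'i \<Rightarrow> real" and m H P S lam eps n Hee :: real and I :: "'i set"
  assumes "finite I" "H > 0" "eps \<ge> 0" "n \<ge> 2" "lam = H - P / 2"
    and da: "\<And>k. da k = dq k * H + m * dH k"
    and dda: "\<And>k. dda k = ddq k * H + 2 * (dq k * dH k) + m * ddH k"
    and dq: "\<And>k. dq k = eps * (v k + 2 * (n - 1) * (dH k / H))"
    and ddq: "\<And>k. ddq k \<ge> eps * (1 + hk k * P + 2 * (n - 1) * (ddH k / H - (dH k / H)\<^sup>2))"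
    and n: "real (card I) = n" and trc: "(\<Sum>k\<in>I. hk k) = H"
    and He: "Hee = (- (m * H) - (m * H)\<^sup>2 * P - (\<Sum>k\<in>I. v k * da k)) / 2"
    and lap: "(\<Sum>k\<in>I. ddH k) = (- H - S * P - (\<Sum>k\<in>I. v k * dH k)) / 2"
    and sim: "(\<Sum>k\<in>I. dda k) = Hee - (m * H) * S + H * (m * H)\<^sup>2"
  shows "eps * (1 + H * P - (n - 1) * S * P / H) \<le> lam * m * (m * H - S / H)"
proof -
  \<comment> \<open>The squared length of \<open>v\<close>, its inner product with the gradient of
    ln H, and the squared length of that gradient; \<open>LH\<close> is the Laplacian of
    \<open>H\<close> divided by \<open>H\<close>.\<close>
  define A1 where "A1 = (\<Sum>k\<in>I. v k * v k)"
  define A2 where "A2 = (\<Sum>k\<in>I. v k * (dH k / H))"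
  define A3 where "A3 = (\<Sum>k\<in>I. (dH k / H) * (dH k / H))"
  define LH where "LH = (\<Sum>k\<in>I. ddH k / H)"
  have LH: "LH = (- 1 - S * P / H - A2) / 2"
  proof -
    have "LH = (\<Sum>k\<in>I. ddH k) / H" by (simp add: LH_def sum_divide_distrib)
    moreover have "A2 = (\<Sum>k\<in>I. v k * dH k) / H" by (simp add: A2_def sum_divide_distrib)
    ultimately show ?thesis using lap assms(2) by (simp add: field_simps)
  qed
  have vda: "(\<Sum>k\<in>I. v k * da k) = eps * H * A1 + eps * H * 2 * (n - 1) * A2 + m * H * A2"
  proof -
    have "v k * da k = eps * H * (v k * v k) + eps * H * 2 * (n - 1) * (v k * (dH k / H)) + m * H * (v k * (dH k / H))" for k
      unfolding da dq using assms(2) by (simp add: algebra_simps)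
    then show ?thesis by (simp add: sum.distrib A1_def A2_def sum_distrib_left)
  qed
  have "(\<Sum>k\<in>I. dda k) \<ge> eps * H * (n + H * P + 2 * (n - 1) * (LH - A3))
      + 2 * eps * H * (A2 + 2 * (n - 1) * A3) + m * H * LH"
  proof -
    have "dda k \<ge> eps * H * (1 + hk k * P + 2 * (n - 1) * (ddH k / H - (dH k / H)\<^sup>2))
        + 2 * eps * H * (v k * (dH k / H) + 2 * (n - 1) * ((dH k / H) * (dH k / H))) + m * H * (ddH k / H)" for k
    proof -
      have "ddq k * H \<ge> eps * (1 + hk k * P + 2 * (n - 1) * (ddH k / H - (dH k / H)\<^sup>2)) * H"
        using ddq[of k] assms(2) by (intro mult_right_mono) auto
      moreover have "2 * (dq k * dH k) = 2 * eps * H * (v k * (dH k / H) + 2 * (n - 1) * ((dH k / H) * (dH k / H)))"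
        unfolding dq using assms(2) by (simp add: field_simps)
      moreover have "m * ddH k = m * H * (ddH k / H)" using assms(2) by simp
      ultimately show ?thesis unfolding dda by (simp add: mult_ac)
    qed
    then have "(\<Sum>k\<in>I. dda k) \<ge> (\<Sum>k\<in>I. eps * H * (1 + hk k * P + 2 * (n - 1) * (ddH k / H - (dH k / H)\<^sup>2))
        + 2 * eps * H * (v k * (dH k / H) + 2 * (n - 1) * ((dH k / H) * (dH k / H))) + m * H * (ddH k / H))"
      by (rule sum_mono)
    also have "(\<Sum>k\<in>I. eps * H * (1 + hk k * P + 2 * (n - 1) * (ddH k / H - (dH k / H)\<^sup>2))
        + 2 * eps * H * (v k * (dH k / H) + 2 * (n - 1) * ((dH k / H) * (dH k / H))) + m * H * (ddH k / H))
      = eps * H * (n + H * P + 2 * (n - 1) * (LH - A3))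
      + 2 * eps * H * (A2 + 2 * (n - 1) * A3) + m * H * LH"
      using n by (simp only: sum.distrib sum_distrib_left[symmetric] sum_distrib_right[symmetric] sum_subtractf
          LH_def A3_def A2_def power2_eq_square trc) (simp add: trc)
    finally show ?thesis .
  qed
  \<comment> \<open>The squared length of \<open>v\<close> plus twice the gradient of ln H.\<close>
  moreover have "0 \<le> A1 + 4 * A2 + 4 * A3"
  proof -
    have "A1 + 4 * A2 + 4 * A3 = (\<Sum>k\<in>I. (v k + 2 * (dH k / H))\<^sup>2)"
      by (simp add: A1_def A2_def A3_def sum_distrib_left sum.distrib[symmetric] power2_eq_square algebra_simps)
    then show ?thesis by (simp add: sum_nonneg)
  qed
  moreover have "0 \<le> A3" by (simp add: A3_def sum_nonneg)
  ultimately have main: "(- (m * H) - (m * H)\<^sup>2 * P - (eps * H * A1 + eps * H * 2 * (n - 1) * A2 + m * H * A2)) / 2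
      - (m * H) * S + H * (m * H)\<^sup>2
      \<ge> eps * H * (n + H * P + 2 * (n - 1) * (LH - A3)) + 2 * eps * H * (A2 + 2 * (n - 1) * A3) + m * H * LH"
    and A: "0 \<le> A1 + 4 * A2 + 4 * A3" "0 \<le> A3"
    using sim He vda by simp_all
  \<comment> \<open>Substituting \<open>LH\<close> turns \<open>n\<close> into 1, cancels part of
    the \<open>A2\<close> terms and produces the term in \<open>(n - 1) * S * P / H\<close>. The
    terms containing \<open>m\<close> combine through the factor H - P/2, which is
    \<open>lam\<close>. The gradient remainder is a square plus \<open>2 * (n - 2) * A3\<close>,
    nonnegative because n >= 2.\<close>
  from main have "m * H * (lam * (m * H - S / H)) \<ge> eps * H * (1 + H * P - (n - 1) * S * P / H
      + (A1 + 4 * A2 + 4 * A3) / 2 + 2 * (n - 2) * A3)"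
    unfolding LH assms(5) using assms(2) by (simp add: field_simps power2_eq_square)
  then have "H * (m * (lam * (m * H - S / H))) \<ge> H * (eps * (1 + H * P - (n - 1) * S * P / H
      + (A1 + 4 * A2 + 4 * A3) / 2 + 2 * (n - 2) * A3))" by (simp add: mult_ac)
  then have "m * (lam * (m * H - S / H)) \<ge> eps * (1 + H * P - (n - 1) * S * P / H
      + (A1 + 4 * A2 + 4 * A3) / 2 + 2 * (n - 2) * A3)"
    using assms(2) by (simp only: mult_le_cancel_left_pos)
  moreover have "eps * (1 + H * P - (n - 1) * S * P / H
      + (A1 + 4 * A2 + 4 * A3) / 2 + 2 * (n - 2) * A3) \<ge> eps * (1 + H * P - (n - 1) * S * P / H)"
    using A assms(3,4) by (intro mult_left_mono) auto
  ultimately show ?thesis by (simp add: mult_ac)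
qed

text \<open>The condition \<open>ddY_normal\<close> says that the Christoffel symbols vanish at \<open>p\<close>.\<close>
locale adapted_patch = patch U Y N
  for U :: "(real^'n::finite) set" and Y N :: "real^'n \<Rightarrow> real^'m::finite" +
  fixes p :: "real^'n"
  assumes p: "p \<in> U"
    and orthonormal: "partial i Y p \<bullet> partial j Y p = (if i = j then 1 else 0)"
    and ddY_normal: "partial i (partial j Y) p \<bullet> partial k Y p = 0"
begin

section \<open>Derivatives of metric, normal and second fundamental form at the base point\<close>

lemma g_p: "g p = mat 1"
  by (simp add: first_fundamental_form_def orthonormal mat_def vec_eq_iff)

lemma ginv_p: "matrix_inv (g p) = mat 1"
  using invertible_matrix_inv(2)[of "mat 1 :: real^'n^'n"] by (simp add: g_p invertible_def) 

lemma dual_p: "dual i p = partial i Y p"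
  by (simp add: dual_frame_def ginv_p mat_def if_distrib[of "\<lambda>c. c *\<^sub>R _"] cong: if_cong)

lemma expansion_p: "z = (z \<bullet> N p) *\<^sub>R N p + (\<Sum>i\<in>UNIV. (z \<bullet> partial i Y p) *\<^sub>R partial i Y p)"
  using frame_expansion[OF p, of z] by (simp add: dual_p)

lemma dN_p: "partial i N p = - (\<Sum>l\<in>UNIV. h p $ i $ l *\<^sub>R partial l Y p)"
  using expansion_p[of "partial i N p"] N_dN[OF p, of i]
  by (simp add: h_eq_dN[OF p] sum_negf inner_commute[of "partial i N p" "N p"])

lemma ddY_p: "partial i (partial j Y) p = h p $ i $ j *\<^sub>R N p"
  using expansion_p[of "partial i (partial j Y) p"] by (simp add: ddY_normal h_eq[OF p])

lemma h_sym: "h p $ i $ j = h p $ j $ i"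
  using h_eq_dN[OF p, of i j] by (simp add: second_fundamental_form_def)

lemma trace_h_p: "metric_trace (g p) (h p) = (\<Sum>i\<in>UNIV. h p $ i $ i)"
  by (simp add: metric_trace_def ginv_p mat_def if_distrib[of "\<lambda>c. c * _"] cong: if_cong)

lemma trace_shape_square_p: "trace (shape_matrix Y N p ** shape_matrix Y N p) = (\<Sum>i\<in>UNIV. \<Sum>j\<in>UNIV. (h p $ i $ j)\<^sup>2)"
proof -
  have "(partial i N p \<bullet> partial j Y p) * (partial j N p \<bullet> partial i Y p) = (h p $ i $ j)\<^sup>2" for i j
    using h_eq_dN[OF p, of i j] h_eq_dN[OF p, of j i] h_sym[of i j] by (simp add: power2_eq_square)
  then show ?thesis unfolding trace_shape_square dual_p by simp
qed

lemma dg_p: "partial k (\<lambda>x. g x $ i $ j) p = 0"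
  by (simp add: first_fundamental_form_def partial_inner diff_dY[OF p] ddY_normal inner_commute[of "partial i Y p"])

lemma ddg_p: "partial l (partial k (\<lambda>x. g x $ i $ j)) p =
    partial i Y p \<bullet> partial l (partial k (partial j Y)) p + h p $ l $ i * h p $ k $ j
    + h p $ k $ i * h p $ l $ j + partial l (partial k (partial i Y)) p \<bullet> partial j Y p"
  by (simp add: first_fundamental_form_def partial_partial_inner[OF open_U p smooth_dY smooth_dY] ddY_p N_N[OF p])

lemma ddN_N_p: "N p \<bullet> partial l (partial k N) p = - (partial l N p \<bullet> partial k N p)"
proof -
  note d = smooth_on_differentiable[OF _ p]
  have "partial l (partial k (\<lambda>x. N x \<bullet> N x)) p = partial l (\<lambda>x. 0 :: real) p"
    by (rule partial_cong[OF open_U p _ d[OF smooth_on_partial[OF smooth_on_inner[OF open_U smooth_N smooth_N]]]])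
      (simp add: partial_inner diff_N N_dN inner_commute[of "partial k N _"])
  then show ?thesis
    by (simp add: partial_partial_inner[OF open_U p smooth_N smooth_N] inner_commute)
qed

lemma dN_dN_p: "partial k N p \<bullet> partial l N p = (\<Sum>i\<in>UNIV. h p $ k $ i * h p $ l $ i)"
  by (simp add: dN_p inner_sum_left inner_sum_right orthonormal sum_negf if_distrib[of "(*) _"] cong: if_cong)
    (simp add: mult.commute)

lemma dh_p: "partial l (\<lambda>x. h x $ i $ j) p = partial l (partial i (partial j Y)) p \<bullet> N p"
proof -
  have "partial l (\<lambda>x. h x $ i $ j) p = partial l (\<lambda>x. partial i (partial j Y) x \<bullet> N x) p"
    by (rule partial_cong[OF open_U p h_eq smooth_on_differentiable[OF smooth_h p]])
  then show ?thesis
    by (simp add: partial_inner smooth_on_differentiable[OF smooth_ddY p] diff_N[OF p] ddY_p N_dN[OF p])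
qed

lemma ddh_p: "partial l (partial k (\<lambda>x. h x $ i $ j)) p =
    - h p $ i $ j * (partial l N p \<bullet> partial k N p) + partial l (partial i (partial j Y)) p \<bullet> partial k N p
    + partial k (partial i (partial j Y)) p \<bullet> partial l N p + partial l (partial k (partial i (partial j Y))) p \<bullet> N p"
proof -
  note d = smooth_on_differentiable
  have "partial k (\<lambda>x. h x $ i $ j) x = partial k (\<lambda>x. partial i (partial j Y) x \<bullet> N x) x" if "x \<in> U" for x
    by (rule partial_cong[OF open_U that h_eq d[OF smooth_h that]])
  then have "partial l (partial k (\<lambda>x. h x $ i $ j)) p = partial l (partial k (\<lambda>x. partial i (partial j Y) x \<bullet> N x)) p"
    by (rule partial_cong[OF open_U p _ d[OF smooth_on_partial[OF smooth_h] p]])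
  then show ?thesis
    by (simp add: partial_partial_inner[OF open_U p smooth_ddY smooth_N] ddY_p ddN_N_p)
qed

text \<open>Differentiate the identity that the inverse metric times the metric is the unit matrix,
  once and twice. The mixed first-order products vanish at \<open>p\<close> because the first
  derivatives of \<open>g\<close> do.\<close>

lemma dginv_p: "partial k (\<lambda>x. matrix_inv (g x) $ i $ j) p = 0"
  and ddginv_p: "partial l (partial k (\<lambda>x. matrix_inv (g x) $ i $ j)) p = - partial l (partial k (\<lambda>x. g x $ i $ j)) p"
proof -
  let ?a = "\<lambda>m x. matrix_inv (g x) $ i $ m" and ?b = "\<lambda>m x. g x $ m $ j"
  note d = smooth_on_differentiable
  note sm = smooth_on_mult[OF open_U smooth_ginv smooth_g]
  have id: "(\<Sum>m\<in>UNIV. ?a m x * ?b m x) = (if i = j then 1 else 0)" if "x \<in> U" for x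
    using invertible_matrix_inv(2)[OF invertible_g[OF that]]
    by (simp add: matrix_matrix_mult_def vec_eq_iff mat_def)
  have 1: "(\<Sum>m\<in>UNIV. partial k (\<lambda>x. ?a m x * ?b m x) x) = 0" if "x \<in> U" for k x
  proof -
    have "partial k (\<lambda>x. \<Sum>m\<in>UNIV. ?a m x * ?b m x) x = partial k (\<lambda>x. if i = j then 1 else 0 :: real) x"
      by (rule partial_cong[OF open_U that id d[OF smooth_on_sum[OF open_U sm] that]])
    then show ?thesis by (simp add: partial_sum[OF d[OF sm that]])
  qed
  have "(\<Sum>m\<in>UNIV. partial k (?a m) p * mat 1 $ m $ j) = 0" for k
    using 1[OF p, of k] by (simp add: partial_mult d[OF smooth_g p] d[OF smooth_ginv p] dg_p g_p)
  then show 0: "partial k (?a j) p = 0" for k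
    by (simp add: mat_def if_distrib[of "(*) _"] cong: if_cong)
  have "partial l (\<lambda>x. \<Sum>m\<in>UNIV. partial k (\<lambda>x. ?a m x * ?b m x) x) p = partial l (\<lambda>x. 0 :: real) p"
    by (rule partial_cong[OF open_U p 1 d[OF smooth_on_sum[OF open_U smooth_on_partial[OF sm]] p]])
  then have "(\<Sum>m\<in>UNIV. partial l (partial k (\<lambda>x. ?a m x * ?b m x)) p) = 0"
    by (simp add: partial_sum[OF d[OF smooth_on_partial[OF sm] p]])
  then have "(\<Sum>m\<in>UNIV. mat 1 $ i $ m * partial l (partial k (?b m)) p + partial l (partial k (?a m)) p * mat 1 $ m $ j) = 0"
    by (simp add: partial_partial_mult[OF open_U p smooth_ginv smooth_g] dg_p g_p ginv_p[unfolded g_p])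
  then show "partial l (partial k (?a j)) p = - partial l (partial k (\<lambda>x. g x $ i $ j)) p"
    by (simp add: mat_def sum.distrib if_distrib[of "(*) _"] if_distrib[of "\<lambda>c. c * _"] cong: if_cong)
qed

lemma smooth_trace_h: "smooth_on U (\<lambda>x. metric_trace (g x) (h x))"
  unfolding metric_trace_def
  by (intro smooth_on_sum smooth_on_mult open_U smooth_ginv smooth_h)

lemma dtrace_h_p: "partial k (\<lambda>x. metric_trace (g x) (h x)) p = (\<Sum>i\<in>UNIV. partial k (\<lambda>x. h x $ i $ i) p)"
proof -
  note d = smooth_on_differentiable[OF _ p]
  note sm = smooth_on_mult[OF open_U smooth_ginv smooth_h]
  have "partial k (\<lambda>x. metric_trace (g x) (h x)) p
    = (\<Sum>i\<in>UNIV. \<Sum>j\<in>UNIV. partial k (\<lambda>x. matrix_inv (g x) $ i $ j * h x $ i $ j) p)"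
    unfolding metric_trace_def
    by (simp add: partial_sum[OF d[OF smooth_on_sum[OF open_U sm]]] partial_sum[OF d[OF sm]])
  also have "\<dots> = (\<Sum>i\<in>UNIV. \<Sum>j\<in>UNIV. mat 1 $ i $ j * partial k (\<lambda>x. h x $ i $ j) p)"
    by (simp add: partial_mult d[OF smooth_h] d[OF smooth_ginv] dginv_p ginv_p)
  finally show ?thesis
    by (simp add: mat_def if_distrib[of "\<lambda>c. c * _"] cong: if_cong)
qed

text \<open>Adapted coordinates remove only the first derivatives of the metric. The correction term
  comes from the second derivatives of the inverse metric.\<close>

lemma ddtrace_h_p: "partial k (partial k (\<lambda>x. metric_trace (g x) (h x))) p
    = (\<Sum>i\<in>UNIV. partial k (partial k (\<lambda>x. h x $ i $ i)) p)
      - (\<Sum>i\<in>UNIV. \<Sum>j\<in>UNIV. partial k (partial k (\<lambda>x. g x $ i $ j)) p * h p $ i $ j)"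
proof -
  note d = smooth_on_differentiable
  note sm = smooth_on_mult[OF open_U smooth_ginv smooth_h]
  have 1: "partial k (\<lambda>x. metric_trace (g x) (h x)) x
    = (\<Sum>i\<in>UNIV. \<Sum>j\<in>UNIV. partial k (\<lambda>x. matrix_inv (g x) $ i $ j * h x $ i $ j) x)" if "x \<in> U" for x
    unfolding metric_trace_def
    by (simp add: partial_sum[OF d[OF smooth_on_sum[OF open_U sm] that]] partial_sum[OF d[OF sm that]])
  have "partial k (partial k (\<lambda>x. metric_trace (g x) (h x))) p
     = partial k (\<lambda>x. \<Sum>i\<in>UNIV. \<Sum>j\<in>UNIV. partial k (\<lambda>x. matrix_inv (g x) $ i $ j * h x $ i $ j) x) p"
    by (rule partial_cong[OF open_U p 1 d[OF smooth_on_partial[OF smooth_trace_h] p]])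
  also have "\<dots> = (\<Sum>i\<in>UNIV. \<Sum>j\<in>UNIV. partial k (partial k (\<lambda>x. matrix_inv (g x) $ i $ j * h x $ i $ j)) p)"
    by (simp add: partial_sum[OF d[OF smooth_on_sum[OF open_U smooth_on_partial[OF sm]] p]]
        partial_sum[OF d[OF smooth_on_partial[OF sm] p]])
  also have "\<dots> = (\<Sum>i\<in>UNIV. \<Sum>j\<in>UNIV. mat 1 $ i $ j * partial k (partial k (\<lambda>x. h x $ i $ j)) p
      - partial k (partial k (\<lambda>x. g x $ i $ j)) p * h p $ i $ j)"
    by (simp add: partial_partial_mult[OF open_U p smooth_ginv smooth_h] dginv_p ddginv_p ginv_p)
  finally show ?thesis
    by (simp add: mat_def sum_subtractf if_distrib[of "\<lambda>c. c * _"] cong: if_cong)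
qed


lemma diag_third:
  "partial k (partial k (\<lambda>x. h x $ e $ e)) p =
    - h p $ e $ e * (\<Sum>l\<in>UNIV. (h p $ k $ l)\<^sup>2)
    - 2 * (\<Sum>l\<in>UNIV. h p $ k $ l * (partial k (partial e (partial e Y)) p \<bullet> partial l Y p))
    + partial k (partial k (partial e (partial e Y))) p \<bullet> N p"
  unfolding ddh_p dN_dN_p
  by (simp add: dN_p inner_sum_right power2_eq_square)

text \<open>For an eigendirection \<open>e\<close> the summand on the left is the second covariant
  derivative of h along \<open>k\<close>, evaluated on \<open>(e, e)\<close>: the metric term
  accounts for the derivatives of the Christoffel symbols. Both sides are expanded into derivatives
  of \<open>Y\<close>; third- and fourth-order terms agree by symmetry, and only the terms cubic in
  \<open>h\<close> survive.\<close>

lemma simons_identity: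
  assumes eigen: "\<And>j. j \<noteq> e \<Longrightarrow> h p $ e $ j = 0"
  shows "(\<Sum>k\<in>UNIV. partial k (partial k (\<lambda>x. h x $ e $ e)) p - h p $ e $ e * partial k (partial k (\<lambda>x. g x $ e $ e)) p)
    = partial e (partial e (\<lambda>x. metric_trace (g x) (h x))) p
      - h p $ e $ e * trace (shape_matrix Y N p ** shape_matrix Y N p)
      + metric_trace (g p) (h p) * (h p $ e $ e)\<^sup>2"
proof -
  \<comment> \<open>\<open>K\<close> is the eigenvalue, \<open>T\<close> collects tangential
    components of third derivatives of \<open>Y\<close>, and \<open>Q\<close> normal components of
    fourth derivatives. The latter two cancel between the sides.\<close>
  define K where "K = h p $ e $ e"
  define T where "T i j k l = partial i (partial j (partial k Y)) p \<bullet> partial l Y p" for i j k l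
  define Q where "Q k = partial k (partial k (partial e (partial e Y))) p \<bullet> N p" for k
  have eigen': "h p $ e $ j = (if j = e then K else 0)" "h p $ j $ e = (if j = e then K else 0)" for j
    using eigen[of j] h_sym[of e j] by (auto simp: K_def)
  have T: "T k e k e = T e k k e" "T e e k l = T k e e l" "T k k e e = T e k k e" for k l
  proof -
    have sw: "partial a (partial b (partial c Y)) p = partial b (partial a (partial c Y)) p"
      "partial a (partial b (partial c Y)) p = partial a (partial c (partial b Y)) p" for a b c
      using partial_commute[OF open_U smooth_dY p]
      by (auto intro!: partial_cong[OF open_U p] partial_commute[OF open_U smooth_Y]
          smooth_on_differentiable[OF smooth_ddY p])
    show "T k e k e = T e k k e" "T e e k l = T k e e l" "T k k e e = T e k k e"
      unfolding T_def by (metis sw)+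
  qed
  have Q: "partial e (partial e (partial k (partial k Y))) p \<bullet> N p = Q k" for k
    unfolding Q_def using partial_partial_commute_twice[OF open_U smooth_Y p] by metis
  have S: "trace (shape_matrix Y N p ** shape_matrix Y N p) = (\<Sum>k\<in>UNIV. \<Sum>l\<in>UNIV. (h p $ k $ l)\<^sup>2)"
    by (rule trace_shape_square_p)
  have lhs: "(\<Sum>k\<in>UNIV. partial k (partial k (\<lambda>x. h x $ e $ e)) p - h p $ e $ e * partial k (partial k (\<lambda>x. g x $ e $ e)) p)
    = - K * (\<Sum>k\<in>UNIV. \<Sum>l\<in>UNIV. (h p $ k $ l)\<^sup>2)
      - 2 * (\<Sum>k\<in>UNIV. \<Sum>l\<in>UNIV. h p $ k $ l * T k e e l) + (\<Sum>k\<in>UNIV. Q k)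
      - 2 * K * (\<Sum>k\<in>UNIV. T e k k e) - 2 * K ^ 3"
  proof -
    have "h p $ e $ e * partial k (partial k (\<lambda>x. g x $ e $ e)) p = 2 * K * T e k k e + 2 * K * (if k = e then K\<^sup>2 else 0)" for k
      unfolding ddg_p eigen' T(3)[of k, symmetric]
      by (simp add: T_def K_def[symmetric] inner_commute[of "partial e Y p"] power2_eq_square algebra_simps)
    then have "partial k (partial k (\<lambda>x. h x $ e $ e)) p - h p $ e $ e * partial k (partial k (\<lambda>x. g x $ e $ e)) p
      = - K * (\<Sum>l\<in>UNIV. (h p $ k $ l)\<^sup>2) - 2 * (\<Sum>l\<in>UNIV. h p $ k $ l * T k e e l) + Q k
        - 2 * K * T e k k e - (if k = e then 2 * K ^ 3 else 0)" for k
      unfolding diag_third T_def Q_def K_def by (simp add: power2_eq_square power3_eq_cube)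
    then show ?thesis
      by (simp add: sum.distrib sum_subtractf sum_negf sum_distrib_left)
  qed
  have dN_e: "partial e N p = - (K *\<^sub>R partial e Y p)"
    by (simp add: dN_p eigen' if_distrib[of "\<lambda>c. c *\<^sub>R _"] cong: if_cong)
  have rhs: "partial e (partial e (\<lambda>x. metric_trace (g x) (h x))) p
    = - (\<Sum>k\<in>UNIV. h p $ k $ k) * K\<^sup>2 - 2 * K * (\<Sum>k\<in>UNIV. T e k k e) + (\<Sum>k\<in>UNIV. Q k)
      - 2 * (\<Sum>k\<in>UNIV. \<Sum>l\<in>UNIV. h p $ k $ l * T k e e l) - 2 * K ^ 3"
  proof -
    have 1: "partial e (partial e (\<lambda>x. h x $ k $ k)) p = - h p $ k $ k * K\<^sup>2 - 2 * K * T e k k e + Q k" for k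
      unfolding ddh_p Q by (simp add: dN_e orthonormal T_def power2_eq_square)
    \<comment> \<open>Since \<open>e\<close> is an eigendirection, the products of \<open>h\<close>
      in the second derivative of the metric contribute only for i = j = e; this gives the term
      \<open>2 * K ^ 3\<close>.\<close>
    have "(\<Sum>i\<in>UNIV. \<Sum>j\<in>UNIV. partial e (partial e (\<lambda>x. g x $ i $ j)) p * h p $ i $ j)
      = (\<Sum>i\<in>UNIV. \<Sum>j\<in>UNIV. h p $ i $ j * T j e e i) + (\<Sum>i\<in>UNIV. \<Sum>j\<in>UNIV. h p $ i $ j * T i e e j)
        + (\<Sum>i\<in>UNIV. \<Sum>j\<in>UNIV. if j = e then (if i = e then 2 * K ^ 3 else 0) else 0)"
      unfolding ddg_p sum.distrib[symmetric]
    proof (intro sum.cong refl)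
      fix i j
      show "(partial i Y p \<bullet> partial e (partial e (partial j Y)) p + h p $ e $ i * h p $ e $ j
          + h p $ e $ i * h p $ e $ j + partial e (partial e (partial i Y)) p \<bullet> partial j Y p) * h p $ i $ j
        = h p $ i $ j * T j e e i + h p $ i $ j * T i e e j + (if j = e then (if i = e then 2 * K ^ 3 else 0) else 0)"
        unfolding eigen' T(2)[symmetric]
        by (simp add: T_def inner_commute[of "partial i Y p"] K_def[symmetric] power3_eq_cube algebra_simps)
    qed
    also have "(\<Sum>i\<in>UNIV. \<Sum>j\<in>UNIV. h p $ i $ j * T j e e i) = (\<Sum>i\<in>UNIV. \<Sum>j\<in>UNIV. h p $ i $ j * T i e e j)"
      by (subst sum.swap) (simp add: h_sym)
    finally have 2: "(\<Sum>i\<in>UNIV. \<Sum>j\<in>UNIV. partial e (partial e (\<lambda>x. g x $ i $ j)) p * h p $ i $ j)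
      = 2 * (\<Sum>i\<in>UNIV. \<Sum>j\<in>UNIV. h p $ i $ j * T i e e j) + 2 * K ^ 3" by simp
    show ?thesis
      unfolding ddtrace_h_p 1 2 sum.distrib sum_subtractf sum_negf
      by (simp add: sum_distrib_left sum_distrib_right sum_negf)
  qed
  show ?thesis
    unfolding lhs rhs S trace_h_p unfolding K_def[symmetric] by (simp add: algebra_simps)
qed

text \<open>Split the second derivative of \<open>N\<close> into tangential and normal parts. The
  tangential part is a derivative of \<open>h\<close>, rearranged by the Codazzi equation, which at
  \<open>p\<close> is the symmetry of third derivatives of \<open>Y\<close>. The normal part follows
  from \<open>N\<close> having unit length.\<close>

lemma second_derivative_support:
  "Y p \<bullet> partial i (partial i N) p
    = - (Y p \<bullet> N p) * (\<Sum>l\<in>UNIV. (h p $ i $ l)\<^sup>2)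
      - (\<Sum>l\<in>UNIV. (Y p \<bullet> partial l Y p) * partial l (\<lambda>x. h x $ i $ i) p)"
proof -
  have tang: "partial i (partial i N) p \<bullet> partial l Y p = - partial l (\<lambda>x. h x $ i $ i) p" for l
  proof -
    have "partial i (\<lambda>x. h x $ l $ i) p = partial i (\<lambda>x. - 1 * (partial i N x \<bullet> partial l Y x)) p"
      by (rule partial_cong[OF open_U p _ smooth_on_differentiable[OF smooth_h p]])
        (simp add: second_fundamental_form_def)
    also have "\<dots> = - (partial i (partial i N) p \<bullet> partial l Y p)"
      by (subst partial_mult[OF differentiable_const smooth_on_differentiable[OF smooth_on_inner[OF open_U smooth_dN smooth_dY] p]])
        (simp add: partial_inner diff_dN[OF p] diff_dY[OF p] ddY_p inner_commute[of _ "N p"] N_dN[OF p])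
    also have "partial i (\<lambda>x. h x $ l $ i) p = partial l (\<lambda>x. h x $ i $ i) p"
      unfolding dh_p using partial_commute[OF open_U smooth_dY p, of i l] by simp
    finally show ?thesis by simp
  qed
  have norm: "partial i (partial i N) p \<bullet> N p = - (\<Sum>l\<in>UNIV. (h p $ i $ l)\<^sup>2)"
    using ddN_N_p[of i i] by (simp add: dN_dN_p inner_commute power2_eq_square)
  show ?thesis
    by (subst expansion_p[of "partial i (partial i N) p"])
      (simp add: tang norm inner_add_right inner_diff_right inner_sum_right sum_negf mult_ac)
qed

text \<open>The expander equation replaces H by half the support function up to a constant. In the
  second derivative of the latter the mixed products give -2 h_ii and the second derivative of
  \<open>Y\<close> gives h_ii, hence the single -h_ii.\<close>

lemma expander_derivatives:
  assumes "\<And>y. y \<in> U \<Longrightarrow> metric_trace (g y) (h y) = lam + (Y y \<bullet> N y) / 2"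
  shows "partial i (partial i (\<lambda>x. metric_trace (g x) (h x))) p
    = (- h p $ i $ i - (Y p \<bullet> N p) * (\<Sum>l\<in>UNIV. (h p $ i $ l)\<^sup>2)
      - (\<Sum>l\<in>UNIV. (Y p \<bullet> partial l Y p) * partial l (\<lambda>x. h x $ i $ i) p)) / 2"
proof -
  note d = smooth_on_differentiable
  note smYN = smooth_on_inner[OF open_U smooth_Y smooth_N]
  have eq: "metric_trace (g y) (h y) = lam + 1/2 * (Y y \<bullet> N y)" if "y \<in> U" for y
    using assms[OF that] by simp
  have 1: "partial i (\<lambda>x. metric_trace (g x) (h x)) y = 1/2 * partial i (\<lambda>x. Y x \<bullet> N x) y" if "y \<in> U" for y
  proof -
    have "partial i (\<lambda>x. metric_trace (g x) (h x)) y = partial i (\<lambda>y. lam + 1/2 * (Y y \<bullet> N y)) y"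
      by (rule partial_cong[OF open_U that eq d[OF smooth_trace_h that]])
    also have "\<dots> = partial i (\<lambda>y. 1/2 * (Y y \<bullet> N y)) y"
      by (subst partial_add[OF differentiable_const d[OF smooth_on_mult[OF open_U smooth_on_const smYN] that]]) simp
    also have "\<dots> = 1/2 * partial i (\<lambda>x. Y x \<bullet> N x) y"
      by (subst partial_mult[OF differentiable_const d[OF smYN that]]) simp
    finally show ?thesis .
  qed
  have "partial i (partial i (\<lambda>x. metric_trace (g x) (h x))) p = partial i (\<lambda>y. 1/2 * partial i (\<lambda>x. Y x \<bullet> N x) y) p"
    by (rule partial_cong[OF open_U p 1 d[OF smooth_on_partial[OF smooth_trace_h] p]])
  also have "\<dots> = 1/2 * partial i (partial i (\<lambda>x. Y x \<bullet> N x)) p"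
    by (subst partial_mult[OF differentiable_const d[OF smooth_on_partial[OF smYN] p]]) simp
  also have "partial i (partial i (\<lambda>x. Y x \<bullet> N x)) p
    = Y p \<bullet> partial i (partial i N) p - h p $ i $ i"
    using h_eq_dN[OF p, of i i]
    by (simp add: partial_partial_inner[OF open_U p smooth_Y smooth_N] ddY_p N_N[OF p] inner_commute[of "partial i N p"])
  finally show ?thesis unfolding second_derivative_support by simp
qed


text \<open>\<open>h_ee / g_ee\<close> is the normal curvature in the direction of the coordinate
  vector \<open>e\<close>, normalised to unit length; it is smooth also where the smallest principal
  curvature is not. The first and second derivative tests at \<open>p\<close> supply the hypotheses
  of \<open>expander_test_algebra\<close>.\<close>

lemma expander_min_inequality:
  fixes e lam eps
  defines "H \<equiv> \<lambda>y. metric_trace (g y) (h y)" and "n \<equiv> real CARD('n)"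
    and "m \<equiv> h p $ e $ e / metric_trace (g p) (h p)" and "P \<equiv> Y p \<bullet> N p"
    and "S \<equiv> trace (shape_matrix Y N p ** shape_matrix Y N p)"
  assumes eigen: "\<And>j. j \<noteq> e \<Longrightarrow> h p $ e $ j = 0"
    and expander: "\<And>y. y \<in> U \<Longrightarrow> H y = lam + (Y y \<bullet> N y) / 2"
    and pos: "\<And>y. y \<in> U \<Longrightarrow> H y > 0"
    and "eps \<ge> 0" "n \<ge> 2"
    and min: "\<And>y. y \<in> U \<Longrightarrow>
      h p $ e $ e / (g p $ e $ e * H p) - eps * ((Y p \<bullet> Y p) / 2 + 2 * (n - 1) * ln (H p))
      \<le> h y $ e $ e / (g y $ e $ e * H y) - eps * ((Y y \<bullet> Y y) / 2 + 2 * (n - 1) * ln (H y))"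
  shows "eps * (1 + H p * P - (n - 1) * S * P / H p) \<le> lam * m * (m * H p - S / H p)"
proof -
  note d = smooth_on_differentiable[OF _ p]
  have gpos: "g y $ e $ e > 0" if "y \<in> U" for y
    using dY_eq_0[OF that, of "axis e 1"]
    by (auto simp: first_fundamental_form_def partial_def axis_eq_0_iff)
  \<comment> \<open>\<open>a\<close> is the curvature in direction \<open>e\<close>,
    \<open>q\<close> its ratio to \<open>H\<close>, and \<open>W\<close> the barrier. Products with
    inverses are used so that the smoothness and product rules apply.\<close>
  define a where "a y = h y $ e $ e * inverse (g y $ e $ e)" for y
  define q where "q y = a y * inverse (H y)" for y
  define L where "L y = ln (H y)" for y
  define W where "W y = 1/2 * (Y y \<bullet> Y y) + 2 * (n - 1) * L y" for y
  have sH: "smooth_on U H" unfolding H_def by (rule smooth_trace_h)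
  have sa: "smooth_on U a"
    unfolding a_def[abs_def] using gpos
    by (intro smooth_on_mult smooth_on_inverse smooth_h smooth_g open_U) (metis less_irrefl)
  have sq: "smooth_on U q"
    unfolding q_def[abs_def] using pos
    by (intro smooth_on_mult smooth_on_inverse sa sH open_U) (metis less_irrefl)
  have sL: "smooth_on U L"
    unfolding L_def[abs_def] by (rule smooth_on_ln[OF open_U pos sH])
  note sYY = smooth_on_inner[OF open_U smooth_Y smooth_Y]
  have sW: "smooth_on U W"
    unfolding W_def[abs_def] by (intro smooth_on_add smooth_on_mult sYY sL open_U smooth_on_const)
  have sF: "smooth_on U (\<lambda>y. q y + (- eps) * W y)"
    by (intro smooth_on_add smooth_on_mult sq sW open_U smooth_on_const)
  have qe: "q y = h y $ e $ e / (g y $ e $ e * H y)" for y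
    by (simp add: q_def a_def divide_inverse mult.assoc)
  have We: "W y = (Y y \<bullet> Y y) / 2 + 2 * (n - 1) * ln (H y)" for y
    by (simp add: W_def L_def)
  have minF: "q p + (- eps) * W p \<le> q y + (- eps) * W y" if "y \<in> U" for y
    using min[OF that] unfolding qe[symmetric] We[symmetric] by simp
  have dlin: "partial k (\<lambda>y. q y + (- eps) * W y) y = partial k q y + (- eps) * partial k W y" if "y \<in> U" for k y
  proof -
    have dW: "(\<lambda>y. (- eps) * W y) differentiable (at y)"
      by (rule smooth_on_differentiable[OF smooth_on_mult[OF open_U smooth_on_const sW] that])
    show ?thesis
      by (subst partial_add[OF smooth_on_differentiable[OF sq that] dW],
          subst partial_mult[OF differentiable_const smooth_on_differentiable[OF sW that]]) simp
  qed
  have ddlin: "partial k (partial k (\<lambda>y. q y + (- eps) * W y)) p = partial k (partial k q) p + (- eps) * partial k (partial k W) p" for k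
  proof -
    have dW: "(\<lambda>y. (- eps) * partial k W y) differentiable (at p)"
      by (rule d[OF smooth_on_mult[OF open_U smooth_on_const smooth_on_partial[OF sW]]])
    have "partial k (partial k (\<lambda>y. q y + (- eps) * W y)) p = partial k (\<lambda>y. partial k q y + (- eps) * partial k W y) p"
      by (rule partial_cong[OF open_U p dlin d[OF smooth_on_partial[OF sF]]])
    then show ?thesis
      by (subst (asm) partial_add[OF d[OF smooth_on_partial[OF sq]] dW],
          subst (asm) partial_mult[OF differentiable_const d[OF smooth_on_partial[OF sW]]]) simp
  qed
  have q1: "partial k q p = eps * partial k W p" for k
    using partial_local_min(1)[OF open_U p sF minF] dlin[OF p] by simp
  have q2: "partial k (partial k q) p \<ge> eps * partial k (partial k W) p" for k
    using partial_local_min(2)[OF open_U p sF minF] ddlin by simp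
  have W1: "partial k W y = Y y \<bullet> partial k Y y + 2 * (n - 1) * partial k L y" if "y \<in> U" for k y
  proof -
    note dy = smooth_on_differentiable[OF _ that]
    have "partial k W y = partial k (\<lambda>y. 1/2 * (Y y \<bullet> Y y)) y + partial k (\<lambda>y. 2 * (n - 1) * L y) y"
      unfolding W_def[abs_def]
      by (rule partial_add) (rule dy[OF smooth_on_mult[OF open_U smooth_on_const]], rule sYY sL)+
    then show ?thesis
      by (subst (asm) partial_mult[OF differentiable_const dy[OF sYY]],
          subst (asm) partial_mult[OF differentiable_const dy[OF sL]])
        (simp add: partial_inner diff_Y[OF that] inner_commute)
  qed
  have W2: "partial k (partial k W) p = 1 + h p $ k $ k * P + 2 * (n - 1) * partial k (partial k L) p" for k
  proof -
    note sYk = smooth_on_inner[OF open_U smooth_Y smooth_dY]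
    note sLk = smooth_on_mult[OF open_U smooth_on_const smooth_on_partial[OF sL]]
    have "partial k (partial k W) p = partial k (\<lambda>y. Y y \<bullet> partial k Y y + 2 * (n - 1) * partial k L y) p"
      by (rule partial_cong[OF open_U p W1 d[OF smooth_on_partial[OF sW]]])
    also have "\<dots> = partial k (\<lambda>y. Y y \<bullet> partial k Y y) p + partial k (\<lambda>y. 2 * (n - 1) * partial k L y) p"
      by (rule partial_add[OF d[OF sYk] d[OF sLk]])
    finally show ?thesis
      by (subst (asm) partial_mult[OF differentiable_const d[OF smooth_on_partial[OF sL]]])
        (simp add: partial_inner diff_Y[OF p] diff_dY[OF p] ddY_p orthonormal P_def)
  qed
  have L1: "partial k H y = partial k L y * H y" if "y \<in> U" for k y
    unfolding L_def[abs_def] using smooth_on_differentiable[OF sH that] pos[OF that] by (rule partial_ln)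
  have L2: "partial k (partial k H) p = partial k (partial k L) p * H p + partial k L p * partial k H p" for k
  proof -
    have "partial k (partial k H) p = partial k (\<lambda>y. partial k L y * H y) p"
      by (rule partial_cong[OF open_U p L1 d[OF smooth_on_partial[OF sH]]])
    then show ?thesis by (simp add: partial_mult d[OF smooth_on_partial[OF sL]] d[OF sH])
  qed
  have Hp: "H p > 0" by (rule pos[OF p])
  have L1': "partial k L p = partial k H p / H p" for k
    using L1[OF p, of k] Hp by (simp add: field_simps)
  have L2': "partial k (partial k L) p = partial k (partial k H) p / H p - (partial k H p / H p)\<^sup>2" for k
    using L2[of k] Hp unfolding L1' by (simp add: field_simps power2_eq_square)
  have aq: "a y = q y * H y" if "y \<in> U" for y
    using pos[OF that] by (simp add: q_def)
  have ha: "h y $ e $ e = a y * g y $ e $ e" if "y \<in> U" for y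
    using gpos[OF that] by (simp add: a_def)
  have qp: "q p = m" and ap: "a p = h p $ e $ e"
    by (auto simp: q_def a_def g_p mat_def m_def H_def divide_inverse)
  have a1: "partial k a p = partial k q p * H p + m * partial k H p" for k
    using partial_cong[OF open_U p aq d[OF sa]]
    by (simp add: partial_mult d[OF sq] d[OF sH] qp)
  have a2: "partial k (partial k a) p = partial k (partial k q) p * H p
      + 2 * (partial k q p * partial k H p) + m * partial k (partial k H) p" for k
  proof -
    have "partial k a y = partial k (\<lambda>y. q y * H y) y" if "y \<in> U" for y
      by (rule partial_cong[OF open_U that aq smooth_on_differentiable[OF sa that]])
    then have "partial k (partial k a) p = partial k (partial k (\<lambda>y. q y * H y)) p"
      by (rule partial_cong[OF open_U p _ d[OF smooth_on_partial[OF sa]]])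
    then show ?thesis by (simp add: partial_partial_mult[OF open_U p sq sH] qp)
  qed
  have h1: "partial k (\<lambda>x. h x $ e $ e) p = partial k a p" for k
    using partial_cong[OF open_U p ha d[OF smooth_h]]
    by (simp add: partial_mult d[OF sa] d[OF smooth_g] dg_p) (simp add: g_p mat_def)
  \<comment> \<open>Passing from \<open>h_ee\<close> to \<open>a\<close> costs exactly the metric
    term that is subtracted on the left of Simons' identity; so that left-hand side is the Laplacian
    of \<open>a\<close> at \<open>p\<close>.\<close>
  have h2: "partial k (partial k (\<lambda>x. h x $ e $ e)) p
     = partial k (partial k a) p + h p $ e $ e * partial k (partial k (\<lambda>x. g x $ e $ e)) p" for k
  proof -
    have "partial k (\<lambda>x. h x $ e $ e) y = partial k (\<lambda>y. a y * g y $ e $ e) y" if "y \<in> U" for y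
      by (rule partial_cong[OF open_U that ha smooth_on_differentiable[OF smooth_h that]])
    then have "partial k (partial k (\<lambda>x. h x $ e $ e)) p = partial k (partial k (\<lambda>y. a y * g y $ e $ e)) p"
      by (rule partial_cong[OF open_U p _ d[OF smooth_on_partial[OF smooth_h]]])
    then show ?thesis
      by (simp add: partial_partial_mult[OF open_U p sa smooth_g] dg_p ap) (simp add: g_p mat_def)
  qed
  have mH: "m * H p = h p $ e $ e" using Hp by (simp add: m_def H_def)
  have trH: "(\<Sum>k\<in>UNIV. h p $ k $ k) = H p" by (simp add: H_def trace_h_p)
  have Sum_e: "(\<Sum>l\<in>UNIV. (h p $ e $ l)\<^sup>2) = (h p $ e $ e)\<^sup>2"
  proof -
    have "(h p $ e $ l)\<^sup>2 = (if l = e then (h p $ e $ e)\<^sup>2 else 0)" for l using eigen[of l] by auto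
    then have "(\<Sum>l\<in>UNIV. (h p $ e $ l)\<^sup>2) = (\<Sum>l\<in>UNIV. if l = e then (h p $ e $ e)\<^sup>2 else 0)"
      by (rule sum.cong[OF refl])
    then show ?thesis by simp
  qed
  have der: "partial i (partial i H) p = (- h p $ i $ i - P * (\<Sum>l\<in>UNIV. (h p $ i $ l)\<^sup>2)
      - (\<Sum>l\<in>UNIV. (Y p \<bullet> partial l Y p) * partial l (\<lambda>x. h x $ i $ i) p)) / 2" for i
    unfolding H_def P_def by (rule expander_derivatives[OF expander[unfolded H_def]])
  have dHk: "partial l H p = (\<Sum>i\<in>UNIV. partial l (\<lambda>x. h x $ i $ i) p)" for l
    unfolding H_def by (rule dtrace_h_p)
  show ?thesis
  proof (rule expander_test_algebra[where I = "UNIV :: 'n set" and v = "\<lambda>k. Y p \<bullet> partial k Y p"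
        and dH = "\<lambda>k. partial k H p" and ddH = "\<lambda>k. partial k (partial k H) p"
        and dq = "\<lambda>k. partial k q p" and ddq = "\<lambda>k. partial k (partial k q) p"
        and da = "\<lambda>k. partial k a p" and dda = "\<lambda>k. partial k (partial k a) p"
        and hk = "\<lambda>k. h p $ k $ k" and Hee = "partial e (partial e H) p"])
    show "lam = H p - P / 2" using expander[OF p] by (simp add: P_def)
    show "partial k q p = eps * (Y p \<bullet> partial k Y p + 2 * (n - 1) * (partial k H p / H p))" for k
      by (simp add: q1 W1[OF p] L1')
    show "partial k (partial k q) p \<ge> eps * (1 + h p $ k $ k * P + 2 * (n - 1) * (partial k (partial k H) p / H p - (partial k H p / H p)\<^sup>2))" for k
      using q2[of k] unfolding W2 L2' .
    show "partial e (partial e H) p = (- (m * H p) - (m * H p)\<^sup>2 * P - (\<Sum>k\<in>UNIV. Y p \<bullet> partial k Y p * partial k a p)) / 2"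
      unfolding der[of e] Sum_e h1 mH by (simp add: mult.commute)
    show "(\<Sum>k\<in>UNIV. partial k (partial k H) p) = (- H p - S * P - (\<Sum>k\<in>UNIV. Y p \<bullet> partial k Y p * partial k H p)) / 2"
    proof -
      have "(\<Sum>i\<in>UNIV. \<Sum>l\<in>UNIV. Y p \<bullet> partial l Y p * partial l (\<lambda>x. h x $ i $ i) p)
        = (\<Sum>l\<in>UNIV. Y p \<bullet> partial l Y p * partial l H p)"
        unfolding dHk by (subst sum.swap) (simp add: sum_distrib_left)
      then show ?thesis
        unfolding der sum_divide_distrib[symmetric] sum_subtractf sum_negf trH S_def trace_shape_square_p
        by (simp add: sum_distrib_left mult.commute flip: sum_distrib_left)
    qed
    show "(\<Sum>k\<in>UNIV. partial k (partial k a) p) = partial e (partial e H) p - m * H p * S + H p * (m * H p)\<^sup>2"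
      using simons_identity[OF eigen] unfolding h2 mH unfolding S_def H_def by simp
  qed (use assms Hp a1 a2 trH in \<open>simp_all add: n_def\<close>)
qed

end

section \<open>Quadratic reparametrisation\<close>

text \<open>A vector in the kernel of the derivative is also in the kernel of the Gram matrix.
  Unlike injectivity, a nonzero determinant is visibly an open condition.\<close>

lemma inj_frechet_derivative_if_det_nonzero:
  assumes "Y differentiable (at u)" "det (first_fundamental_form Y u) \<noteq> 0"
  shows "inj (frechet_derivative Y (at u))"
proof (rule linear_inj_iff_eq_0[THEN iffD2, OF linear_frechet_derivative[OF assms(1)]], intro allI impI)
  fix v
  assume "frechet_derivative Y (at u) v = 0"
  then have "(\<Sum>j\<in>UNIV. v $ j *\<^sub>R partial j Y u) = 0"
    by (simp add: frechet_derivative_eq_sum_partial[OF assms(1)])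
  then have "partial i Y u \<bullet> (\<Sum>j\<in>UNIV. v $ j *\<^sub>R partial j Y u) = 0" for i by simp
  then have "first_fundamental_form Y u *v v = 0"
    by (simp add: vec_eq_iff matrix_vector_mult_def first_fundamental_form_def inner_sum_right mult.commute)
  moreover have "inj ((*v) (first_fundamental_form Y u))"
    using assms(2) by (simp add: inj_matrix_vector_mult invertible_det_nz)
  ultimately show "v = 0"
    by (metis injD matrix_vector_mult_0_right)
qed

lemma frechet_derivative_chain:
  assumes "t differentiable (at y)" "f differentiable (at (t y))"
  shows "frechet_derivative (\<lambda>z. f (t z)) (at y) v = frechet_derivative f (at (t y)) (frechet_derivative t (at y) v)"
  using frechet_derivative_compose[OF assms] by (simp add: o_def)

lemma partial_chain:
  assumes "t differentiable (at y)" "f differentiable (at (t y))"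
  shows "partial i (\<lambda>z. f (t z)) y = (\<Sum>a\<in>UNIV. partial i t y $ a *\<^sub>R partial a f (t y))"
  unfolding partial_def[of i] frechet_derivative_chain[OF assms]
  by (rule frechet_derivative_eq_sum_partial[OF assms(2)])

context patch
begin

section \<open>Independence of the parametrisation, and coordinates adapted to a point\<close>

lemma shape_dY_vec: "u \<in> U \<Longrightarrow> shape_matrix Y N u *v frechet_derivative Y (at u) v = - frechet_derivative N (at u) v"
  by (simp add: frechet_derivative_eq_sum_partial diff_Y diff_N linear_sum[OF matrix_vector_mul_linear]
      matrix_vector_mult_scaleR shape_dY sum_negf)

text \<open>The chain rule sends the derivatives of \<open>Y\<close> and of \<open>N\<close> through
  the same vectors \<open>partial k t y\<close>, so the old shape matrix satisfies the equations
  that determine the new one.\<close>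

lemma shape_matrix_reparam:
  assumes "patch V Y' N'" "open W" "y \<in> W" "W \<subseteq> V"
    and t: "t differentiable (at y)" "t y \<in> U"
    and eq: "\<And>z. z \<in> W \<Longrightarrow> Y' z = Y (t z)" "\<And>z. z \<in> W \<Longrightarrow> N' z = N (t z)"
  shows "shape_matrix Y' N' y = shape_matrix Y N (t y)"
proof -
  interpret P': patch V Y' N' by fact
  have y: "y \<in> V" using assms by auto
  have "partial k Y' y = frechet_derivative Y (at (t y)) (partial k t y)" for k
    using partial_cong[OF assms(2,3) eq(1) P'.diff_Y[OF y], of k]
    by (simp add: partial_def frechet_derivative_chain[OF t(1) diff_Y[OF t(2)]])
  moreover have "partial k N' y = frechet_derivative N (at (t y)) (partial k t y)" for k
    using partial_cong[OF assms(2,3) eq(2) P'.diff_N[OF y], of k]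
    by (simp add: partial_def frechet_derivative_chain[OF t(1) diff_N[OF t(2)]])
  ultimately have "shape_matrix Y N (t y) *v partial k Y' y = - partial k N' y" for k
    by (simp add: shape_dY_vec[OF t(2)])
  moreover have "shape_matrix Y N (t y) *v N' y = 0"
    using eq(2)[OF assms(3)] by (simp add: shape_N[OF t(2)])
  ultimately show ?thesis by (intro P'.shape_unique[OF y, symmetric]) auto
qed

text \<open>Map real n-space isometrically onto the tangent hyperplane, after a rotation that takes
  the axis \<open>e\<close> to the preimage of \<open>w\<close>.\<close>

lemma tangent_isometry:
  fixes e :: 'n
  assumes u: "u \<in> U" and w: "norm w = 1" "w \<bullet> N u = 0"
  obtains E where "\<And>i j. E i \<bullet> E j = (if i = j then 1 else 0)" "\<And>i. E i \<bullet> N u = 0" "E e = w"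
proof -
  let ?T = "{x. N u \<bullet> x = 0}"
  have Nnz: "N u \<noteq> 0" using N_N[OF u] by auto
  have "dim (UNIV :: (real^'n) set) = dim ?T"
    using dim by (simp add: dim_hyperplane[OF Nnz])
  then obtain f :: "real^'n \<Rightarrow> real^'m" where f: "linear f" "range f = ?T" "\<And>x. norm (f x) = norm x"
    using isometry_subspaces[of "UNIV :: (real^'n) set" ?T, OF subspace_UNIV subspace_hyperplane]
    by (metis UNIV_I)
  have "w \<in> range f" using f(2) w(2) by (simp add: inner_commute)
  then obtain a where a: "w = f a" by auto
  have "norm (axis e 1 :: real^'n) = norm a" using f(3)[of a] w(1) a by simp
  then obtain r :: "real^'n \<Rightarrow> real^'n" where r: "orthogonal_transformation r" "r (axis e 1) = a"
    by (rule orthogonal_transformation_exists) blast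
  have fin: "f x \<bullet> f y = x \<bullet> y" for x y
    using f(3)[of "x + y"] f(3)[of x] f(3)[of y] by (simp add: dot_norm linear_add[OF f(1), symmetric])
  show ?thesis
  proof (rule that[of "\<lambda>i. f (r (axis i 1))"])
    show "f (r (axis i 1)) \<bullet> f (r (axis j 1)) = (if i = j then 1 else 0)" for i j
      using r(1) by (simp add: fin orthogonal_transformation_def inner_axis_axis)
    show "f (r (axis i 1)) \<bullet> N u = 0" for i
      using f(2) by (metis (mono_tags, lifting) mem_Collect_eq rangeI inner_commute)
    show "f (r (axis e 1)) = w" using r(2) a by simp
  qed
qed

lemma tangent_preimage:
  assumes u: "u \<in> U" and z: "z \<bullet> N u = 0"
  shows "(\<Sum>a\<in>UNIV. (\<chi> k. z \<bullet> dual k u) $ a *\<^sub>R partial a Y u) = z"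
  using frame_expansion[OF u, of z] z by simp

text \<open>The linear part of \<open>t\<close> makes the frame orthonormal with \<open>w\<close> in
  position \<open>e\<close>; the quadratic part cancels the tangential second derivatives and
  thereby the Christoffel symbols at the centre.\<close>

lemma quadratic_coordinates:
  fixes e :: 'n
  assumes u: "u \<in> U" and w: "norm w = 1" "w \<bullet> N u = 0"
  obtains V t where "0 \<in> V" "t 0 = u" "t ` V \<subseteq> U" "\<And>y. y \<in> V \<Longrightarrow> t differentiable (at y)"
    "adapted_patch V (\<lambda>y. Y (t y)) (\<lambda>y. N (t y)) 0" "partial e (\<lambda>y. Y (t y)) 0 = w"
proof -
  obtain E where E: "\<And>i j. E i \<bullet> E j = (if i = j then 1 else 0)" "\<And>i. E i \<bullet> N u = 0" "E e = w"
    using tangent_isometry[OF assms] by metis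
  define A where "A i = (\<chi> k. E i \<bullet> dual k u)" for i
  \<comment> \<open>\<open>c i j\<close> is the second derivative of \<open>Y\<close> along the
    linear part of \<open>t\<close>, and \<open>c' i j\<close> is minus its tangential part.
    \<open>Q i j\<close> is the coordinate vector that the derivative of \<open>Y\<close> maps to
    \<open>c' i j\<close>.\<close>
  define c where "c i j = (\<Sum>a\<in>UNIV. \<Sum>b\<in>UNIV. (A i $ a * A j $ b) *\<^sub>R partial b (partial a Y) u)" for i j
  define c' where "c' i j = (c i j \<bullet> N u) *\<^sub>R N u - c i j" for i j
  define Q where "Q i j = (\<chi> k. c' i j \<bullet> dual k u)" for i j
  have c_sym: "c i j = c j i" for i j
    unfolding c_def using partial_commute[OF open_U smooth_Y u]
    by (subst sum.swap) (simp add: mult.commute)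
  have dA: "(\<Sum>a\<in>UNIV. A i $ a *\<^sub>R partial a Y u) = E i" for i
    unfolding A_def by (rule tangent_preimage[OF u E(2)])
  have dQ: "(\<Sum>a\<in>UNIV. Q i j $ a *\<^sub>R partial a Y u) = c' i j" for i j
    unfolding Q_def by (rule tangent_preimage[OF u]) (simp add: c'_def inner_diff_left N_N[OF u])
  define t where "t y = u + (\<Sum>i\<in>UNIV. y $ i *\<^sub>R A i) + (\<Sum>i\<in>UNIV. \<Sum>j\<in>UNIV. (y $ i * y $ j) *\<^sub>R ((1/2) *\<^sub>R Q i j))" for y :: "real^'n"
  \<comment> \<open>The expected partial derivative of \<open>t\<close>: the factor 1/2 in
    \<open>t\<close> is compensated by the symmetry of \<open>Q\<close>.\<close>
  define t' where "t' i y = A i + (\<Sum>j\<in>UNIV. y $ j *\<^sub>R Q i j)" for i and y :: "real^'n"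
  have Q_sym: "Q i j = Q j i" for i j by (simp add: Q_def c'_def c_sym[of i j])
  have comp: "smooth_on S (\<lambda>y :: real^'n. y $ i)" for S i
    by (rule smooth_on_linear[OF bounded_linear_vec_nth])
  have smt: "smooth_on UNIV t"
    unfolding t_def[abs_def]
    by (intro smooth_on_add smooth_on_sum smooth_on_scaleR smooth_on_mult comp smooth_on_const open_UNIV)
  have smt': "smooth_on UNIV (t' i)" for i
    unfolding t'_def[abs_def]
    by (intro smooth_on_add smooth_on_sum smooth_on_scaleR comp smooth_on_const open_UNIV)
  have dt: "t differentiable (at y)" for y
    using smooth_on_differentiable[OF smt] by simp
  have t': "partial i t y = t' i y" for i y
  proof -
    have "(t has_derivative (\<lambda>v. (\<Sum>i\<in>UNIV. v $ i *\<^sub>R A i)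
        + (\<Sum>i\<in>UNIV. \<Sum>j\<in>UNIV. (y $ i * v $ j + v $ i * y $ j) *\<^sub>R ((1/2) *\<^sub>R Q i j)))) (at y)"
      unfolding t_def[abs_def]
      by (auto intro!: derivative_eq_intros has_derivative_sum bounded_linear_imp_has_derivative[OF bounded_linear_vec_nth])
        (simp add: add_divide_distrib mult.commute)
    from frechet_derivative_at[OF this, symmetric]
    have "partial i t y = A i + (\<Sum>k\<in>UNIV. \<Sum>j\<in>UNIV. (y $ k * axis i 1 $ j) *\<^sub>R ((1/2) *\<^sub>R Q k j))
       + (\<Sum>k\<in>UNIV. \<Sum>j\<in>UNIV. (axis i 1 $ k * y $ j) *\<^sub>R ((1/2) *\<^sub>R Q k j))"
      by (simp add: partial_def axis_def scaleR_left_distrib add_divide_distrib sum.distrib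
          if_distrib[of "\<lambda>c. c *\<^sub>R _"] cong: if_cong)
    also have "(\<Sum>k\<in>UNIV. \<Sum>j\<in>UNIV. (axis i 1 $ k * y $ j) *\<^sub>R ((1/2) *\<^sub>R Q k j))
        = (\<Sum>j\<in>UNIV. y $ j *\<^sub>R ((1/2) *\<^sub>R Q i j))"
      by (subst sum.swap) (simp add: axis_def if_distrib[of "\<lambda>c. c *\<^sub>R _"] if_distrib[of "\<lambda>c. c * _"]
          if_distrib[of "\<lambda>c. c / 2"] cong: if_cong)
    also have "(\<Sum>k\<in>UNIV. \<Sum>j\<in>UNIV. (y $ k * axis i 1 $ j) *\<^sub>R ((1/2) *\<^sub>R Q k j))
        = (\<Sum>j\<in>UNIV. y $ j *\<^sub>R ((1/2) *\<^sub>R Q i j))"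
      by (simp add: Q_sym[of i] axis_def if_distrib[of "\<lambda>c. c *\<^sub>R _"] if_distrib[of "(*) _"]
          if_distrib[of "\<lambda>c. c / 2"] cong: if_cong)
    also have "A i + (\<Sum>j\<in>UNIV. y $ j *\<^sub>R ((1/2) *\<^sub>R Q i j)) + (\<Sum>j\<in>UNIV. y $ j *\<^sub>R ((1/2) *\<^sub>R Q i j)) = t' i y"
      by (simp add: t'_def add.assoc sum.distrib[symmetric] scaleR_left_distrib[symmetric])
    finally show ?thesis .
  qed
  have t0: "t 0 = u" and t'0: "t' i 0 = A i" for i by (simp_all add: t_def t'_def)
  have dt'0: "partial j (t' i) 0 = Q i j" for i j
  proof -
    have "(t' i has_derivative (\<lambda>v. \<Sum>j\<in>UNIV. v $ j *\<^sub>R Q i j)) (at 0)"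
      unfolding t'_def[abs_def]
      by (auto intro!: derivative_eq_intros has_derivative_sum bounded_linear_imp_has_derivative[OF bounded_linear_vec_nth])
    from frechet_derivative_at[OF this, symmetric] show ?thesis
      by (simp add: partial_def axis_def if_distrib[of "\<lambda>c. c *\<^sub>R _"] cong: if_cong)
  qed
  define V0 where "V0 = t -` U"
  have V0: "open V0"
    using smooth_on_continuous_on[OF smt] open_U
    unfolding V0_def by (simp add: continuous_on_open_vimage[OF open_UNIV])
  have V0': "t ` V0 \<subseteq> U" "0 \<in> V0" using t0 u by (auto simp: V0_def)
  define Y' where "Y' y = Y (t y)" for y
  define N' where "N' y = N (t y)" for y
  have smY': "smooth_on V0 Y'" and smN': "smooth_on V0 N'"
    unfolding Y'_def[abs_def] N'_def[abs_def]
    by (rule smooth_on_compose[OF open_U V0 V0'(1) _ smooth_on_subset[OF smt]],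
        auto simp: smooth_Y smooth_N)+
  have Y'1: "partial i Y' y = (\<Sum>a\<in>UNIV. t' i y $ a *\<^sub>R partial a Y (t y))" if "y \<in> V0" for i y
    unfolding Y'_def[abs_def]
    by (subst partial_chain[OF dt]) (use that V0' in \<open>auto intro!: diff_Y simp: t'\<close>)
  have Y'10: "partial i Y' 0 = E i" for i
    by (simp add: Y'1[OF V0'(2)] t'0 t0 dA)
  have Y'20: "partial j (partial i Y') 0 = (c i j \<bullet> N u) *\<^sub>R N u" for i j
  proof -
    have smYt: "smooth_on V0 (\<lambda>y. partial a Y (t y))" for a
      by (rule smooth_on_compose[OF open_U V0 V0'(1) smooth_dY smooth_on_subset[OF smt]]) simp
    have smt'a: "smooth_on V0 (\<lambda>y. t' i y $ a)" for a
      using smooth_on_compose[OF open_UNIV open_UNIV _ comp[of UNIV a] smt'[of i]] smooth_on_subset by blast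
    note d0 = smooth_on_differentiable[OF _ V0'(2)]
    have cmp: "partial j (\<lambda>y. t' i y $ a) 0 = Q i j $ a" for a
    proof -
      have d': "t' i differentiable (at 0)" using smooth_on_differentiable[OF smt'] by simp
      then have "((\<lambda>y. t' i y $ a) has_derivative (\<lambda>v. frechet_derivative (t' i) (at 0) v $ a)) (at 0)"
        unfolding frechet_derivative_works by (rule bounded_linear.has_derivative[OF bounded_linear_vec_nth])
      from frechet_derivative_at[OF this, symmetric] show ?thesis
        using dt'0[of j i] by (simp add: partial_def)
    qed
    have "partial j (partial i Y') 0 = partial j (\<lambda>y. \<Sum>a\<in>UNIV. t' i y $ a *\<^sub>R partial a Y (t y)) 0"
      by (rule partial_cong[OF V0 V0'(2) Y'1 d0[OF smooth_on_partial[OF smY']]])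
    also have "\<dots> = (\<Sum>a\<in>UNIV. partial j (\<lambda>y. t' i y $ a *\<^sub>R partial a Y (t y)) 0)"
      by (rule partial_sum[OF d0[OF smooth_on_scaleR[OF V0 smt'a smYt]]])
    also have "\<dots> = (\<Sum>a\<in>UNIV. A i $ a *\<^sub>R (\<Sum>b\<in>UNIV. A j $ b *\<^sub>R partial b (partial a Y) u) + Q i j $ a *\<^sub>R partial a Y u)"
    proof (rule sum.cong[OF refl])
      fix a
      have "partial j (\<lambda>y. partial a Y (t y)) 0 = (\<Sum>b\<in>UNIV. A j $ b *\<^sub>R partial b (partial a Y) u)"
        by (subst partial_chain[OF dt]) (simp_all add: t0 diff_dY[OF u] t' t'0)
      then show "partial j (\<lambda>y. t' i y $ a *\<^sub>R partial a Y (t y)) 0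
        = A i $ a *\<^sub>R (\<Sum>b\<in>UNIV. A j $ b *\<^sub>R partial b (partial a Y) u) + Q i j $ a *\<^sub>R partial a Y u"
        by (simp add: partial_scaleR[OF d0[OF smt'a] d0[OF smYt]] cmp t'0 t0)
    qed
    also have "\<dots> = c i j + c' i j"
      by (simp add: sum.distrib dQ c_def scaleR_sum_right)
    finally show ?thesis by (simp add: c'_def)
  qed
  \<comment> \<open>The quadratic map is an immersion only near 0, where the Gram determinant is 1;
    the domain is cut down accordingly.\<close>
  define V where "V = {y \<in> V0. det (first_fundamental_form Y' y) \<noteq> 0}"
  have smg: "smooth_on V0 (\<lambda>y. first_fundamental_form Y' y $ i $ j)" for i j
    unfolding first_fundamental_form_def
    by (simp add: smooth_on_inner[OF V0 smooth_on_partial[OF smY'] smooth_on_partial[OF smY']])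
  have V: "open V"
  proof -
    have "continuous_on V0 (\<lambda>y. det (first_fundamental_form Y' y))"
      by (rule smooth_on_continuous_on[OF smooth_on_det[OF V0 smg]])
    from continuous_open_preimage[OF this V0, of "- {0}"]
    have "open (V0 \<inter> (\<lambda>y. det (first_fundamental_form Y' y)) -` (- {0}))" by auto
    moreover have "V = V0 \<inter> (\<lambda>y. det (first_fundamental_form Y' y)) -` (- {0})"
      unfolding V_def by blast
    ultimately show ?thesis by (rule ssubst[rotated])
  qed
  have "first_fundamental_form Y' 0 = mat 1"
    by (simp add: first_fundamental_form_def Y'10 E mat_def vec_eq_iff)
  then have V_0: "0 \<in> V" using V0' by (simp add: V_def)
  have VV0: "V \<subseteq> V0" by (auto simp: V_def)
  have dY': "Y' differentiable (at y)" if "y \<in> V" for y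
    using smooth_on_differentiable[OF smY'] that VV0 by auto
  show ?thesis
  proof (rule that[OF V_0 t0 _ dt])
    show "t ` V \<subseteq> U" using V0' VV0 by auto
    show "adapted_patch V (\<lambda>y. Y (t y)) (\<lambda>y. N (t y)) 0"
      unfolding Y'_def[symmetric] N'_def[symmetric]
    proof unfold_locales
      show "open V" by fact
      show "smooth_on V Y'" "smooth_on V N'" using smY' smN' VV0 smooth_on_subset by blast+
      show "0 \<in> V" by fact
      fix y assume y: "y \<in> V"
      then have ty: "t y \<in> U" using VV0 V0' by auto
      show "norm (N' y) = 1" unfolding N'_def by (rule norm_N[OF ty])
      show "N' y \<bullet> frechet_derivative Y' (at y) v = 0" for v
        unfolding N'_def Y'_def[abs_def] frechet_derivative_chain[OF dt diff_Y[OF ty]] by (rule N_normal[OF ty])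
      show "inj (frechet_derivative Y' (at y))"
        using y by (intro inj_frechet_derivative_if_det_nonzero dY') (auto simp: V_def)
    next
      show "partial i Y' 0 \<bullet> partial j Y' 0 = (if i = j then 1 else 0)" for i j by (simp add: Y'10 E)
      show "partial i (partial j Y') 0 \<bullet> partial k Y' 0 = 0" for i j k
        using E(2)[of k] by (simp add: Y'10 Y'20 inner_commute)
    qed (rule dim)
    show "partial e (\<lambda>y. Y (t y)) 0 = w"
      unfolding Y'_def[symmetric] by (simp add: Y'10 E(3))
  qed
qed

end

section \<open>Immersed hypersurfaces\<close>

locale immersed_hypersurface =
  fixes M :: "'p topology" and A :: "('p, 'n::finite) chart set"
    and x \<xi> :: "'p \<Rightarrow> real^'m::finite"
  assumes dim: "CARD('m) = CARD('n) + 1"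
    and manifold: "smooth_manifold M A"
    and immersion: "smooth_immersion A x"
    and normal: "unit_normal_field M A x \<xi>"
begin

lemma chart:
  assumes "c \<in> A"
  shows chart_open: "openin M (fst c)" and coords_eq: "coords c = snd c ` fst c"
    and open_coords: "open (coords c)" and chart_inj: "inj_on (snd c) (fst c)"
    and chart_homeo: "homeomorphic_map (subtopology M (fst c)) (top_of_set (coords c)) (snd c)"
    and chart_subset: "fst c \<subseteq> topspace M"
proof -
  have ch: "is_chart M c" using assms manifold by (simp add: smooth_manifold_def)
  show "coords c = snd c ` fst c" by (simp add: coords_def split: prod.split)
  with ch show 1: "openin M (fst c)" "open (coords c)"
    and 2: "homeomorphic_map (subtopology M (fst c)) (top_of_set (coords c)) (snd c)"
    by (auto simp: is_chart_def split: prod.splits)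
  show sub: "fst c \<subseteq> topspace M" using 1(1) by (rule openin_subset)
  show "inj_on (snd c) (fst c)"
    using homeomorphic_imp_injective_map[OF 2] sub by (simp add: Int_absorb1)
qed

lemma local_expr_apply: "c \<in> A \<Longrightarrow> p \<in> fst c \<Longrightarrow> local_expr c f (snd c p) = f p"
  using chart_inj[of c] by (auto simp: local_expr_def split: prod.split)

lemma coords_cases:
  assumes "c \<in> A" "u \<in> coords c"
  obtains p where "p \<in> fst c" "u = snd c p" "p \<in> topspace M"
  using assms coords_eq chart_subset by blast

lemma chart_at: "p \<in> topspace M \<Longrightarrow> chart_at A p \<in> A \<and> p \<in> fst (chart_at A p)"
  unfolding chart_at_def using manifold
  by (intro someI_ex[of "\<lambda>c. c \<in> A \<and> p \<in> fst c"]) (metis UN_E smooth_manifold_def)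

lemma norm_xi: "p \<in> topspace M \<Longrightarrow> norm (\<xi> p) = 1"
  using normal by (simp add: unit_normal_field_def)

lemma patch_chart:
  assumes c: "c \<in> A"
  shows "patch (coords c) (local_expr c x) (local_expr c \<xi>)"
proof
  show "CARD('m) = CARD('n) + 1" by (rule dim)
  show "open (coords c)" by (rule open_coords[OF c])
  show "smooth_on (coords c) (local_expr c x)" "smooth_on (coords c) (local_expr c \<xi>)"
    using c immersion normal by (auto simp: smooth_immersion_def smooth_map_def unit_normal_field_def)
  fix u assume u: "u \<in> coords c"
  show "norm (local_expr c \<xi> u) = 1"
    using u by (rule coords_cases[OF c]) (simp add: local_expr_apply[OF c] norm_xi)
  show "local_expr c \<xi> u \<bullet> frechet_derivative (local_expr c x) (at u) v = 0" for v
    using c u normal by (auto simp: unit_normal_field_def)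
  show "inj (frechet_derivative (local_expr c x) (at u))"
    using c u immersion by (auto simp: smooth_immersion_def)
qed

definition shape :: "'p \<Rightarrow> real^'m^'m" where
  "shape p = (let c = chart_at A p in shape_matrix (local_expr c x) (local_expr c \<xi>) (snd c p))"

text \<open>Two charts around \<open>p\<close> differ by a smooth transition map, so the invariance
  of the shape matrix applies. This frees \<open>shape\<close> from the choice in
  \<open>chart_at\<close>.\<close>

lemma shape_chart:
  assumes c: "c \<in> A" and p: "p \<in> fst c"
  shows "shape_matrix (local_expr c x) (local_expr c \<xi>) (snd c p) = shape p"
proof -
  define d where "d = chart_at A p"
  have d: "d \<in> A" "p \<in> fst d"
    using chart_at chart_subset[OF c] p by (auto simp: d_def)
  interpret C: patch "coords c" "local_expr c x" "local_expr c \<xi>" by (rule patch_chart[OF c])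
  \<comment> \<open>The overlap of the two charts in the coordinates of \<open>d\<close>; the
    transition map there is \<open>local_expr d (snd c)\<close>.\<close>
  define W where "W = snd d ` (fst d \<inter> fst c)"
  have "openin (top_of_set (coords d)) W"
  proof -
    have "openin (subtopology M (fst d)) (fst d \<inter> fst c)"
      using chart_open[OF c] by (auto simp: openin_subtopology)
    with homeomorphic_imp_open_map[OF chart_homeo[OF d(1)]] show ?thesis
      by (simp add: W_def open_map_def)
  qed
  then have W: "open W" "W \<subseteq> coords d"
    using open_coords[OF d(1)] by (auto simp: openin_open_eq)
  have "smooth_on W (local_expr d (snd c))"
    using manifold c d(1) by (auto simp: smooth_manifold_def smoothly_compatible_def W_def)
  moreover have pW: "snd d p \<in> W" using d p by (auto simp: W_def)
  ultimately have diff: "local_expr d (snd c) differentiable (at (snd d p))"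
    by (rule smooth_on_differentiable)
  have "shape_matrix (local_expr d x) (local_expr d \<xi>) (snd d p)
      = shape_matrix (local_expr c x) (local_expr c \<xi>) (local_expr d (snd c) (snd d p))"
  proof (rule C.shape_matrix_reparam[OF patch_chart[OF d(1)] W(1) pW W(2) diff])
    show "local_expr d (snd c) (snd d p) \<in> coords c"
      using p by (simp add: local_expr_apply[OF d] coords_eq[OF c])
    fix z assume "z \<in> W"
    then obtain q where q: "z = snd d q" "q \<in> fst d" "q \<in> fst c" by (auto simp: W_def)
    show "local_expr d x z = local_expr c x (local_expr d (snd c) z)"
      "local_expr d \<xi> z = local_expr c \<xi> (local_expr d (snd c) z)"
      by (simp_all add: q local_expr_apply[OF d(1)] local_expr_apply[OF c])
  qed
  then show ?thesis by (simp add: shape_def d_def[symmetric] local_expr_apply[OF d])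
qed

lemma mean_curvature_eq:
  assumes "p \<in> topspace M"
  shows "mean_curvature A x \<xi> p = trace (shape p)"
proof -
  have c: "chart_at A p \<in> A" "snd (chart_at A p) p \<in> coords (chart_at A p)"
    using chart_at[OF assms] by (auto simp: coords_eq)
  interpret patch "coords (chart_at A p)" "local_expr (chart_at A p) x" "local_expr (chart_at A p) \<xi>"
    by (rule patch_chart[OF c(1)])
  show ?thesis using trace_shape[OF c(2)] by (simp add: mean_curvature_def shape_def Let_def)
qed

lemma scalar_curvature_eq:
  assumes "p \<in> topspace M"
  shows "scalar_curvature A x p = (trace (shape p))\<^sup>2 - trace (shape p ** shape p)"
proof -
  have c: "chart_at A p \<in> A" "snd (chart_at A p) p \<in> coords (chart_at A p)"
    using chart_at[OF assms] by (auto simp: coords_eq)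
  interpret patch "coords (chart_at A p)" "local_expr (chart_at A p) x" "local_expr (chart_at A p) \<xi>"
    by (rule patch_chart[OF c(1)])
  show ?thesis using scalar_curvature_eq[OF c(2)] by (simp add: scalar_curvature_def shape_def Let_def)
qed

lemma continuous_map_if_local:
  fixes f :: "'p \<Rightarrow> 'b::topological_space"
  assumes "\<And>c. c \<in> A \<Longrightarrow> continuous_on (coords c) (local_expr c f)"
  shows "continuous_map M euclidean f"
  unfolding continuous_map_def
proof (intro conjI allI impI)
  fix T :: "'b set"
  assume "openin euclidean T"
  then have T: "open T" by simp
  have "openin M {p \<in> fst c. f p \<in> T}" if c: "c \<in> A" for c
  proof -
    have "openin (top_of_set (coords c)) (coords c \<inter> local_expr c f -` T)"
      using assms[OF c] T by (simp add: continuous_openin_preimage_gen)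
    then have "openin (subtopology M (fst c)) {p \<in> topspace (subtopology M (fst c)). snd c p \<in> coords c \<inter> local_expr c f -` T}"
      by (rule openin_continuous_map_preimage[OF homeomorphic_imp_continuous_map[OF chart_homeo[OF c]]])
    also have "{p \<in> topspace (subtopology M (fst c)). snd c p \<in> coords c \<inter> local_expr c f -` T} = {p \<in> fst c. f p \<in> T}"
      using chart_subset[OF c] imageI[of _ "fst c" "snd c"]
      by (auto simp: local_expr_apply[OF c] coords_eq[OF c, symmetric])
    finally show ?thesis using chart_open[OF c] openin_trans_full by blast
  qed
  then have "openin M (\<Union>c\<in>A. {p \<in> fst c. f p \<in> T})" by blast
  also have "(\<Union>c\<in>A. {p \<in> fst c. f p \<in> T}) = {p \<in> topspace M. f p \<in> T}"
    using manifold by (auto simp: smooth_manifold_def)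
  finally show "openin M {p \<in> topspace M. f p \<in> T}" .
qed simp

lemma continuous_x: "continuous_map M euclidean x"
  and continuous_xi: "continuous_map M euclidean \<xi>"
  using immersion normal
  by (auto intro!: continuous_map_if_local smooth_on_continuous_on
      simp: smooth_immersion_def smooth_map_def unit_normal_field_def)

lemma continuous_shape: "continuous_map M euclidean (\<lambda>p. shape p $ a $ b)"
proof (rule continuous_map_if_local)
  fix c assume c: "c \<in> A"
  interpret patch "coords c" "local_expr c x" "local_expr c \<xi>" by (rule patch_chart[OF c])
  have "local_expr c (\<lambda>p. shape p $ a $ b) u = shape_matrix (local_expr c x) (local_expr c \<xi>) u $ a $ b"
    if "u \<in> coords c" for u
    using that by (rule coords_cases[OF c]) (simp add: local_expr_apply[OF c] shape_chart[OF c])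
  then show "continuous_on (coords c) (local_expr c (\<lambda>p. shape p $ a $ b))"
    using continuous_shape[of a b] by (simp cong: continuous_on_cong)
qed

text \<open>Composes the quadratic coordinates with the inverse of a chart. The last clause concerns
  all of \<open>V\<close>, not only the centre, because a minimum at \<open>p\<close> is to be
  compared with neighbouring points.\<close>

lemma adapted_coordinates:
  fixes e :: 'n
  assumes p: "p \<in> topspace M" and w: "norm w = 1" "w \<bullet> \<xi> p = 0"
  obtains V c where "0 \<in> V" "c ` V \<subseteq> topspace M" "c 0 = p"
    "adapted_patch V (\<lambda>y. x (c y)) (\<lambda>y. \<xi> (c y)) 0" "partial e (\<lambda>y. x (c y)) 0 = w"
    "\<And>y. y \<in> V \<Longrightarrow> shape_matrix (\<lambda>y. x (c y)) (\<lambda>y. \<xi> (c y)) y = shape (c y)"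
proof -
  define d where "d = chart_at A p"
  have d: "d \<in> A" "p \<in> fst d" using chart_at[OF p] by (auto simp: d_def)
  interpret C: patch "coords d" "local_expr d x" "local_expr d \<xi>" by (rule patch_chart[OF d(1)])
  have "snd d p \<in> coords d" using d by (auto simp: coords_eq)
  moreover have "w \<bullet> local_expr d \<xi> (snd d p) = 0" using w(2) by (simp add: local_expr_apply[OF d])
  ultimately obtain V t where Vt: "0 \<in> V" "t 0 = snd d p" "t ` V \<subseteq> coords d"
    "\<And>y. y \<in> V \<Longrightarrow> t differentiable (at y)"
    "adapted_patch V (\<lambda>y. local_expr d x (t y)) (\<lambda>y. local_expr d \<xi> (t y)) 0"
    "partial e (\<lambda>y. local_expr d x (t y)) 0 = w"
    using C.quadratic_coordinates[OF _ w(1)] by metis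
  define c where "c y = inv_into (fst d) (snd d) (t y)" for y
  have le: "local_expr d f (t y) = f (c y)" for f :: "'p \<Rightarrow> real^'m" and y
    by (simp add: local_expr_def c_def split: prod.split)
  have c: "c y \<in> fst d" "snd d (c y) = t y" if "y \<in> V" for y
    using that Vt(3) coords_eq[OF d(1)] by (auto simp: c_def inv_into_into f_inv_into_f)
  interpret V: adapted_patch V "\<lambda>y. x (c y)" "\<lambda>y. \<xi> (c y)" 0
    using Vt(5) by (simp add: le)
  show ?thesis
  proof (rule that[OF Vt(1)])
    show "c ` V \<subseteq> topspace M" using c(1) chart_subset[OF d(1)] by auto
    show "c 0 = p" using Vt(2) d chart_inj[OF d(1)] by (simp add: c_def)
    show "adapted_patch V (\<lambda>y. x (c y)) (\<lambda>y. \<xi> (c y)) 0" by unfold_locales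
    show "partial e (\<lambda>y. x (c y)) 0 = w" using Vt(6) by (simp add: le)
    fix y assume y: "y \<in> V"
    have "shape_matrix (\<lambda>y. x (c y)) (\<lambda>y. \<xi> (c y)) y
        = shape_matrix (local_expr d x) (local_expr d \<xi>) (t y)"
      using Vt(3) y by (intro C.shape_matrix_reparam[OF V.patch_axioms V.open_U y order_refl Vt(4)[OF y]])
        (auto simp: le)
    also have "\<dots> = shape (c y)" using shape_chart[OF d(1) c(1)[OF y]] c(2)[OF y] by simp
    finally show "shape_matrix (\<lambda>y. x (c y)) (\<lambda>y. \<xi> (c y)) y = shape (c y)" .
  qed
qed

lemma unit_tangent_exists:
  assumes p: "p \<in> topspace M"
  obtains w where "norm w = 1" "w \<bullet> \<xi> p = 0"
proof -
  define d where "d = chart_at A p"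
  have d: "d \<in> A" "p \<in> fst d" using chart_at[OF p] by (auto simp: d_def)
  interpret C: patch "coords d" "local_expr d x" "local_expr d \<xi>" by (rule patch_chart[OF d(1)])
  have u: "snd d p \<in> coords d" using d by (auto simp: coords_eq)
  fix k :: 'n
  let ?z = "partial k (local_expr d x) (snd d p)"
  have "?z \<noteq> 0" using C.dual_dY[OF u, of k k] by auto
  moreover have "?z \<bullet> \<xi> p = 0"
    using C.N_dY[OF u, of k] by (simp add: local_expr_apply[OF d] inner_commute)
  ultimately show ?thesis by (intro that[of "?z /\<^sub>R norm ?z"]) auto
qed

end

section \<open>Closed pinched expanders\<close>

text \<open>The first-order condition at the minimum s = 0 of a quadratic polynomial.\<close>

lemma linear_coefficient_zero:
  fixes b c :: real
  assumes "\<And>s. 0 \<le> s * b + s * s * c"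
  shows "b = 0"
proof (rule ccontr)
  assume "b \<noteq> 0"
  \<comment> \<open>Any \<open>k\<close> that is positive and larger than \<open>c\<close> works: at
    s = -b/k the polynomial equals b^2 (c - k) / k^2.\<close>
  define k where "k = \<bar>c\<bar> + 1"
  have k: "k > 0" "c < k" by (auto simp: k_def)
  have "0 \<le> (- b / k) * b + (- b / k) * (- b / k) * c" by (rule assms)
  also have "\<dots> = (b * b) * (c - k) / (k * k)" using k by (simp add: field_simps)
  also have "\<dots> < 0"
    using k \<open>b \<noteq> 0\<close> by (intro divide_neg_pos mult_pos_neg) (auto simp: zero_less_mult_iff)
  finally show False by simp
qed

text \<open>Cauchy-Schwarz for the n - 1 entries other than \<open>a e\<close>.\<close>

lemma sum_square_pinched:
  fixes a :: "'i::finite \<Rightarrow> real"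
  assumes "CARD('i) \<ge> 2"
  shows "(real CARD('i) - 1) * (a e)\<^sup>2 + ((\<Sum>i\<in>UNIV. a i) - a e)\<^sup>2 \<le> (real CARD('i) - 1) * (\<Sum>i\<in>UNIV. (a i)\<^sup>2)"
proof -
  have card: "real (card (UNIV - {e})) = real CARD('i) - 1"
    using assms by (simp add: card_Diff_singleton of_nat_diff)
  have "(\<Sum>i\<in>UNIV - {e}. a i)\<^sup>2 \<le> (\<Sum>i\<in>UNIV - {e}. (a i)\<^sup>2) * (real CARD('i) - 1)"
    using sum_squared_le_sum_of_squares[of a "UNIV - {e}"] card by simp
  moreover have "(\<Sum>i\<in>UNIV. a i) = a e + (\<Sum>i\<in>UNIV - {e}. a i)"
    "(\<Sum>i\<in>UNIV. (a i)\<^sup>2) = (a e)\<^sup>2 + (\<Sum>i\<in>UNIV - {e}. (a i)\<^sup>2)"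
    by (simp_all add: sum.remove)
  ultimately show ?thesis by (simp add: algebra_simps)
qed

locale closed_pinched_expander = immersed_hypersurface M A x \<xi>
  for M :: "'p topology" and A :: "('p, 'n::finite) chart set" and x \<xi> :: "'p \<Rightarrow> real^'m::finite" +
  fixes lam :: real
  assumes card_n: "CARD('n) \<ge> 2"
    and compact: "compact_space M" and connected: "connected_space M" and nonempty: "topspace M \<noteq> {}"
    and expander: "p \<in> topspace M \<Longrightarrow> trace (shape p) = lam + (x p \<bullet> \<xi> p) / 2"
    and H_pos: "p \<in> topspace M \<Longrightarrow> trace (shape p) > 0"
    and pinched: "p \<in> topspace M \<Longrightarrow>
      (real CARD('n) - 1) * trace (shape p ** shape p) \<le> (trace (shape p))\<^sup>2"
begin

definition H :: "'p \<Rightarrow> real" where "H p = trace (shape p)"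
definition S :: "'p \<Rightarrow> real" where "S p = trace (shape p ** shape p)"
definition curv :: "'p \<Rightarrow> real^'m \<Rightarrow> real" where "curv p w = w \<bullet> (shape p *v w)"
definition tangent :: "'p \<Rightarrow> real^'m \<Rightarrow> bool" where "tangent p w \<longleftrightarrow> norm w = 1 \<and> w \<bullet> \<xi> p = 0"
definition barrier :: "'p \<Rightarrow> real" where "barrier p = (x p \<bullet> x p) / 2 + 2 * (real CARD('n) - 1) * ln (H p)"

text \<open>The frame is the coordinate frame of adapted coordinates at their centre. It need not
  diagonalise the shape operator.\<close>

lemma orthonormal_frame:
  fixes e :: 'n
  assumes p: "p \<in> topspace M" and w: "tangent p w"
  obtains E where "E e = w" "\<And>i. tangent p (E i)" "\<And>i j. i \<noteq> j \<Longrightarrow> E i \<bullet> E j = 0"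
    "\<And>i j. E i \<bullet> (shape p *v E j) = E j \<bullet> (shape p *v E i)"
    "H p = (\<Sum>i\<in>UNIV. curv p (E i))"
    "S p = (\<Sum>i\<in>UNIV. \<Sum>j\<in>UNIV. (E i \<bullet> (shape p *v E j))\<^sup>2)"
    "\<And>i. shape p *v E i = (\<Sum>l\<in>UNIV. (E i \<bullet> (shape p *v E l)) *\<^sub>R E l)"
proof -
  obtain V c where Vc: "0 \<in> V" "c ` V \<subseteq> topspace M" "c 0 = p"
    "adapted_patch V (\<lambda>y. x (c y)) (\<lambda>y. \<xi> (c y)) 0" "partial e (\<lambda>y. x (c y)) 0 = w"
    "\<And>y. y \<in> V \<Longrightarrow> shape_matrix (\<lambda>y. x (c y)) (\<lambda>y. \<xi> (c y)) y = shape (c y)"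
    using adapted_coordinates[OF p] w unfolding tangent_def by metis
  interpret V: adapted_patch V "\<lambda>y. x (c y)" "\<lambda>y. \<xi> (c y)" 0 by (rule Vc(4))
  define E where "E i = partial i (\<lambda>y. x (c y)) 0" for i
  have sh: "shape_matrix (\<lambda>y. x (c y)) (\<lambda>y. \<xi> (c y)) 0 = shape p" using Vc(1,3,6) by simp
  have k: "E i \<bullet> (shape p *v E j) = V.h 0 $ i $ j" for i j
    unfolding E_def sh[symmetric] V.shape_dY[OF V.p] using V.h_eq_dN[OF V.p, of j i] V.h_sym[of i j]
    by (simp add: inner_commute)
  show ?thesis
  proof (rule that[of E])
    show "E e = w" using Vc(5) by (simp add: E_def)
    show "tangent p (E i)" for i
      using V.orthonormal[of i i] V.N_dY[OF V.p, of i] Vc(3)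
      by (simp add: tangent_def E_def norm_eq_1 inner_commute)
    show "E i \<bullet> E j = 0" if "i \<noteq> j" for i j using V.orthonormal[of i j] that by (simp add: E_def)
    show "E i \<bullet> (shape p *v E j) = E j \<bullet> (shape p *v E i)" for i j unfolding k by (rule V.h_sym)
    show "H p = (\<Sum>i\<in>UNIV. curv p (E i))"
      unfolding curv_def k V.trace_h_p[symmetric] V.trace_shape[OF V.p, symmetric] sh H_def ..
    show "S p = (\<Sum>i\<in>UNIV. \<Sum>j\<in>UNIV. (E i \<bullet> (shape p *v E j))\<^sup>2)"
      unfolding k V.trace_shape_square_p[symmetric] sh S_def ..
    show "shape p *v E i = (\<Sum>l\<in>UNIV. (E i \<bullet> (shape p *v E l)) *\<^sub>R E l)" for i
      unfolding k using V.shape_dY[OF V.p, of i] V.dN_p[of i] by (simp add: E_def sh)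
  qed
qed

lemma H_gt_0: "p \<in> topspace M \<Longrightarrow> H p > 0"
  unfolding H_def by (rule H_pos)

text \<open>Dropping the off-diagonal entries keeps the trace and can only lower the sum of squares.
  The estimates below need no more than this, so no eigenbasis is constructed.\<close>

lemma frame_diagonal:
  fixes e :: 'n
  assumes p: "p \<in> topspace M" and w: "tangent p w"
  obtains a where "a e = curv p w" "\<And>i. \<exists>v. tangent p v \<and> a i = curv p v" "H p = (\<Sum>i\<in>UNIV. a i)" "(\<Sum>i\<in>UNIV. (a i)\<^sup>2) \<le> S p"
proof -
  obtain E where E: "E e = w" "\<And>i. tangent p (E i)" "H p = (\<Sum>i\<in>UNIV. curv p (E i))"
    "S p = (\<Sum>i\<in>UNIV. \<Sum>j\<in>UNIV. (E i \<bullet> (shape p *v E j))\<^sup>2)"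
    by (rule orthonormal_frame[OF assms, of e]) blast
  have "(curv p (E i))\<^sup>2 \<le> (\<Sum>j\<in>UNIV. (E i \<bullet> (shape p *v E j))\<^sup>2)" for i
    unfolding curv_def by (rule member_le_sum) auto
  then have "(\<Sum>i\<in>UNIV. (curv p (E i))\<^sup>2) \<le> S p"
    unfolding E(4) by (rule sum_mono)
  then show ?thesis using E by (intro that[of "\<lambda>i. curv p (E i)"]) auto
qed

text \<open>With k the curvature, expanding \<open>sum_square_pinched\<close> gives n k^2 + (H^2 -
  (n-1) S) <= 2 k H. Both summands on the left are nonnegative, the second by pinching; each bound
  keeps what it needs.\<close>

lemma curv_bounds:
  assumes p: "p \<in> topspace M" and w: "tangent p w"
  shows "0 \<le> curv p w" "(H p)\<^sup>2 - (real CARD('n) - 1) * S p \<le> 2 * curv p w * H p"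
proof -
  fix e :: 'n
  obtain a where a: "a e = curv p w" "H p = (\<Sum>i\<in>UNIV. a i)" "(\<Sum>i\<in>UNIV. (a i)\<^sup>2) \<le> S p"
    by (rule frame_diagonal[OF assms, of e]) blast
  have "(real CARD('n) - 1) * (\<Sum>i\<in>UNIV. (a i)\<^sup>2) \<le> (real CARD('n) - 1) * S p"
    using a(3) card_n by (intro mult_left_mono) auto
  with sum_square_pinched[OF card_n, of a e]
  have *: "(real CARD('n) - 1) * (curv p w)\<^sup>2 + (H p - curv p w)\<^sup>2 \<le> (real CARD('n) - 1) * S p"
    unfolding a(1) a(2)[symmetric] by linarith
  have exp: "(real CARD('n) - 1) * (curv p w)\<^sup>2 + (H p - curv p w)\<^sup>2 = (H p)\<^sup>2 - 2 * curv p w * H p + real CARD('n) * (curv p w)\<^sup>2"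
    by (simp add: power2_eq_square algebra_simps)
  have sq: "0 \<le> real CARD('n) * (curv p w)\<^sup>2" by simp
  show "(H p)\<^sup>2 - (real CARD('n) - 1) * S p \<le> 2 * curv p w * H p" using * exp sq by linarith
  have "0 \<le> 2 * curv p w * H p" using * exp sq pinched[OF p] unfolding H_def S_def by linarith
  then show "0 \<le> curv p w" using H_gt_0[OF p] by (simp add: zero_le_mult_iff)
qed

lemma curv_normalize:
  assumes "v \<noteq> 0" "v \<bullet> \<xi> p = 0"
  shows "tangent p (v /\<^sub>R norm v)" "curv p (v /\<^sub>R norm v) = (v \<bullet> (shape p *v v)) / (v \<bullet> v)"
  using assms by (auto simp: tangent_def curv_def matrix_vector_mult_scaleR divide_inverse
      dot_square_norm power2_eq_square)

text \<open>First variation of the Rayleigh quotient along \<open>w + s *\<^sub>R z\<close>,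
  multiplied out by the squared length 1 + s^2 to get a quadratic polynomial in s.\<close>

lemma minimal_direction_is_eigenvector:
  assumes w: "tangent p w" and z: "tangent p z" "w \<bullet> z = 0"
    and sym: "w \<bullet> (shape p *v z) = z \<bullet> (shape p *v w)"
    and min: "\<And>v. tangent p v \<Longrightarrow> curv p w \<le> curv p v"
  shows "w \<bullet> (shape p *v z) = 0"
proof -
  have "0 \<le> s * (2 * (w \<bullet> (shape p *v z))) + s * s * (curv p z - curv p w)" for s
  proof -
    let ?v = "w + s *\<^sub>R z"
    have ww: "w \<bullet> w = 1" "z \<bullet> z = 1" using w z by (auto simp: tangent_def norm_eq_1)
    have vv: "?v \<bullet> ?v = 1 + s * s" using ww z(2) by (simp add: inner_add_left inner_add_right inner_commute)
    have pos: "1 + s * s > 0" by (simp add: add_pos_nonneg)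
    then have "?v \<noteq> 0" using vv by auto
    moreover have "?v \<bullet> \<xi> p = 0" using w z by (simp add: tangent_def inner_add_left)
    ultimately have "curv p w \<le> (?v \<bullet> (shape p *v ?v)) / (1 + s * s)"
      using min[OF curv_normalize(1)] curv_normalize(2) vv by metis
    then have "curv p w * (1 + s * s) \<le> ?v \<bullet> (shape p *v ?v)" using pos by (simp add: pos_le_divide_eq)
    also have "?v \<bullet> (shape p *v ?v) = curv p w + s * (2 * (w \<bullet> (shape p *v z))) + s * s * curv p z"
      by (simp add: curv_def matrix_vector_right_distrib matrix_vector_mult_scaleR inner_add_left inner_add_right
          sym algebra_simps)
    finally show ?thesis by (simp add: algebra_simps)
  qed
  from linear_coefficient_zero[OF this] show ?thesis by simp
qed

text \<open>In adapted coordinates with \<open>partial e\<close> equal to \<open>w\<close> at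
  \<open>p\<close>, the normalised coordinate vector serves as competitor at nearby points. Thus a
  minimum over unit tangent vectors yields the minimum demanded by
  \<open>expander_min_inequality\<close>.\<close>

lemma test_inequality:
  assumes p: "p \<in> topspace M" and w: "tangent p w" and "eps \<ge> 0"
    and min: "\<And>r v. r \<in> topspace M \<Longrightarrow> tangent r v \<Longrightarrow>
      curv p w / H p - eps * barrier p \<le> curv r v / H r - eps * barrier r"
  shows "eps * (1 + H p * (x p \<bullet> \<xi> p) - (real CARD('n) - 1) * S p * (x p \<bullet> \<xi> p) / H p)
    \<le> lam * (curv p w / H p) * (curv p w / H p * H p - S p / H p)"
proof -
  fix e :: 'n
  obtain V c where Vc: "0 \<in> V" "c ` V \<subseteq> topspace M" "c 0 = p"
    "adapted_patch V (\<lambda>y. x (c y)) (\<lambda>y. \<xi> (c y)) 0" "partial e (\<lambda>y. x (c y)) 0 = w"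
    "\<And>y. y \<in> V \<Longrightarrow> shape_matrix (\<lambda>y. x (c y)) (\<lambda>y. \<xi> (c y)) y = shape (c y)"
    using adapted_coordinates[OF p, of w e] w unfolding tangent_def by metis
  interpret V: adapted_patch V "\<lambda>y. x (c y)" "\<lambda>y. \<xi> (c y)" 0 by (rule Vc(4))
  let ?Y = "\<lambda>y. x (c y)"
  have sh: "shape_matrix ?Y (\<lambda>y. \<xi> (c y)) 0 = shape p" using Vc(1,3,6) by simp
  have cM: "c y \<in> topspace M" if "y \<in> V" for y using Vc(2) that by auto
  have Heq: "metric_trace (V.g y) (V.h y) = H (c y)" if "y \<in> V" for y
    using V.trace_shape[OF that] Vc(6)[OF that] by (simp add: H_def)
  have hS: "partial i ?Y y \<bullet> (shape (c y) *v partial j ?Y y) = V.h y $ i $ j" if "y \<in> V" for y i j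
    using V.shape_dY[OF that, of j] Vc(6)[OF that]
    by (simp add: second_fundamental_form_def inner_commute)
  have curv_p: "curv p w = V.h 0 $ e $ e" using hS[OF V.p, of e e] Vc by (simp add: curv_def)
  \<comment> \<open>Over the fixed point \<open>p\<close> the barrier and \<open>H p\<close> are
    constant, so \<open>w\<close> minimises the curvature there and is an eigendirection.\<close>
  have minp: "curv p w \<le> curv p v" if "tangent p v" for v
    using min[OF p that] H_gt_0[OF p] by (simp add: divide_le_cancel)
  have tan: "tangent p (partial j ?Y 0)" for j
    using V.orthonormal[of j j] V.N_dY[OF V.p, of j] Vc(3) by (simp add: tangent_def norm_eq_1 inner_commute)
  have eigen: "V.h 0 $ e $ j = 0" if "j \<noteq> e" for j
  proof -
    have "w \<bullet> (shape p *v partial j ?Y 0) = 0"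
      using that V.orthonormal[of e j] hS[OF V.p, of e j] hS[OF V.p, of j e] V.h_sym[of e j] Vc
      by (intro minimal_direction_is_eigenvector[OF w tan _ _ minp]) auto
    then show ?thesis using hS[OF V.p, of e j] Vc by simp
  qed
  have "eps * (1 + metric_trace (V.g 0) (V.h 0) * (x (c 0) \<bullet> \<xi> (c 0))
      - (real CARD('n) - 1) * trace (shape_matrix ?Y (\<lambda>y. \<xi> (c y)) 0 ** shape_matrix ?Y (\<lambda>y. \<xi> (c y)) 0) * (x (c 0) \<bullet> \<xi> (c 0)) / metric_trace (V.g 0) (V.h 0))
    \<le> lam * (V.h 0 $ e $ e / metric_trace (V.g 0) (V.h 0)) *
      (V.h 0 $ e $ e / metric_trace (V.g 0) (V.h 0) * metric_trace (V.g 0) (V.h 0)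
        - trace (shape_matrix ?Y (\<lambda>y. \<xi> (c y)) 0 ** shape_matrix ?Y (\<lambda>y. \<xi> (c y)) 0) / metric_trace (V.g 0) (V.h 0))"
  proof (rule V.expander_min_inequality[OF eigen])
    show "metric_trace (V.g y) (V.h y) = lam + (x (c y) \<bullet> \<xi> (c y)) / 2" if "y \<in> V" for y
      using Heq[OF that] expander[OF cM[OF that]] by (simp add: H_def)
    show "metric_trace (V.g y) (V.h y) > 0" if "y \<in> V" for y
      using Heq[OF that] H_gt_0[OF cM[OF that]] by simp
    fix y assume y: "y \<in> V"
    let ?v = "partial e ?Y y"
    have v: "?v \<noteq> 0" using V.dual_dY[OF y, of e e] by auto
    have "?v \<bullet> \<xi> (c y) = 0" using V.N_dY[OF y, of e] by (simp add: inner_commute)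
    note vn = curv_normalize[OF v this]
    have "curv (c y) (?v /\<^sub>R norm ?v) = V.h y $ e $ e / V.g y $ e $ e"
      unfolding vn(2) hS[OF y] by (simp add: first_fundamental_form_def)
    with min[OF cM[OF y] vn(1)]
    have "curv p w / H p - eps * barrier p \<le> V.h y $ e $ e / (V.g y $ e $ e * H (c y)) - eps * barrier (c y)"
      by simp
    moreover have "V.g 0 $ e $ e = 1" by (simp add: V.g_p mat_def)
    ultimately show "V.h 0 $ e $ e / (V.g 0 $ e $ e * metric_trace (V.g 0) (V.h 0))
        - eps * (x (c 0) \<bullet> x (c 0) / 2 + 2 * (real CARD('n) - 1) * ln (metric_trace (V.g 0) (V.h 0)))
      \<le> V.h y $ e $ e / (V.g y $ e $ e * metric_trace (V.g y) (V.h y))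
        - eps * (x (c y) \<bullet> x (c y) / 2 + 2 * (real CARD('n) - 1) * ln (metric_trace (V.g y) (V.h y)))"
      using Vc(3) by (simp add: Heq[OF y] Heq[OF V.p] curv_p barrier_def)
  qed (use assms card_n in auto)
  then show ?thesis
    unfolding Heq[OF V.p] sh Vc(3) S_def[symmetric] curv_p .
qed

section \<open>Existence of minima by compactness\<close>

lemma continuous_H: "continuous_map M euclidean H"
  unfolding H_def[abs_def] trace_def by (intro continuous_map_sum continuous_shape) auto

lemma continuous_scalar_product:
  fixes f g :: "'q \<Rightarrow> real^'m"
  assumes "continuous_map X euclidean f" "continuous_map X euclidean g"
  shows "continuous_map X euclidean (\<lambda>p. f p \<bullet> g p)"
proof -
  have component: "continuous_map X euclidean (\<lambda>p. f p $ a)" if "continuous_map X euclidean f" for f :: "'q \<Rightarrow> real^'m" and a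
    using continuous_map_compose[OF that, of euclidean "\<lambda>v. v $ a"]
    by (simp add: o_def continuous_map_iff_continuous2 continuous_on_component)
  show ?thesis
    unfolding inner_vec_def inner_real_def
    by (intro continuous_map_sum continuous_map_real_mult component assms) auto
qed

lemma continuous_barrier: "continuous_map M euclidean barrier"
proof -
  have "continuous_map M (top_of_set {0<..}) H"
    using continuous_H H_gt_0 by (auto simp: continuous_map_in_subtopology)
  moreover have "continuous_map (top_of_set {0<..}) euclidean (ln :: real \<Rightarrow> real)"
    by (auto intro!: continuous_on_ln)
  ultimately have "continuous_map M euclidean (ln \<circ> H)" by (rule continuous_map_compose)
  then show ?thesis
    unfolding barrier_def[abs_def] o_def
    by (intro continuous_map_add continuous_map_real_mult continuous_map_real_divide continuous_scalar_product
        continuous_x) auto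
qed

lemma attains_min:
  fixes f :: "'p \<Rightarrow> real"
  assumes "continuous_map M euclidean f"
  obtains p where "p \<in> topspace M" "\<And>r. r \<in> topspace M \<Longrightarrow> f p \<le> f r"
proof -
  have "compact (f ` topspace M)"
    using image_compactin[OF _ assms, of "topspace M"] compact by (simp add: compact_space_def)
  from compact_attains_inf[OF this] nonempty that show ?thesis by auto
qed

lemma bounded_on_M:
  fixes f :: "'p \<Rightarrow> real"
  assumes "continuous_map M euclidean f"
  obtains C where "C > 0" "\<And>p. p \<in> topspace M \<Longrightarrow> \<bar>f p\<bar> \<le> C"
proof -
  have "compact (f ` topspace M)"
    using image_compactin[OF _ assms, of "topspace M"] compact by (simp add: compact_space_def)
  then have "bounded (f ` topspace M)" by (rule compact_imp_bounded)
  then obtain C where "\<forall>y\<in>f ` topspace M. norm y \<le> C" by (auto simp: bounded_iff)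
  then show ?thesis by (intro that[of "max C 1"]) force+
qed

lemma attains_min_tangent:
  obtains p w where "p \<in> topspace M" "tangent p w"
    "\<And>r v. r \<in> topspace M \<Longrightarrow> tangent r v \<Longrightarrow>
      curv p w / H p - eps * barrier p \<le> curv r v / H r - eps * barrier r"
proof -
  let ?X = "prod_topology M (top_of_set (sphere 0 1 :: (real^'m) set))"
  let ?f = "\<lambda>z. curv (fst z) (snd z) / H (fst z) - eps * barrier (fst z)"
  \<comment> \<open>The unit tangent bundle, closed in the compact product of \<open>M\<close> with
    the unit sphere because it is the preimage of the closed set {0}.\<close>
  define T where "T = {z \<in> topspace ?X. snd z \<bullet> \<xi> (fst z) \<in> {0}}"
  have fst: "continuous_map ?X euclidean (\<lambda>z. f (fst z))" if "continuous_map M euclidean f"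
    for f :: "'p \<Rightarrow> 'b::topological_space"
    using continuous_map_compose[OF continuous_map_fst that] by (simp add: o_def)
  have snd: "continuous_map ?X euclidean (\<lambda>z. snd z)"
    using continuous_map_snd[of M "top_of_set (sphere 0 1 :: (real^'m) set)"]
    by (simp add: continuous_map_in_subtopology)
  have snd_a: "continuous_map ?X euclidean (\<lambda>z. snd z $ a)" for a
    using continuous_map_compose[OF snd, of euclidean "\<lambda>v. v $ a"]
    by (simp add: o_def continuous_map_iff_continuous2 continuous_on_component)
  have "compact_space ?X"
    using compact by (simp add: compact_space_prod_topology compact_space_subtopology)
  moreover have "closedin ?X T"
    unfolding T_def
    by (rule closedin_continuous_map_preimage[OF continuous_scalar_product[OF snd fst[OF continuous_xi]]]) simp
  ultimately have T: "compactin ?X T" by (rule closedin_compact_space)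
  have "curv (fst z) (snd z) = (\<Sum>a\<in>UNIV. snd z $ a * (\<Sum>b\<in>UNIV. shape (fst z) $ a $ b * snd z $ b))" for z
    by (simp add: curv_def inner_vec_def matrix_vector_mult_def)
  moreover have "continuous_map ?X euclidean (\<lambda>z. \<Sum>a\<in>UNIV. snd z $ a * (\<Sum>b\<in>UNIV. shape (fst z) $ a $ b * snd z $ b))"
    by (intro continuous_map_sum continuous_map_real_mult snd_a fst[OF continuous_shape]) auto
  ultimately have "continuous_map ?X euclidean (\<lambda>z. curv (fst z) (snd z))" by simp
  then have cont_f: "continuous_map ?X euclidean ?f"
    using H_gt_0
    by (intro continuous_map_diff continuous_map_real_divide continuous_map_real_mult fst[OF continuous_H]
        fst[OF continuous_barrier]) (auto simp: less_imp_neq[symmetric])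
  have "compact (?f ` T)" using image_compactin[OF T cont_f] by simp
  moreover have T_iff: "(r, v) \<in> T \<longleftrightarrow> r \<in> topspace M \<and> tangent r v" for r v
    by (auto simp: T_def tangent_def)
  moreover have "T \<noteq> {}"
  proof -
    obtain r where "r \<in> topspace M" using nonempty by blast
    moreover from this obtain v where "tangent r v" using unit_tangent_exists unfolding tangent_def by metis
    ultimately show ?thesis using T_iff by blast
  qed
  ultimately obtain z where z: "z \<in> T" "\<And>z'. z' \<in> T \<Longrightarrow> ?f z \<le> ?f z'"
    using compact_attains_inf[of "?f ` T"] by blast
  then show ?thesis
    using T_iff[of "fst z" "snd z"] T_iff by (intro that[of "fst z" "snd z"]) force+
qed


text \<open>At a maximum of |x|^2 the second derivative test gives 1 + k P <= 0 for the curvature k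
  in any unit tangent direction. As k >= 0, this forces P < 0, and then lam = H - P/2 is
  positive.\<close>

lemma lam_pos: "lam > 0"
proof -
  have "continuous_map M euclidean (\<lambda>p. - 1 * (x p \<bullet> x p))"
    by (intro continuous_map_real_mult continuous_scalar_product continuous_x) auto
  then obtain p where p: "p \<in> topspace M" "\<And>r. r \<in> topspace M \<Longrightarrow> - 1 * (x p \<bullet> x p) \<le> - 1 * (x r \<bullet> x r)"
    by (rule attains_min) blast
  obtain w where w: "tangent p w" using unit_tangent_exists[OF p(1)] unfolding tangent_def by metis
  fix e :: 'n
  obtain V c where Vc: "0 \<in> V" "c ` V \<subseteq> topspace M" "c 0 = p"
    "adapted_patch V (\<lambda>y. x (c y)) (\<lambda>y. \<xi> (c y)) 0" "partial e (\<lambda>y. x (c y)) 0 = w"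
    "\<And>y. y \<in> V \<Longrightarrow> shape_matrix (\<lambda>y. x (c y)) (\<lambda>y. \<xi> (c y)) y = shape (c y)"
    using adapted_coordinates[OF p(1), of w e] w unfolding tangent_def by metis
  interpret V: adapted_patch V "\<lambda>y. x (c y)" "\<lambda>y. \<xi> (c y)" 0 by (rule Vc(4))
  let ?Y = "\<lambda>y. x (c y)"
  note sYY = smooth_on_inner[OF V.open_U V.smooth_Y V.smooth_Y]
  have min: "- 1 * (x (c 0) \<bullet> x (c 0)) \<le> - 1 * (x (c y) \<bullet> x (c y))" if "y \<in> V" for y
    using p(2)[of "c y"] Vc(2,3) that by auto
  have "0 \<le> partial e (partial e (\<lambda>y. - 1 * (?Y y \<bullet> ?Y y))) 0"
    by (rule partial_local_min(2)[OF V.open_U V.p smooth_on_mult[OF V.open_U smooth_on_const sYY] min])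
  also have "partial e (partial e (\<lambda>y. - 1 * (?Y y \<bullet> ?Y y))) 0 = - partial e (partial e (\<lambda>y. ?Y y \<bullet> ?Y y)) 0"
    by (subst partial_partial_mult[OF V.open_U V.p smooth_on_const sYY]) (simp add: partial_def[abs_def])
  also have "partial e (partial e (\<lambda>y. ?Y y \<bullet> ?Y y)) 0 = 2 * (1 + V.h 0 $ e $ e * (x p \<bullet> \<xi> p))"
    by (simp add: partial_partial_inner[OF V.open_U V.p V.smooth_Y V.smooth_Y] V.ddY_p V.orthonormal
        Vc(3) inner_commute)
  also have "V.h 0 $ e $ e = curv p w"
    using V.shape_dY[OF V.p, of e] Vc(1,3,5) Vc(6)[OF V.p]
    by (simp add: second_fundamental_form_def curv_def inner_commute)
  finally have "1 + curv p w * (x p \<bullet> \<xi> p) \<le> 0" by (simp add: mult.commute[of "curv p w"])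
  then have "curv p w * (x p \<bullet> \<xi> p) < 0" by linarith
  then have "x p \<bullet> \<xi> p < 0"
    using curv_bounds(1)[OF p(1) w] by (simp add: mult_less_0_iff)
  then show ?thesis using expander[OF p(1)] H_pos[OF p(1)] by simp
qed

text \<open>With k the minimal curvature, every diagonal entry a_i satisfies a_i >= k and a_i >= 0,
  hence k a_i <= a_i^2; sum over i. This makes the right-hand side of the test inequality
  nonpositive.\<close>

lemma curv_minimal_le:
  assumes p: "p \<in> topspace M" and w: "tangent p w"
    and min: "\<And>v. tangent p v \<Longrightarrow> curv p w \<le> curv p v"
  shows "curv p w * H p \<le> S p"
proof -
  fix e :: 'n
  obtain a where "a e = curv p w" and a: "\<And>i. \<exists>v. tangent p v \<and> a i = curv p v"
      "H p = (\<Sum>i\<in>UNIV. a i)" "(\<Sum>i\<in>UNIV. (a i)\<^sup>2) \<le> S p"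
    by (rule frame_diagonal[OF p w, of e]) (rule that)
  have "curv p w * a i \<le> (a i)\<^sup>2" for i
    using a(1)[of i] min curv_bounds(1)[OF p] unfolding power2_eq_square
    by (auto intro!: mult_right_mono)
  then have "curv p w * H p \<le> (\<Sum>i\<in>UNIV. (a i)\<^sup>2)"
    unfolding a(2) sum_distrib_left by (rule sum_mono)
  with a(3) show ?thesis by simp
qed

text \<open>At the minimum of the perturbed function the ratio is at least 1/(2C), where
  \<open>C\<close> bounds |H P| on \<open>M\<close>. This constant does not depend on
  \<open>eps\<close>, so it survives the limit in which the perturbation disappears.\<close>

lemma curv_bounded_below:
  obtains b where "b > 0" "\<And>p w. p \<in> topspace M \<Longrightarrow> tangent p w \<Longrightarrow> b \<le> curv p w / H p"
proof -
  obtain C where C: "C > 0" "\<And>p. p \<in> topspace M \<Longrightarrow> \<bar>H p * (x p \<bullet> \<xi> p)\<bar> \<le> C"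
    using bounded_on_M[OF continuous_map_real_mult[OF continuous_H continuous_scalar_product[OF continuous_x continuous_xi]]]
    by metis
  obtain D where D: "D > 0" "\<And>p. p \<in> topspace M \<Longrightarrow> \<bar>barrier p\<bar> \<le> D"
    using bounded_on_M[OF continuous_barrier] by metis
  have approx: "1 / (2 * C) \<le> curv r v / H r + eta" if r: "r \<in> topspace M" "tangent r v" and "eta > 0" for r v eta
  proof -
    \<comment> \<open>The barrier varies by at most 2 D, so the perturbation costs at most
      \<open>eta\<close>.\<close>
    define eps where "eps = eta / (2 * D)"
    have eps: "eps > 0" "2 * (eps * D) = eta" using D(1) \<open>eta > 0\<close> by (auto simp: eps_def)
    obtain p w where p: "p \<in> topspace M" and w: "tangent p w" and
      min: "\<And>r v. r \<in> topspace M \<Longrightarrow> tangent r v \<Longrightarrow>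
        curv p w / H p - eps * barrier p \<le> curv r v / H r - eps * barrier r"
      by (rule attains_min_tangent[of eps]) blast
    define m where "m = curv p w / H p"
    \<comment> \<open>The pinching defect; the test inequality becomes 1 + H P th <= 0.\<close>
    define th where "th = 1 - (real CARD('n) - 1) * S p / (H p)\<^sup>2"
    note Hp = H_gt_0[OF p]
    have "m \<ge> 0" using curv_bounds(1)[OF p w] Hp by (simp add: m_def)
    have min': "curv p w \<le> curv p v" if "tangent p v" for v
      using min[OF p that] Hp by (simp add: divide_le_cancel)
    have "m * H p - S p / H p \<le> 0"
      using curv_minimal_le[OF p w min'] Hp by (simp add: m_def pos_le_divide_eq)
    then have "lam * m * (m * H p - S p / H p) \<le> 0"
      using lam_pos \<open>m \<ge> 0\<close> by (intro mult_nonneg_nonpos) auto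
    with test_inequality[OF p w _ min] eps(1)
    have "eps * (1 + H p * (x p \<bullet> \<xi> p) - (real CARD('n) - 1) * S p * (x p \<bullet> \<xi> p) / H p) \<le> 0"
      unfolding m_def by linarith
    then have "1 + H p * (x p \<bullet> \<xi> p) - (real CARD('n) - 1) * S p * (x p \<bullet> \<xi> p) / H p \<le> 0"
      using eps(1) by (simp add: mult_le_0_iff)
    moreover have "(H p * (x p \<bullet> \<xi> p)) * th = H p * (x p \<bullet> \<xi> p) - (real CARD('n) - 1) * S p * (x p \<bullet> \<xi> p) / H p"
      using Hp by (simp add: th_def field_simps power2_eq_square)
    ultimately have "1 \<le> \<bar>H p * (x p \<bullet> \<xi> p)\<bar> * \<bar>th\<bar>"
      unfolding abs_mult[symmetric] by linarith
    also have "\<dots> \<le> C * \<bar>th\<bar>" using C(2)[OF p] by (intro mult_right_mono) auto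
    also have "\<bar>th\<bar> \<le> 2 * m"
    proof -
      have "th * (H p)\<^sup>2 = (H p)\<^sup>2 - (real CARD('n) - 1) * S p" using Hp by (simp add: th_def field_simps)
      then have "0 \<le> th * (H p)\<^sup>2" "th * (H p)\<^sup>2 \<le> (2 * m) * (H p)\<^sup>2"
        using pinched[OF p] curv_bounds(2)[OF p w] Hp unfolding m_def H_def S_def
        by (auto simp: power2_eq_square)
      then show ?thesis using Hp by (simp add: zero_le_mult_iff)
    qed
    finally have "1 / (2 * C) \<le> m" using C(1) by (simp add: field_simps)
    also have "m \<le> curv r v / H r + eps * (barrier p - barrier r)"
      using min[OF r] by (simp add: m_def algebra_simps)
    also have "eps * (barrier p - barrier r) \<le> eps * (2 * D)"
      using D(2)[OF p] D(2)[OF r(1)] eps(1) by (intro mult_left_mono) auto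
    finally show ?thesis using eps(2) by (simp add: mult_ac)
  qed
  have "1 / (2 * C) \<le> curv r v / H r" if "r \<in> topspace M" "tangent r v" for r v
    by (rule field_le_epsilon) (rule approx[OF that])
  then show ?thesis using C(1) by (intro that[of "1 / (2 * C)"]) auto
qed

text \<open>The unperturbed minimum is shown to have the value 1/n. Since the diagonal entries in an
  orthonormal frame average to H/n, a lower bound H/n for all directions leaves no room at any
  point.\<close>

lemma curv_eq:
  assumes p: "p \<in> topspace M" and w: "tangent p w"
  shows "curv p w = H p / real CARD('n)"
proof -
  fix e :: 'n
  obtain b where b: "b > 0" "\<And>p w. p \<in> topspace M \<Longrightarrow> tangent p w \<Longrightarrow> b \<le> curv p w / H p"
    by (rule curv_bounded_below) blast
  obtain q u where q: "q \<in> topspace M" and u: "tangent q u" and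
    min: "\<And>r v. r \<in> topspace M \<Longrightarrow> tangent r v \<Longrightarrow>
      curv q u / H q - 0 * barrier q \<le> curv r v / H r - 0 * barrier r"
    by (rule attains_min_tangent[of 0]) blast
  note Hq = H_gt_0[OF q]
  define K where "K = curv q u"
  \<comment> \<open>Strict positivity is what the uniform lower bound provides; without it the
    factor \<open>lam * m\<close> could not be cancelled from the test inequality.\<close>
  have m: "K / H q > 0" using b(1) b(2)[OF q u] unfolding K_def by linarith
  have K: "K > 0" using m Hq by (simp add: zero_less_divide_iff)
  have min': "K \<le> curv q v" if "tangent q v" for v
    using min[OF q that] Hq by (simp add: divide_le_cancel K_def)
  have "0 \<le> lam * (K / H q) * (K / H q * H q - S q / H q)"
    using test_inequality[OF q u _ min] by (simp add: K_def)
  then have "0 \<le> K / H q * H q - S q / H q"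
    using mult_pos_pos[OF lam_pos m] unfolding zero_le_mult_iff[of "lam * (K / H q)"] by linarith
  \<comment> \<open>The reverse of the bound in \<open>curv_minimal_le\<close>. It makes the sum of
    the nonnegative terms a_i (a_i - K) nonpositive, so each of them is zero.\<close>
  then have SK: "S q \<le> K * H q" using Hq by (simp add: pos_divide_le_eq)
  obtain a where "a e = curv q u" and a: "\<And>i. \<exists>v. tangent q v \<and> a i = curv q v"
      "H q = (\<Sum>i\<in>UNIV. a i)" "(\<Sum>i\<in>UNIV. (a i)\<^sup>2) \<le> S q"
    by (rule frame_diagonal[OF q u, of e]) (rule that)
  have aK: "K \<le> a i" for i using a(1)[of i] min' by auto
  have nonneg: "0 \<le> a i * (a i - K)" for i using aK[of i] K by (intro mult_nonneg_nonneg) auto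
  have "(\<Sum>i\<in>UNIV. a i * (a i - K)) = (\<Sum>i\<in>UNIV. (a i)\<^sup>2) - K * H q"
    unfolding a(2) by (simp add: right_diff_distrib sum_subtractf power2_eq_square sum_distrib_left mult.commute)
  then have "(\<Sum>i\<in>UNIV. a i * (a i - K)) = 0"
    using a(3) SK sum_nonneg[of UNIV "\<lambda>i. a i * (a i - K)"] nonneg by simp
  then have "a i * (a i - K) = 0" for i
    using sum_nonneg_eq_0_iff[of "UNIV :: 'n set" "\<lambda>i. a i * (a i - K)"] nonneg by simp
  then have "a i = K" for i using aK[of i] K by (metis less_irrefl mult_eq_0_iff order_less_le_trans right_minus_eq)
  then have "H q = real CARD('n) * K" using a(2) by simp
  then have mq: "K / H q = 1 / real CARD('n)" using K by simp
  have lower: "H p / real CARD('n) \<le> curv p v" if "tangent p v" for v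
    using min[OF p that] H_gt_0[OF p] unfolding K_def[symmetric] mq by (simp add: field_simps)
  obtain d where d: "d e = curv p w" "\<And>i. \<exists>v. tangent p v \<and> d i = curv p v" "H p = (\<Sum>i\<in>UNIV. d i)"
      "(\<Sum>i\<in>UNIV. (d i)\<^sup>2) \<le> S p"
    by (rule frame_diagonal[OF p w, of e]) (rule that)
  have "(\<Sum>i\<in>UNIV. d i - H p / real CARD('n)) = 0"
    by (simp add: sum_subtractf d(3)[symmetric])
  moreover have "0 \<le> d i - H p / real CARD('n)" for i using d(2)[of i] lower by auto
  ultimately have "d e - H p / real CARD('n) = 0"
    using sum_nonneg_eq_0_iff[of "UNIV :: 'n set" "\<lambda>i. d i - H p / real CARD('n)"] by simp
  then show ?thesis using d(1) by simp
qed

text \<open>By \<open>curv_eq\<close> every unit tangent direction is minimal, hence an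
  eigendirection, and the off-diagonal entries vanish.\<close>

lemma umbilic:
  assumes p: "p \<in> topspace M" and w: "tangent p w"
  shows "shape p *v w = (H p / real CARD('n)) *\<^sub>R w" "S p = (H p)\<^sup>2 / real CARD('n)"
proof -
  fix e :: 'n
  obtain E where E: "E e = w" "\<And>i. tangent p (E i)" "\<And>i j. i \<noteq> j \<Longrightarrow> E i \<bullet> E j = 0"
    "\<And>i j. E i \<bullet> (shape p *v E j) = E j \<bullet> (shape p *v E i)"
    and "H p = (\<Sum>i\<in>UNIV. curv p (E i))" and E': "S p = (\<Sum>i\<in>UNIV. \<Sum>j\<in>UNIV. (E i \<bullet> (shape p *v E j))\<^sup>2)"
    "\<And>i. shape p *v E i = (\<Sum>l\<in>UNIV. (E i \<bullet> (shape p *v E l)) *\<^sub>R E l)"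
    by (rule orthonormal_frame[OF assms, of e]) (rule that)
  have off: "E i \<bullet> (shape p *v E j) = 0" if "i \<noteq> j" for i j
    by (rule minimal_direction_is_eigenvector[OF E(2) E(2) E(3)[OF that] E(4)])
      (simp add: curv_eq[OF p E(2)] curv_eq[OF p])
  have k: "E i \<bullet> (shape p *v E j) = (if i = j then H p / real CARD('n) else 0)" for i j
    using off[of i j] curv_eq[OF p E(2)[of i]] by (auto simp: curv_def)
  show "shape p *v w = (H p / real CARD('n)) *\<^sub>R w"
    using E'(2)[of e] unfolding k by (simp add: E(1) if_distrib[of "\<lambda>c. c *\<^sub>R _"] cong: if_cong)
  show "S p = (H p)\<^sup>2 / real CARD('n)"
    unfolding E'(1) k if_distrib[of "\<lambda>c. c\<^sup>2"] by (simp add: power2_eq_square cong: if_cong)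
qed

section \<open>From umbilic to a full round sphere\<close>

lemma locally_constant_imp_constant:
  fixes f :: "'p \<Rightarrow> real"
  assumes cont: "continuous_map M euclidean f"
    and der: "\<And>c u. c \<in> A \<Longrightarrow> u \<in> coords c \<Longrightarrow> (local_expr c f has_derivative (\<lambda>v. 0)) (at u)"
    and p: "p \<in> topspace M" and q: "q \<in> topspace M"
  shows "f p = f q"
proof -
  define Z where "Z = {r \<in> topspace M. f r \<in> {f p}}"
  have "closedin M Z"
    unfolding Z_def by (rule closedin_continuous_map_preimage[OF cont]) simp
  moreover have "openin M Z"
  proof -
    have "openin M {r \<in> fst c. f r = f p}" if c: "c \<in> A" for c
    proof -
      have "open {u \<in> coords c. local_expr c f u = f p}"
        unfolding open_contains_ball
      proof safe
        fix u assume u: "u \<in> coords c" "local_expr c f u = f p"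
        obtain d where d: "d > 0" "ball u d \<subseteq> coords c" using open_coords[OF c] u(1) by (meson openE)
        have "local_expr c f v = local_expr c f u" if "v \<in> ball u d" for v
        proof -
          have "(local_expr c f has_derivative (\<lambda>h. 0)) (at v within ball u d)" if "v \<in> ball u d" for v
            using der[OF c] d(2) that by (meson has_derivative_at_withinI subsetD)
          then have "\<exists>k. \<forall>v\<in>ball u d. local_expr c f v = k"
            by (rule has_derivative_zero_constant[OF convex_ball])
          then show ?thesis using that d(1) by force
        qed
        then show "\<exists>e>0. ball u e \<subseteq> {u \<in> coords c. local_expr c f u = f p}"
          using d u(2) by (intro exI[of _ d]) auto
      qed
      then have "openin (top_of_set (coords c)) {u \<in> coords c. local_expr c f u = f p}"
        by (simp add: openin_open_eq open_coords[OF c])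
      then have "openin (subtopology M (fst c)) {r \<in> topspace (subtopology M (fst c)). snd c r \<in> {u \<in> coords c. local_expr c f u = f p}}"
        by (rule openin_continuous_map_preimage[OF homeomorphic_imp_continuous_map[OF chart_homeo[OF c]]])
      also have "{r \<in> topspace (subtopology M (fst c)). snd c r \<in> {u \<in> coords c. local_expr c f u = f p}} = {r \<in> fst c. f r = f p}"
        using chart_subset[OF c] imageI[of _ "fst c" "snd c"]
        by (auto simp: local_expr_apply[OF c] coords_eq[OF c, symmetric])
      finally show ?thesis using chart_open[OF c] openin_trans_full by blast
    qed
    then have "openin M (\<Union>c\<in>A. {r \<in> fst c. f r = f p})" by blast
    also have "(\<Union>c\<in>A. {r \<in> fst c. f r = f p}) = Z"
      using manifold by (auto simp: smooth_manifold_def Z_def)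
    finally show ?thesis .
  qed
  ultimately have "Z = {} \<or> Z = topspace M"
    using connected by (simp add: connected_space_clopen_in)
  moreover have "p \<in> Z" using p by (simp add: Z_def)
  ultimately have "q \<in> Z" using q by blast
  then show ?thesis by (simp add: Z_def)
qed

text \<open>Umbilicity says dN = -(f/n) dX with f = H. Symmetry of the second derivatives of N and X
  forces df = 0. The differentiated expander equation then makes <X, dN> vanish, and since f > 0 so
  does <X, dX>.\<close>

lemma x_normal:
  assumes c: "c \<in> A" and u: "u \<in> coords c"
  shows "local_expr c x u \<bullet> partial i (local_expr c x) u = 0"
proof -
  define X where "X = local_expr c x"
  define N where "N = local_expr c \<xi>"
  interpret patch "coords c" X N unfolding X_def N_def by (rule patch_chart[OF c])
  \<comment> \<open>\<open>H\<close> in the chart, written through the expander equation so that its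
    smoothness and derivative are immediate.\<close>
  define f where "f u = lam + 1/2 * (X u \<bullet> N u)" for u
  note d = smooth_on_differentiable
  have sf: "smooth_on (coords c) f"
    unfolding f_def[abs_def] by (intro smooth_on_add smooth_on_mult smooth_on_inner open_U smooth_Y smooth_N smooth_on_const)
  have dN: "partial k N v = (- 1 / real CARD('n)) *\<^sub>R (f v *\<^sub>R partial k X v)" and fpos: "f v > 0" if v: "v \<in> coords c" for k v
  proof -
    obtain p where p: "p \<in> fst c" "v = snd c p" "p \<in> topspace M" by (rule coords_cases[OF c v])
    have fH: "f v = H p"
      using expander[OF p(3)] by (simp add: f_def X_def N_def p(2) local_expr_apply[OF c p(1)] H_def)
    then show "f v > 0" using H_gt_0[OF p(3)] by simp
    let ?z = "partial k X v"
    have z: "?z \<noteq> 0" using dual_dY[OF v, of k k] by auto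
    have "?z \<bullet> \<xi> p = 0"
      using N_dY[OF v, of k] by (simp add: N_def p(2) local_expr_apply[OF c p(1)] inner_commute)
    from arg_cong[OF umbilic(1)[OF p(3) curv_normalize(1)[OF z this]], of "\<lambda>t. norm ?z *\<^sub>R t"]
    have "shape p *v ?z = (f v / real CARD('n)) *\<^sub>R ?z"
      using z by (simp add: matrix_vector_mult_scaleR fH)
    moreover have "shape p *v ?z = - partial k N v"
      using shape_dY[OF v, of k] shape_chart[OF c p(1)] by (simp add: X_def N_def p(2))
    ultimately have "partial k N v = - ((f v / real CARD('n)) *\<^sub>R ?z)" by (metis minus_minus)
    then show "partial k N v = (- 1 / real CARD('n)) *\<^sub>R (f v *\<^sub>R ?z)" by simp
  qed
  have sfX: "smooth_on (coords c) (\<lambda>v. f v *\<^sub>R partial k X v)" for k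
    by (rule smooth_on_scaleR[OF open_U sf smooth_dY])
  have ddN: "partial j (partial k N) u
      = (- 1 / real CARD('n)) *\<^sub>R (f u *\<^sub>R partial j (partial k X) u + partial j f u *\<^sub>R partial k X u)" for j k
  proof -
    have "partial j (partial k N) u = partial j (\<lambda>v. (- 1 / real CARD('n)) *\<^sub>R (f v *\<^sub>R partial k X v)) u"
      by (rule partial_cong[OF open_U u dN d[OF smooth_dN u]])
    also have "\<dots> = (- 1 / real CARD('n)) *\<^sub>R partial j (\<lambda>v. f v *\<^sub>R partial k X v) u"
      by (subst partial_scaleR[OF differentiable_const d[OF sfX u]]) simp
    also have "partial j (\<lambda>v. f v *\<^sub>R partial k X v) u = f u *\<^sub>R partial j (partial k X) u + partial j f u *\<^sub>R partial k X u"
      by (rule partial_scaleR[OF d[OF sf u] d[OF smooth_dY u]])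
    finally show ?thesis .
  qed
  \<comment> \<open>A second direction, available because n >= 2; the symmetry of second derivatives
    carries no information when both indices agree.\<close>
  obtain k where k: "k \<noteq> i"
  proof -
    have "\<exists>k. k \<noteq> i"
    proof (rule ccontr)
      assume "\<nexists>k. k \<noteq> i"
      then have "UNIV = {i}" by auto
      then have "CARD('n) = 1" using card.insert[of "{}" i] by simp
      with card_n show False by simp
    qed
    with that show thesis by blast
  qed
  have "partial i f u *\<^sub>R partial k X u = partial k f u *\<^sub>R partial i X u"
    using partial_commute[OF open_U smooth_N u, of i k] partial_commute[OF open_U smooth_Y u, of i k]
    unfolding ddN by simp
  \<comment> \<open>Pairing with \<open>dual k u\<close> isolates the coefficient of
    \<open>partial k X u\<close>.\<close>
  from arg_cong[OF this, of "\<lambda>z. dual k u \<bullet> z"] have "partial i f u = 0"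
    using k by (simp add: dual_dY[OF u])
  moreover have "partial i f u = 1/2 * (X u \<bullet> partial i N u)"
  proof -
    have "partial i f u = partial i (\<lambda>v. 1/2 * (X v \<bullet> N v)) u"
      unfolding f_def[abs_def]
      by (subst partial_add[OF differentiable_const d[OF smooth_on_mult[OF open_U smooth_on_const smooth_on_inner[OF open_U smooth_Y smooth_N]] u]]) simp
    also have "\<dots> = 1/2 * partial i (\<lambda>v. X v \<bullet> N v) u"
      by (subst partial_mult[OF differentiable_const d[OF smooth_on_inner[OF open_U smooth_Y smooth_N] u]]) simp
    finally show ?thesis
      by (simp add: partial_inner diff_Y[OF u] diff_N[OF u] inner_commute[of "partial i X u"] N_dY[OF u])
  qed
  ultimately have "X u \<bullet> partial i X u = 0"
    unfolding dN[OF u] using fpos[OF u] by simp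
  then show ?thesis by (simp add: X_def)
qed

lemma not_constant_x:
  assumes "\<And>p. p \<in> topspace M \<Longrightarrow> x p = a"
  shows False
proof -
  obtain p where p: "p \<in> topspace M" using nonempty by blast
  define c where "c = chart_at A p"
  have c: "c \<in> A" "p \<in> fst c" using chart_at[OF p] by (auto simp: c_def)
  interpret patch "coords c" "local_expr c x" "local_expr c \<xi>" by (rule patch_chart[OF c(1)])
  have u: "snd c p \<in> coords c" using c by (simp add: coords_eq)
  have eq: "local_expr c x v = a" if "v \<in> coords c" for v
    using that by (rule coords_cases[OF c(1)]) (simp add: local_expr_apply[OF c(1)] assms)
  fix k :: 'n
  have "partial k (local_expr c x) (snd c p) = partial k (\<lambda>v. a) (snd c p)"
    by (rule partial_cong[OF open_U u eq diff_Y[OF u]])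
  then show False using dual_dY[OF u, of k k] by simp
qed

lemma norm_x_constant:
  assumes "p \<in> topspace M" "q \<in> topspace M"
  shows "x p \<bullet> x p = x q \<bullet> x q"
proof (rule locally_constant_imp_constant[OF continuous_scalar_product[OF continuous_x continuous_x] _ assms])
  fix c u assume c: "c \<in> A" and u: "u \<in> coords c"
  interpret patch "coords c" "local_expr c x" "local_expr c \<xi>" by (rule patch_chart[OF c])
  let ?X = "local_expr c x"
  have eq: "local_expr c (\<lambda>p. x p \<bullet> x p) v = ?X v \<bullet> ?X v" for v
    by (simp add: local_expr_def split: prod.split)
  have "frechet_derivative ?X (at u) v \<bullet> ?X u = 0" for v
    using x_normal[OF c u]
    by (simp add: frechet_derivative_eq_sum_partial[OF diff_Y[OF u]] inner_sum_left inner_commute[of "partial _ _ u"])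
  moreover have "((\<lambda>v. ?X v \<bullet> ?X v) has_derivative
      (\<lambda>v. ?X u \<bullet> frechet_derivative ?X (at u) v + frechet_derivative ?X (at u) v \<bullet> ?X u)) (at u)"
    using diff_Y[OF u] unfolding frechet_derivative_works by (intro has_derivative_inner)
  ultimately show "(local_expr c (\<lambda>p. x p \<bullet> x p) has_derivative (\<lambda>v. 0)) (at u)"
    unfolding eq[abs_def] by (simp add: inner_commute)
qed

lemma round_sphere: "round_sphere_centered_at_origin M x"
proof -
  obtain p0 where p0: "p0 \<in> topspace M" using nonempty by blast
  define r where "r = norm (x p0)"
  have r: "norm (x p) = r" if "p \<in> topspace M" for p
    using norm_x_constant[OF that p0] by (simp add: r_def norm_eq)
  have "r > 0"
  proof (rule ccontr)
    assume "\<not> r > 0"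
    then have "x p = 0" if "p \<in> topspace M" for p using r[OF that] norm_ge_zero[of "x p"] by simp
    then show False by (rule not_constant_x)
  qed
  moreover have "x ` topspace M = sphere 0 r"
  proof
    show "x ` topspace M \<subseteq> sphere 0 r" using r by auto
    show "sphere 0 r \<subseteq> x ` topspace M"
    proof
      fix y :: "real^'m" assume "y \<in> sphere 0 r"
      then have y: "norm y = r" by simp
      have "continuous_map M euclidean (\<lambda>p. x p \<bullet> (- y))"
        by (intro continuous_scalar_product continuous_x) auto
      \<comment> \<open>A minimum of <x, -y>, that is, a maximum of <x, y>.\<close>
      then obtain p where p: "p \<in> topspace M" "\<And>q. q \<in> topspace M \<Longrightarrow> x p \<bullet> (- y) \<le> x q \<bullet> (- y)"
        by (rule attains_min) blast
      define c where "c = chart_at A p"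
      have c: "c \<in> A" "p \<in> fst c" using chart_at[OF p(1)] by (auto simp: c_def)
      interpret patch "coords c" "local_expr c x" "local_expr c \<xi>" by (rule patch_chart[OF c(1)])
      define u where "u = snd c p"
      have u: "u \<in> coords c" using c by (simp add: coords_eq u_def)
      let ?X = "local_expr c x" and ?N = "local_expr c \<xi> u"
      have Xu: "?X u = x p" by (simp add: u_def local_expr_apply[OF c])
      have "?X u \<bullet> (- y) \<le> ?X v \<bullet> (- y)" if "v \<in> coords c" for v
        using that by (rule coords_cases[OF c(1)]) (simp add: Xu p(2) local_expr_apply[OF c(1)] del: inner_minus_right)
      note crit = partial_local_min(1)[OF open_U u smooth_on_inner[OF open_U smooth_Y smooth_on_const] this]
      have yX: "y \<bullet> partial i ?X u = 0" for i
        using crit[of i] unfolding partial_inner[OF diff_Y[OF u] differentiable_const]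
        by (simp add: inner_commute)
      \<comment> \<open>At this point both \<open>y\<close> and \<open>x p\<close> are orthogonal to
        the tangent space, hence multiples of the unit normal; having the same length, they agree up
        to sign.\<close>
      have par: "z = (z \<bullet> ?N) *\<^sub>R ?N" if "\<And>i. z \<bullet> partial i ?X u = 0" for z
      proof -
        have "z \<bullet> dual i u = 0" for i using that by (simp add: dual_frame_def inner_sum_right)
        then show ?thesis using frame_expansion[OF u, of z] by simp
      qed
      have yN: "y = (y \<bullet> ?N) *\<^sub>R ?N" by (rule par[OF yX])
      have xN: "x p = (x p \<bullet> ?N) *\<^sub>R ?N"
        by (rule par) (use x_normal[OF c(1) u] in \<open>simp add: Xu\<close>)
      have "\<bar>y \<bullet> ?N\<bar> = r" "\<bar>x p \<bullet> ?N\<bar> = r"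
        using arg_cong[OF yN, of norm] arg_cong[OF xN, of norm] y r[OF p(1)] norm_N[OF u] by simp_all
      then have "y \<bullet> ?N = x p \<bullet> ?N \<or> y \<bullet> ?N = - (x p \<bullet> ?N)" by linarith
      then have "y = x p \<or> y = - x p"
        using yN xN by (metis scaleR_minus_left)
      then show "y \<in> x ` topspace M"
      proof
        assume anti: "y = - x p"
        \<comment> \<open>If even the maximum of <x, y> equals -r^2, then |x q + y|^2 <= 0 at every
          point.\<close>
        have "x q = - y" if q: "q \<in> topspace M" for q
        proof -
          have "x q \<bullet> y \<le> x p \<bullet> y" using p(2)[OF q] by simp
          also have "x p \<bullet> y = - (y \<bullet> y)" using anti by simp
          finally have "(x q + y) \<bullet> (x q + y) \<le> x q \<bullet> x q - y \<bullet> y"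
            by (simp add: inner_add_left inner_add_right inner_commute)
          also have "\<dots> = 0" using r[OF q] y by (simp add: dot_square_norm)
          finally have "x q + y = 0" by (metis inner_gt_zero_iff not_le)
          then show ?thesis by (simp add: eq_neg_iff_add_eq_0)
        qed
        then show ?thesis using not_constant_x by blast
      qed (use p(1) in blast)
    qed
  qed
  ultimately show ?thesis unfolding round_sphere_centered_at_origin_def by blast
qed

lemma trace_shape_square: "p \<in> topspace M \<Longrightarrow> trace (shape p ** shape p) = (trace (shape p))\<^sup>2 / real CARD('n)"
  using umbilic(2) unit_tangent_exists unfolding tangent_def S_def H_def by metis

end

text \<open>Formulated for any unit normal with positive mean curvature, so that it applies to
  \<open>\<xi>\<close> and to its negative alike.\<close>

lemma pinched_expander_is_round_sphere:
  fixes M :: "'p topology" and A :: "('p, 'n::finite) chart set"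
    and x \<xi> :: "'p \<Rightarrow> real^'m::finite" and lam :: real
  assumes "CARD('n) \<ge> 2" and "CARD('m) = CARD('n) + 1"
    and "smooth_manifold M A" "compact_space M" "connected_space M" "topspace M \<noteq> {}"
    and "smooth_immersion A x" "unit_normal_field M A x \<xi>" "self_expander M A x \<xi> lam"
    and pos: "\<And>p. p \<in> topspace M \<Longrightarrow> mean_curvature A x \<xi> p > 0"
    and pinch: "\<And>p. p \<in> topspace M \<Longrightarrow> scalar_curvature A x p
      \<ge> (real CARD('n) - 2) / (real CARD('n) - 1) * (mean_curvature A x \<xi> p)\<^sup>2"
  shows "(\<forall>p\<in>topspace M. scalar_curvature A x p
             = (real CARD('n) - 1) / real CARD('n) * (mean_curvature A x \<xi> p)\<^sup>2)
         \<and> round_sphere_centered_at_origin M x"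
proof -
  interpret I: immersed_hypersurface M A x \<xi> by unfold_locales fact+
  interpret closed_pinched_expander M A x \<xi> lam
  proof
    fix p assume p: "p \<in> topspace M"
    show "trace (I.shape p) = lam + (x p \<bullet> \<xi> p) / 2"
      using \<open>self_expander M A x \<xi> lam\<close> p I.mean_curvature_eq[OF p] by (auto simp: self_expander_def)
    show "trace (I.shape p) > 0" using pos[OF p] I.mean_curvature_eq[OF p] by simp
    have "(real CARD('n) - 2) / (real CARD('n) - 1) * (trace (I.shape p))\<^sup>2
        \<le> (trace (I.shape p))\<^sup>2 - trace (I.shape p ** I.shape p)"
      \<comment> \<open>With R = H^2 - S, the lower bound on R is (n-1) S <= H^2 after
        multiplication by n - 1 > 0.\<close>
      using pinch[OF p] I.mean_curvature_eq[OF p] I.scalar_curvature_eq[OF p] by simp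
    then show "(real CARD('n) - 1) * trace (I.shape p ** I.shape p) \<le> (trace (I.shape p))\<^sup>2"
      using assms(1) by (simp add: field_simps)
  qed fact+
  have "scalar_curvature A x p = (real CARD('n) - 1) / real CARD('n) * (mean_curvature A x \<xi> p)\<^sup>2"
    if p: "p \<in> topspace M" for p
    using I.mean_curvature_eq[OF p] I.scalar_curvature_eq[OF p] trace_shape_square[OF p]
    by (simp add: field_simps)
  then show ?thesis using round_sphere by blast
qed

section \<open>Reversal of the normal and the final statement\<close>

lemma partial_uminus:
  "f differentiable (at u) \<Longrightarrow> partial i (\<lambda>x. - f x) u = - partial i f u"
  using partial_scaleR[OF differentiable_const, of f u i "- 1"] by simp

lemma local_expr_uminus: "local_expr c (\<lambda>p. - f p) = (\<lambda>u. - local_expr c f u)"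
  by (auto simp: local_expr_def split: prod.split)

lemma smooth_on_uminus:
  "open S \<Longrightarrow> smooth_on S f \<Longrightarrow> smooth_on S (\<lambda>u. - f u)"
  using smooth_on_scaleR[of S "\<lambda>u. - 1" f] by simp

lemma (in immersed_hypersurface) unit_normal_field_uminus: "unit_normal_field M A x (\<lambda>p. - \<xi> p)"
  using normal smooth_on_uminus[OF open_coords]
  by (auto simp: unit_normal_field_def smooth_map_def local_expr_uminus)

lemma (in immersed_hypersurface) mean_curvature_uminus:
  assumes "p \<in> topspace M"
  shows "mean_curvature A x (\<lambda>p. - \<xi> p) p = - mean_curvature A x \<xi> p"
proof -
  have c: "chart_at A p \<in> A" "snd (chart_at A p) p \<in> coords (chart_at A p)"
    using chart_at[OF assms] by (auto simp: coords_eq)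
  interpret patch "coords (chart_at A p)" "local_expr (chart_at A p) x" "local_expr (chart_at A p) \<xi>"
    by (rule patch_chart[OF c(1)])
  show ?thesis
    by (simp add: mean_curvature_def Let_def local_expr_uminus second_fundamental_form_def metric_trace_def
        partial_uminus[OF diff_N[OF c(2)]] sum_negf)
qed

theorem theorem1p2:
  fixes M :: "'p topology"
    and A :: "('p, 'n::finite) chart set"
    and x \<xi> :: "'p \<Rightarrow> real^'m::finite"
    and lam :: real
  assumes "CARD('n) \<ge> 2"
    and "CARD('m) = CARD('n) + 1"
    and "smooth_manifold M A"
    and "compact_space M"
    and "connected_space M"
    and "topspace M \<noteq> {}"
    and "smooth_immersion A x"
    and "inward_unit_normal_field M A x \<xi>"
    and "self_expander M A x \<xi> lam"
    and "\<forall>p\<in>topspace M.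
           scalar_curvature A x p
             \<ge> (real CARD('n) - 2) / (real CARD('n) - 1) * (mean_curvature A x \<xi> p)\<^sup>2
           \<and> (real CARD('n) - 2) / (real CARD('n) - 1) * (mean_curvature A x \<xi> p)\<^sup>2 > 0"
  shows "(\<forall>p\<in>topspace M.
           scalar_curvature A x p
             = (real CARD('n) - 1) / real CARD('n) * (mean_curvature A x \<xi> p)\<^sup>2)
         \<and> round_sphere_centered_at_origin M x"
proof -
  let ?n = "real CARD('n)" and ?H = "mean_curvature A x \<xi>"
  have normal: "unit_normal_field M A x \<xi>"
    using assms(8) by (simp add: inward_unit_normal_field_def)
  interpret immersed_hypersurface M A x \<xi> by unfold_locales (fact normal assms)+
  have nz: "?H p \<noteq> 0" if "p \<in> topspace M" for p using assms(10) that by force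
  have expander: "?H p = lam + 1/2 * (x p \<bullet> \<xi> p)" if "p \<in> topspace M" for p
    using assms(9) that by (auto simp: self_expander_def)
  \<comment> \<open>\<open>mean_curvature\<close> selects a chart point by point, so its continuity
    is obtained through \<open>shape\<close>. Being nowhere zero on a connected space, it has a
    constant sign.\<close>
  have "continuous_map M euclidean (\<lambda>p. trace (shape p))"
    unfolding trace_def by (intro continuous_map_sum continuous_shape) auto
  then have "connectedin euclidean ((\<lambda>p. trace (shape p)) ` topspace M)"
    using assms(5) by (intro connectedin_continuous_map_image) (auto simp: connectedin_topspace)
  moreover have "(\<lambda>p. trace (shape p)) ` topspace M = ?H ` topspace M"
    using mean_curvature_eq by (intro image_cong) auto
  ultimately have "connected (?H ` topspace M)" by simp
  then have interval: "c \<in> ?H ` topspace M" if "a \<in> ?H ` topspace M" "b \<in> ?H ` topspace M" "a \<le> c" "c \<le> b" for a b c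
    using that by (meson connectedD_interval)
  have "(\<forall>p\<in>topspace M. ?H p > 0) \<or> (\<forall>p\<in>topspace M. ?H p < 0)"
  proof (rule ccontr)
    assume "\<not> ?thesis"
    then obtain p q where "p \<in> topspace M" "q \<in> topspace M" "?H p < 0" "?H q > 0"
      using nz by (metis linorder_neqE_linordered_idom)
    then have "0 \<in> ?H ` topspace M" using interval[of "?H p" "?H q" 0] by auto
    then show False using nz by auto
  qed
  then show ?thesis
  proof
    assume "\<forall>p\<in>topspace M. ?H p > 0"
    then show ?thesis
      using assms normal by (intro pinched_expander_is_round_sphere[where \<xi> = \<xi> and lam = lam]) auto
  next
    assume neg: "\<forall>p\<in>topspace M. ?H p < 0"
    \<comment> \<open>Reversing the normal changes the sign of both the mean curvature and <x,
      \<xi>>, hence of \<open>lam\<close>. The scalar curvature depends on \<open>x\<close> alone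
      and the conclusion contains only the square of the mean curvature, so it carries back
      unchanged.\<close>
    have "self_expander M A x (\<lambda>p. - \<xi> p) (- lam)"
      using expander mean_curvature_uminus by (auto simp: self_expander_def)
    then have "(\<forall>p\<in>topspace M. scalar_curvature A x p
             = (?n - 1) / ?n * (mean_curvature A x (\<lambda>p. - \<xi> p) p)\<^sup>2)
         \<and> round_sphere_centered_at_origin M x"
      using assms neg mean_curvature_uminus unit_normal_field_uminus
      by (intro pinched_expander_is_round_sphere[where lam = "- lam"]) auto
    then show ?thesis using mean_curvature_uminus by simp
  qed
qed

end
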